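(* Let $\mathcal H_1,\dots,\mathcal H_n$ be complex Banach spaces and let $\mathcal P(\lambda)=[P_{j,i}(\lambda)]_{j,i=1}^n$, defined on its natural domain in $\bigoplus_{i=1}^n\mathcal H_i$, be an operator matrix polynomial with $P_{j,i}(\lambda)=\sum_{k=0}^{d_{j,i}}\lambda^kP_{j,i}^{(k)}$, $P_{j,i}^{(k)}\in\mathcal L(\mathcal H_i,\mathcal H_j)$ (and $P_{j,i}^{(k)}:=0$ for $k>d_{j,i}$). Assume that $d_i:=d_{i,i}>0$ and $d_i>d_{j,i}$ for $j\ne i$, that each $P_{i,i}^{(d_i)}$ is invertible, and that there exist $l_i\in\{0,\dots,d_i\}$ such that $P_{j,i}^{(k)}\in\mathcal B(\mathcal H_i,\mathcal H_j)$ for all $j$ and all $k\neq l_i$. For $0\le k<d_i$ and all $j$ set $\widehat P_{j,i}^{(k)}:=(P_{j,j}^{(d_j)})^{-1}P_{j,i}^{(k)}$. If $l_i=d_i$ for some $i$, assume that $\overline{\widehat P_{i,j}^{(k)}}\in\mathcal B(\mathcal H_j,\mathcal H_i)$ for all $j$ and $k$. Let $\Omega:=\mathbb C$ if $l_i=0$ for all $i$, and $\Omega:=\mathbb C\setminus\{0\}$ otherwise. Let $\mathcal T=[T_{j,i}]_{j,i=1}^n\in\mathcal L\big(\bigoplus_{i=1}^n\mathcal H_i^{d_i}\big)$ on its natural domain, where $$T_{i,i}=\begin{bmatrix} -\widehat P_{i,i}^{(d_i-1)} & \cdots & -\widehat P_{i,i}^{(1)} & -\widehat P_{i,i}^{(0)}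 \\ I_{\mathcal H_i} & & & \\ & \ddots & & \\ & & I_{\mathcal H_i} & \end{bmatrix},\qquad T_{j,i}=\begin{bmatrix} -\widehat P_{j,i}^{(d_i-1)} & \cdots & -\widehat P_{j,i}^{(1)} & -\widehat P_{j,i}^{(0)} \\ 0 & \cdots & 0 & 0 \end{bmatrix}\ (j\neq i).$$ Let $\mathcal W(\lambda)=\bigoplus_{i=1}^nW_i(\lambda)$ with $W_i(\lambda)=I_{\mathcal H_i^{d_i-l_i-1}}\oplus N_i(\lambda)\in\mathcal B(\mathcal H_i^{\max(d_i-1,l_i)})$, where $N_i(\lambda)$ is the $l_i\times l_i$ operator matrix with $-\lambda$ on the diagonal and $I_{\mathcal H_i}$ on the first subdiagonal. Let $L:=\{i: l_i=d_i\}$. Then: (i) if $L=\emptyset$, $\mathcal P(\lambda)\oplus\mathcal W(\lambda)$ is equivalent to $\mathcal T-\lambda$ on $\Omega$; (ii) if $L\ne\emptyset$, $\mathcal P(\lambda)\oplus\mathcal W(\lambda)$ is equivalent to $\mathcal P_d\oplus(\mathcal T-\lambda)$ on $\Omega$, where $\mathcal P_d:=\bigoplus_{i\in L}P_{i,i}^{(d_i)}\in\mathcal L(\bigoplus_{i\in L}\mathcal H_i)$ on its natural domain. Moreover, if $L=\emptyset$, let $\mathcal P_{\rm ext}(\lambda)$ be $\mathcal P(\lambda)\oplus\mathcal W(\lambda)$ with the spaces reordered as $\bigoplus_{i=1}^n(\mathcal H_i\oplus\mathcal H_i^{d_i-1})$, i.e. with $(i,i)$ block $P_{i,i}(\lambda)\oplus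 W_i(\lambda)$ and $(j,i)$ block $\begin{bmatrix} P_{j,i}(\lambda) & 0 \\ 0 & 0 \end{bmatrix}$ for $j\ne i$. Then for all $\lambda\in\Omega$ $$\mathcal P_{\rm ext}(\lambda)=\mathcal E(\lambda)(\mathcal T-\lambda)\mathcal F(\lambda),\qquad\mathcal D(\mathcal P_{\rm ext}(\lambda))=\mathcal F(\lambda)^{-1}\mathcal D(\mathcal T),$$ with bounded invertible $\mathcal E(\lambda)=[E_{j,i}(\lambda)]_{j,i=1}^n$ and $\mathcal F(\lambda)=\operatorname{diag}(F_1(\lambda),\dots,F_n(\lambda))$ given by: if $l_i=0$, $E_{i,i}=E_i^{(\alpha)}$, $F_i=F_i^{(\alpha)}$, $E_{j,i}=E_{j,i}^{(\alpha)}$ $(j\ne i)$; if $l_i>0$, $$E_{i,i}=\begin{bmatrix} E_i^{(\alpha)} & E_i^{(\beta)} \\ 0 & I_{\mathcal H_i^{l_i}} \end{bmatrix},\quad F_i=\begin{bmatrix} F_i^{(\alpha)} & 0 \\ F_i^{(\beta)} & I_{\mathcal H_i^{l_i}} \end{bmatrix},\quad E_{j,i}=\begin{bmatrix} E_{j,i}^{(\alpha)} & E_{j,i}^{(\beta)} \end{bmatrix}\ (j\neq i),$$ where, on $\mathcal H_i^{d_i-l_i}$, $$E_i^{(\alpha)}(\lambda)=\begin{bmatrix} -P_{i,i}^{(d_i)} & -\sum_{k=0}^1\lambda^kP_{i,i}^{(d_i-1+k)} & \cdots & -\sum_{k=0}^{d_i-l_i-1}\lambda^kP_{i,i}^{(l_i+1+k)}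 \\ & I_{\mathcal H_i} & \cdots & \lambda^{d_i-l_i-2} \\ & & \ddots & \vdots \\ & & & I_{\mathcal H_i} \end{bmatrix},\quad F_i^{(\alpha)}(\lambda)=\begin{bmatrix} \lambda^{d_i-1} & I_{\mathcal H_i} & & \\ \vdots & & \ddots & \\ \lambda^{l_i+1} & & & I_{\mathcal H_i} \\ \lambda^{l_i} & & & \end{bmatrix}$$ (so $E_i^{(\alpha)}=-P_{i,i}^{(d_i)}$, $F_i^{(\alpha)}=\lambda^{d_i-1}$ if $l_i=d_i-1$); $E_{j,i}^{(\alpha)}(\lambda):\mathcal H_i^{d_i-l_i}\to\mathcal H_j^{d_j}$ has first row $$\begin{bmatrix} 0 & -P_{j,i}^{(d_i-1)} & -\sum_{k=0}^{1}\lambda^kP_{j,i}^{(d_i-2+k)} & \cdots & -\sum_{k=0}^{d_i-l_i-2}\lambda^kP_{j,i}^{(l_i+1+k)} \end{bmatrix}$$ and zero other rows ($E_{j,i}^{(\alpha)}=0$ if $l_i=d_i-1$); and for $l_i>0$, $E_i^{(\beta)}(\lambda):\mathcal H_i^{l_i}\to\mathcal H_i^{d_i-l_i}$ and $E_{j,i}^{(\beta)}(\lambda):\mathcal H_i^{l_i}\to\mathcal H_j^{d_j}$ have first rows $$\Big[\sum_{k=0}^{l_i-1}\tfrac{P_{i,i}^{(k)}}{\lambda^{l_i-k}}\ \cdots\ \sum_{k=0}^1\tfrac{P_{i,i}^{(k)}}{\lambda^{2-k}}\ \ \tfrac{P_{i,i}^{(0)}}{\lambda}\Big]\quad\text{and}\quad\Big[\sum_{k=0}^{l_i-1}\tfrac{P_{j,i}^{(k)}}{\lambda^{l_i-k}}\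 \cdots\ \sum_{k=0}^1\tfrac{P_{j,i}^{(k)}}{\lambda^{2-k}}\ \ \tfrac{P_{j,i}^{(0)}}{\lambda}\Big]$$ respectively and zero other rows, while $F_i^{(\beta)}(\lambda):\mathcal H_i^{d_i-l_i}\to\mathcal H_i^{l_i}$ has first column $(\lambda^{l_i-1},\dots,\lambda,I_{\mathcal H_i})^\top$ and zero other columns.
   Context: $\mathcal L(\mathcal X,\mathcal Y)$: linear, not necessarily bounded, operators $A$ with domain $\mathcal D(A)\subset\mathcal X$; $\mathcal B(\mathcal X,\mathcal Y)$: everywhere defined bounded operators. $\overline A$ is the closure of $A$. $\mathcal X^m=\bigoplus_{i=1}^m\mathcal X$, with $\mathcal X^m=\{0\}$ for $m\le0$. Invertible means bijective from the domain onto the target space with bounded inverse. Scalars stand for multiples of the identity; blank entries are $0$. The polynomial $P_{j,i}(\lambda)$ has as domain the intersection of the domains of its coefficients. The natural domain of an operator matrix is the direct sum over the columns of the intersection of the domains of the entries in that column. Equivalence: $S:\Omega_S\to\mathcal L(\mathcal X,\mathcal X')$ and $T:\Omega_T\to\mathcal L(\mathcal Y,\mathcal Y')$ are equivalent on $\Omega\subset\Omega_S\cap\Omega_T$ if there are $E:\Omega\to\mathcal B(\mathcal Y',\mathcal X')$, $F:\Omega\to\mathcal B(\mathcal X,\mathcal Y)$, invertible for each $\lambda\in\Omega$, with $S(\lambda)=E(\lambda)T(\lambda)F(\lambda)$ and $\mathcal D(S(\lambda))=F(\lambda)^{-1}\mathcal D(T(\lambda))$. *)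

theory Defs
  imports "HOL-Analysis.Analysis" "HOL-Library.Function_Algebras" "HOL-Library.Product_Plus"
begin

section \<open>Complex vector spaces\<close>

class complex_vector = ab_group_add +
  fixes scaleC :: "complex \<Rightarrow> 'a \<Rightarrow> 'a"  (infixr "*\<^sub>C" 75)
  assumes scaleC_add_right: "c *\<^sub>C (x + y) = c *\<^sub>C x + c *\<^sub>C y"
    and scaleC_add_left: "(b + c) *\<^sub>C x = b *\<^sub>C x + c *\<^sub>C x"
    and scaleC_scaleC: "b *\<^sub>C (c *\<^sub>C x) = (b * c) *\<^sub>C x"
    and scaleC_one: "1 *\<^sub>C x = x"

global_interpretation complex_vector:
  vector_space "scaleC :: complex \<Rightarrow> 'a \<Rightarrow> 'a::complex_vector"
  by unfold_locales (rule scaleC_add_right scaleC_add_left scaleC_scaleC scaleC_one)+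

instantiation complex :: complex_vector
begin
definition scaleC_complex :: "complex \<Rightarrow> complex \<Rightarrow> complex" where
  "scaleC_complex c x = c * x"
instance by standard (simp_all add: scaleC_complex_def algebra_simps)
end

instantiation "fun" :: (type, complex_vector) complex_vector
begin
definition scaleC_fun :: "complex \<Rightarrow> ('a \<Rightarrow> 'b) \<Rightarrow> 'a \<Rightarrow> 'b" where
  "scaleC_fun c f = (\<lambda>i. c *\<^sub>C f i)"
instance by standard
  (simp_all add: scaleC_fun_def plus_fun_def scaleC_add_right scaleC_add_left scaleC_scaleC scaleC_one)
end

instantiation prod :: (complex_vector, complex_vector) complex_vector
begin
definition scaleC_prod :: "complex \<Rightarrow> 'a \<times> 'b \<Rightarrow> 'a \<times> 'b" where
  "scaleC_prod c p = (c *\<^sub>C fst p, c *\<^sub>C snd p)"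
instance by standard
  (simp_all add: scaleC_prod_def scaleC_add_right scaleC_add_left scaleC_scaleC scaleC_one prod_eq_iff)
end


section \<open>Banach spaces and direct sums\<close>

text \<open>
  A normed space is a complex subspace of an ambient complex vector space (a type) together
  with a norm of its own; the ambient type carries no norm.  In this way finitely many
  unrelated Banach spaces can be handled over a single type: every family of complex
  vector spaces embeds into one complex vector space.  The values of the norm off the carrier
  are irrelevant.
\<close>

record 'v nspace =
  carr :: "'v set"
  nrm :: "'v \<Rightarrow> real"

definition complex_normed_space :: "'v::complex_vector nspace \<Rightarrow> bool" where
  "complex_normed_space X \<longleftrightarrow>
     complex_vector.subspace (carr X) \<and>
     (\<forall>x\<in>carr X. nrm X x \<ge> 0) \<and>
     (\<forall>x\<in>carr X. nrm X x = 0 \<longleftrightarrow> x = 0) \<and>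
     (\<forall>x\<in>carr X. \<forall>y\<in>carr X. nrm X (x + y) \<le> nrm X x + nrm X y) \<and>
     (\<forall>c. \<forall>x\<in>carr X. nrm X (c *\<^sub>C x) = cmod c * nrm X x)"

definition complex_banach_space :: "'v::complex_vector nspace \<Rightarrow> bool" where
  "complex_banach_space X \<longleftrightarrow>
     complex_normed_space X \<and>
     (\<forall>f :: nat \<Rightarrow> 'v.
        (\<forall>m. f m \<in> carr X) \<and>
        (\<forall>e>0. \<exists>N. \<forall>p\<ge>N. \<forall>q\<ge>N. nrm X (f p - f q) < e) \<longrightarrow>
        (\<exists>x\<in>carr X. (\<lambda>m. nrm X (f m - x)) \<longlonglongrightarrow> 0))"

text \<open>
  Elements of a direct sum over the finite index set \<open>I\<close> are families that vanish off \<open>I\<close>.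
  The norm is the sum of the norms of the components; any of the usual choices is equivalent.
\<close>

definition dirsum :: "'i set \<Rightarrow> ('i \<Rightarrow> 'v::complex_vector nspace) \<Rightarrow> ('i \<Rightarrow> 'v) nspace" where
  "dirsum I X = \<lparr> carr = {x. (\<forall>i\<in>I. x i \<in> carr (X i)) \<and> (\<forall>i. i \<notin> I \<longrightarrow> x i = 0)},
                nrm = (\<lambda>x. \<Sum>i\<in>I. nrm (X i) (x i)) \<rparr>"

definition spow :: "'v::complex_vector nspace \<Rightarrow> nat \<Rightarrow> (nat \<Rightarrow> 'v) nspace" where
  "spow X m = dirsum {1..m} (\<lambda>_. X)"

definition sprod :: "'v::complex_vector nspace \<Rightarrow> 'w::complex_vector nspace \<Rightarrow> ('v \<times> 'w) nspace" where
  "sprod X Y = \<lparr> carr = carr X \<times> carr Y, nrm = (\<lambda>p. nrm X (fst p) + nrm Y (snd p)) \<rparr>"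


section \<open>Linear operators with domains\<close>

record ('v, 'w) lop =
  odom :: "'v set"
  oapp :: "'v \<Rightarrow> 'w"

definition linear_op :: "'v::complex_vector nspace \<Rightarrow> 'w::complex_vector nspace \<Rightarrow> ('v, 'w) lop \<Rightarrow> bool" where
  "linear_op X Y A \<longleftrightarrow>
     odom A \<subseteq> carr X \<and> complex_vector.subspace (odom A) \<and>
     (\<forall>x\<in>odom A. oapp A x \<in> carr Y) \<and>
     (\<forall>x\<in>odom A. \<forall>y\<in>odom A. oapp A (x + y) = oapp A x + oapp A y) \<and>
     (\<forall>c. \<forall>x\<in>odom A. oapp A (c *\<^sub>C x) = c *\<^sub>C oapp A x)"

definition bounded_op :: "'v::complex_vector nspace \<Rightarrow> 'w::complex_vector nspace \<Rightarrow> ('v, 'w) lop \<Rightarrow> bool" where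
  "bounded_op X Y A \<longleftrightarrow>
     linear_op X Y A \<and> odom A = carr X \<and>
     (\<exists>C. \<forall>x\<in>carr X. nrm Y (oapp A x) \<le> C * nrm X x)"

text \<open>Equality of operators: the values of \<open>oapp\<close> off the domain do not count.\<close>

definition op_eq :: "('v, 'w) lop \<Rightarrow> ('v, 'w) lop \<Rightarrow> bool"  (infix "\<doteq>" 50) where
  "A \<doteq> B \<longleftrightarrow> odom A = odom B \<and> (\<forall>x\<in>odom A. oapp A x = oapp B x)"

definition op_inv :: "('v, 'w) lop \<Rightarrow> ('w, 'v) lop" where
  "op_inv A = \<lparr> odom = oapp A ` odom A, oapp = inv_into (odom A) (oapp A) \<rparr>"

definition op_invertible :: "'v::complex_vector nspace \<Rightarrow> 'w::complex_vector nspace \<Rightarrow> ('v, 'w) lop \<Rightarrow> bool" where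
  "op_invertible X Y A \<longleftrightarrow>
     bij_betw (oapp A) (odom A) (carr Y) \<and> bounded_op Y X (op_inv A)"

definition graph_closure ::
  "'v::complex_vector nspace \<Rightarrow> 'w::complex_vector nspace \<Rightarrow> ('v, 'w) lop \<Rightarrow> ('v \<times> 'w) set" where
  "graph_closure X Y A =
     {(x, y). x \<in> carr X \<and> y \<in> carr Y \<and>
        (\<exists>f :: nat \<Rightarrow> 'v. (\<forall>m. f m \<in> odom A) \<and>
           (\<lambda>m. nrm X (f m - x)) \<longlonglongrightarrow> 0 \<and> (\<lambda>m. nrm Y (oapp A (f m) - y)) \<longlonglongrightarrow> 0)}"

definition closable :: "'v::complex_vector nspace \<Rightarrow> 'w::complex_vector nspace \<Rightarrow> ('v, 'w) lop \<Rightarrow> bool" where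
  "closable X Y A \<longleftrightarrow> single_valued (graph_closure X Y A)"

text \<open>Only meaningful if \<open>A\<close> is closable.\<close>

definition op_closure ::
  "'v::complex_vector nspace \<Rightarrow> 'w::complex_vector nspace \<Rightarrow> ('v, 'w) lop \<Rightarrow> ('v, 'w) lop" where
  "op_closure X Y A = \<lparr> odom = Domain (graph_closure X Y A),
                        oapp = (\<lambda>x. THE y. (x, y) \<in> graph_closure X Y A) \<rparr>"

definition zero_op :: "'v::complex_vector nspace \<Rightarrow> ('v, 'w::complex_vector) lop" where
  "zero_op X = \<lparr> odom = carr X, oapp = (\<lambda>_. 0) \<rparr>"

definition scalar_op :: "'v::complex_vector nspace \<Rightarrow> complex \<Rightarrow> ('v, 'v) lop" where
  "scalar_op X c = \<lparr> odom = carr X, oapp = (\<lambda>x. c *\<^sub>C x) \<rparr>"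

definition scale_op :: "complex \<Rightarrow> ('v, 'w::complex_vector) lop \<Rightarrow> ('v, 'w) lop" where
  "scale_op c A = \<lparr> odom = odom A, oapp = (\<lambda>x. c *\<^sub>C oapp A x) \<rparr>"

definition sum_op ::
  "'v::complex_vector nspace \<Rightarrow> 'k set \<Rightarrow> ('k \<Rightarrow> ('v, 'w::complex_vector) lop) \<Rightarrow> ('v, 'w) lop" where
  "sum_op X K A = \<lparr> odom = {x \<in> carr X. \<forall>k\<in>K. x \<in> odom (A k)},
                    oapp = (\<lambda>x. \<Sum>k\<in>K. oapp (A k) x) \<rparr>"

definition comp_op :: "('u, 'w) lop \<Rightarrow> ('v, 'u) lop \<Rightarrow> ('v, 'w) lop"  (infixr "\<circ>\<^sub>o" 70) where
  "A \<circ>\<^sub>o B = \<lparr> odom = {x \<in> odom B. oapp B x \<in> odom A}, oapp = (\<lambda>x. oapp A (oapp B x)) \<rparr>"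

definition minus_scalar :: "('v::complex_vector, 'v) lop \<Rightarrow> complex \<Rightarrow> ('v, 'v) lop" where
  "minus_scalar A c = \<lparr> odom = odom A, oapp = (\<lambda>x. oapp A x - c *\<^sub>C x) \<rparr>"

definition oplus_op :: "('v, 'v') lop \<Rightarrow> ('w, 'w') lop \<Rightarrow> ('v \<times> 'w, 'v' \<times> 'w') lop"  (infixr "\<oplus>\<^sub>o" 65) where
  "A \<oplus>\<^sub>o B = \<lparr> odom = odom A \<times> odom B, oapp = (\<lambda>p. (oapp A (fst p), oapp B (snd p))) \<rparr>"

definition dirsum_op ::
  "'i set \<Rightarrow> ('i \<Rightarrow> 'v::complex_vector nspace) \<Rightarrow> ('i \<Rightarrow> ('v, 'w::complex_vector) lop) \<Rightarrow> ('i \<Rightarrow> 'v, 'i \<Rightarrow> 'w) lop" where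
  "dirsum_op I X A = \<lparr> odom = {x \<in> carr (dirsum I X). \<forall>i\<in>I. x i \<in> odom (A i)},
                     oapp = (\<lambda>x i. if i \<in> I then oapp (A i) (x i) else 0) \<rparr>"

text \<open>
  The operator matrix with row indices \<open>J\<close>, column indices \<open>I\<close>, column spaces \<open>X\<close> and entries
  \<open>A j i\<close>, on its natural domain.
\<close>

definition matrix_op ::
  "'j set \<Rightarrow> 'i set \<Rightarrow> ('i \<Rightarrow> 'v::complex_vector nspace) \<Rightarrow> ('j \<Rightarrow> 'i \<Rightarrow> ('v, 'w::complex_vector) lop)
     \<Rightarrow> ('i \<Rightarrow> 'v, 'j \<Rightarrow> 'w) lop" where
  "matrix_op J I X A = \<lparr> odom = {x \<in> carr (dirsum I X). \<forall>i\<in>I. \<forall>j\<in>J. x i \<in> odom (A j i)},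
                         oapp = (\<lambda>x j. if j \<in> J then \<Sum>i\<in>I. oapp (A j i) (x i) else 0) \<rparr>"

abbreviation matrix_pow ::
  "nat \<Rightarrow> nat \<Rightarrow> 'v::complex_vector nspace \<Rightarrow> (nat \<Rightarrow> nat \<Rightarrow> ('v, 'w::complex_vector) lop)
     \<Rightarrow> (nat \<Rightarrow> 'v, nat \<Rightarrow> 'w) lop" where
  "matrix_pow p q X \<equiv> matrix_op {1..p} {1..q} (\<lambda>_. X)"

text \<open>
  Juxtaposition of arrays of entries (indices start at 1): \<open>A\<close> has \<open>q\<close> columns in \<open>hcat q A B\<close>
  and \<open>p\<close> rows in \<open>vcat p A C\<close>.
\<close>

definition hcat :: "nat \<Rightarrow> (nat \<Rightarrow> nat \<Rightarrow> 'e) \<Rightarrow> (nat \<Rightarrow> nat \<Rightarrow> 'e) \<Rightarrow> nat \<Rightarrow> nat \<Rightarrow> 'e" where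
  "hcat q A B r c = (if c \<le> q then A r c else B r (c - q))"

definition vcat :: "nat \<Rightarrow> (nat \<Rightarrow> nat \<Rightarrow> 'e) \<Rightarrow> (nat \<Rightarrow> nat \<Rightarrow> 'e) \<Rightarrow> nat \<Rightarrow> nat \<Rightarrow> 'e" where
  "vcat p A C r c = (if r \<le> p then A r c else C (r - p) c)"

definition block22 ::
  "nat \<Rightarrow> nat \<Rightarrow> (nat \<Rightarrow> nat \<Rightarrow> 'e) \<Rightarrow> (nat \<Rightarrow> nat \<Rightarrow> 'e) \<Rightarrow> (nat \<Rightarrow> nat \<Rightarrow> 'e) \<Rightarrow> (nat \<Rightarrow> nat \<Rightarrow> 'e)
     \<Rightarrow> nat \<Rightarrow> nat \<Rightarrow> 'e" where
  "block22 p q A B C D = vcat p (hcat q A B) (hcat q C D)"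

definition zero_ents :: "'v::complex_vector nspace \<Rightarrow> nat \<Rightarrow> nat \<Rightarrow> ('v, 'w::complex_vector) lop" where
  "zero_ents X r c = zero_op X"

definition id_ents :: "'v::complex_vector nspace \<Rightarrow> nat \<Rightarrow> nat \<Rightarrow> ('v, 'v) lop" where
  "id_ents X r c = (if r = c then scalar_op X 1 else zero_op X)"


section \<open>Equivalence of operator functions\<close>

definition equivalent_on ::
  "complex set
     \<Rightarrow> 'v::complex_vector nspace \<Rightarrow> 'v'::complex_vector nspace \<Rightarrow> (complex \<Rightarrow> ('v, 'v') lop)
     \<Rightarrow> 'w::complex_vector nspace \<Rightarrow> 'w'::complex_vector nspace \<Rightarrow> (complex \<Rightarrow> ('w, 'w') lop) \<Rightarrow> bool" where
  "equivalent_on \<Omega> X X' S Y Y' T \<longleftrightarrow>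
     (\<forall>z\<in>\<Omega>. linear_op X X' (S z) \<and> linear_op Y Y' (T z)) \<and>
     (\<exists>E F. \<forall>z\<in>\<Omega>.
        bounded_op Y' X' (E z) \<and> op_invertible Y' X' (E z) \<and>
        bounded_op X Y (F z) \<and> op_invertible X Y (F z) \<and>
        S z \<doteq> E z \<circ>\<^sub>o T z \<circ>\<^sub>o F z \<and>
        odom (S z) = {x \<in> carr X. oapp (F z) x \<in> odom (T z)})"


section \<open>The operator matrix polynomial and its linearization\<close>

text \<open>
  Throughout, \<open>P j i k\<close> is the \<open>k\<close>-th coefficient of the \<open>(j, i)\<close> entry, \<open>deg j i\<close> the degree
  of that entry, \<open>d i\<close> the degree of the \<open>i\<close>-th diagonal entry and \<open>l i\<close> the index of the possibly
  unbounded coefficients in the \<open>i\<close>-th column.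
\<close>

type_synonym 'v coeffs = "nat \<Rightarrow> nat \<Rightarrow> nat \<Rightarrow> ('v, 'v) lop"

definition P_entry ::
  "(nat \<Rightarrow> 'v::complex_vector nspace) \<Rightarrow> (nat \<Rightarrow> nat \<Rightarrow> nat) \<Rightarrow> 'v coeffs \<Rightarrow> complex \<Rightarrow> nat \<Rightarrow> nat \<Rightarrow> ('v, 'v) lop" where
  "P_entry H deg P z j i = sum_op (H i) {0..deg j i} (\<lambda>k. scale_op (z ^ k) (P j i k))"

definition P_mat ::
  "nat \<Rightarrow> (nat \<Rightarrow> 'v::complex_vector nspace) \<Rightarrow> (nat \<Rightarrow> nat \<Rightarrow> nat) \<Rightarrow> 'v coeffs \<Rightarrow> complex
     \<Rightarrow> (nat \<Rightarrow> 'v, nat \<Rightarrow> 'v) lop" where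
  "P_mat n H deg P z = matrix_op {1..n} {1..n} H (P_entry H deg P z)"

definition P_hat :: "(nat \<Rightarrow> nat) \<Rightarrow> 'v coeffs \<Rightarrow> 'v coeffs" where
  "P_hat d P j i k = op_inv (P j j (d j)) \<circ>\<^sub>o P j i k"

definition T_ents ::
  "(nat \<Rightarrow> 'v::complex_vector nspace) \<Rightarrow> (nat \<Rightarrow> nat) \<Rightarrow> 'v coeffs \<Rightarrow> nat \<Rightarrow> nat \<Rightarrow> nat \<Rightarrow> nat \<Rightarrow> ('v, 'v) lop" where
  "T_ents H d P j i r c =
     (if r = 1 then scale_op (- 1) (P_hat d P j i (d i - c))
      else if j = i \<and> r = c + 1 then scalar_op (H i) 1
      else zero_op (H i))"

definition T_mat ::
  "nat \<Rightarrow> (nat \<Rightarrow> 'v::complex_vector nspace) \<Rightarrow> (nat \<Rightarrow> nat) \<Rightarrow> 'v coeffs \<Rightarrow> (nat \<Rightarrow> nat \<Rightarrow> 'v, nat \<Rightarrow> nat \<Rightarrow> 'v) lop" where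
  "T_mat n H d P =
     matrix_op {1..n} {1..n} (\<lambda>i. spow (H i) (d i))
       (\<lambda>j i. matrix_pow (d j) (d i) (H i) (T_ents H d P j i))"

definition N_ents :: "'v::complex_vector nspace \<Rightarrow> complex \<Rightarrow> nat \<Rightarrow> nat \<Rightarrow> ('v, 'v) lop" where
  "N_ents X z r c =
     (if r = c then scalar_op X (- z)
      else if r = c + 1 then scalar_op X 1
      else zero_op X)"

text \<open>
  If \<open>l i = d i\<close>, truncated subtraction makes the identity block of size \<open>d i - l i - 1\<close> empty,
  in accordance with \<open>X\<^sup>m = {0}\<close> for negative \<open>m\<close>.
\<close>

definition W_ents :: "'v::complex_vector nspace \<Rightarrow> nat \<Rightarrow> nat \<Rightarrow> complex \<Rightarrow> nat \<Rightarrow> nat \<Rightarrow> ('v, 'v) lop" where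
  "W_ents X di li z =
     block22 (di - li - 1) (di - li - 1)
       (id_ents X)    (zero_ents X)
       (zero_ents X)  (N_ents X z)"

definition W_space ::
  "nat \<Rightarrow> (nat \<Rightarrow> 'v::complex_vector nspace) \<Rightarrow> (nat \<Rightarrow> nat) \<Rightarrow> (nat \<Rightarrow> nat) \<Rightarrow> (nat \<Rightarrow> nat \<Rightarrow> 'v) nspace" where
  "W_space n H d l = dirsum {1..n} (\<lambda>i. spow (H i) (max (d i - 1) (l i)))"

definition W_op ::
  "nat \<Rightarrow> (nat \<Rightarrow> 'v::complex_vector nspace) \<Rightarrow> (nat \<Rightarrow> nat) \<Rightarrow> (nat \<Rightarrow> nat) \<Rightarrow> complex
     \<Rightarrow> (nat \<Rightarrow> nat \<Rightarrow> 'v, nat \<Rightarrow> nat \<Rightarrow> 'v) lop" where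
  "W_op n H d l z =
     dirsum_op {1..n} (\<lambda>i. spow (H i) (max (d i - 1) (l i)))
       (\<lambda>i. matrix_pow (max (d i - 1) (l i)) (max (d i - 1) (l i)) (H i) (W_ents (H i) (d i) (l i) z))"

text \<open>Here \<open>H i \<oplus> H i ^ (d i - 1)\<close> is identified with \<open>H i ^ d i\<close>, with \<open>H i\<close> in first position.\<close>

definition P_ext ::
  "nat \<Rightarrow> (nat \<Rightarrow> 'v::complex_vector nspace) \<Rightarrow> (nat \<Rightarrow> nat \<Rightarrow> nat) \<Rightarrow> (nat \<Rightarrow> nat) \<Rightarrow> (nat \<Rightarrow> nat) \<Rightarrow> 'v coeffs
     \<Rightarrow> complex \<Rightarrow> (nat \<Rightarrow> nat \<Rightarrow> 'v, nat \<Rightarrow> nat \<Rightarrow> 'v) lop" where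
  "P_ext n H deg d l P z =
     matrix_op {1..n} {1..n} (\<lambda>i. spow (H i) (d i))
       (\<lambda>j i. matrix_pow (d j) (d i) (H i)
          (block22 1 1
             (\<lambda>_ _. P_entry H deg P z j i)  (zero_ents (H i))
             (zero_ents (H i))              (if j = i then W_ents (H i) (d i) (l i) z else zero_ents (H i))))"

definition E_alpha_ents ::
  "(nat \<Rightarrow> 'v::complex_vector nspace) \<Rightarrow> (nat \<Rightarrow> nat) \<Rightarrow> 'v coeffs \<Rightarrow> complex \<Rightarrow> nat \<Rightarrow> nat \<Rightarrow> nat \<Rightarrow> ('v, 'v) lop" where
  "E_alpha_ents H d P z i r c =
     (if r = 1 then
        scale_op (- 1) (sum_op (H i) {0..c - 1} (\<lambda>k. scale_op (z ^ k) (P i i (d i - c + 1 + k))))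
      else if r \<le> c then scalar_op (H i) (z ^ (c - r))
      else zero_op (H i))"

definition E_alpha_off_ents ::
  "(nat \<Rightarrow> 'v::complex_vector nspace) \<Rightarrow> (nat \<Rightarrow> nat) \<Rightarrow> 'v coeffs \<Rightarrow> complex \<Rightarrow> nat \<Rightarrow> nat \<Rightarrow> nat \<Rightarrow> nat \<Rightarrow> ('v, 'v) lop" where
  "E_alpha_off_ents H d P z j i r c =
     (if r = 1 \<and> c \<ge> 2 then
        scale_op (- 1) (sum_op (H i) {0..c - 2} (\<lambda>k. scale_op (z ^ k) (P j i (d i - c + 1 + k))))
      else zero_op (H i))"

definition E_beta_ents ::
  "(nat \<Rightarrow> 'v::complex_vector nspace) \<Rightarrow> (nat \<Rightarrow> nat) \<Rightarrow> 'v coeffs \<Rightarrow> complex \<Rightarrow> nat \<Rightarrow> nat \<Rightarrow> nat \<Rightarrow> nat \<Rightarrow> ('v, 'v) lop" where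
  "E_beta_ents H l P z j i r c =
     (if r = 1 then
        sum_op (H i) {0..l i - c} (\<lambda>k. scale_op (1 / z ^ (l i - c + 1 - k)) (P j i k))
      else zero_op (H i))"

text \<open>For \<open>l i = 0\<close> the second block row and column are empty, so that only the alpha blocks remain.\<close>

definition E_ents ::
  "(nat \<Rightarrow> 'v::complex_vector nspace) \<Rightarrow> (nat \<Rightarrow> nat) \<Rightarrow> (nat \<Rightarrow> nat) \<Rightarrow> 'v coeffs \<Rightarrow> complex
     \<Rightarrow> nat \<Rightarrow> nat \<Rightarrow> nat \<Rightarrow> nat \<Rightarrow> ('v, 'v) lop" where
  "E_ents H d l P z j i =
     (if j = i then
        block22 (d i - l i) (d i - l i)
          (E_alpha_ents H d P z i)  (E_beta_ents H l P z i i)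
          (zero_ents (H i))         (id_ents (H i))
      else
        hcat (d i - l i) (E_alpha_off_ents H d P z j i) (E_beta_ents H l P z j i))"

definition E_mat ::
  "nat \<Rightarrow> (nat \<Rightarrow> 'v::complex_vector nspace) \<Rightarrow> (nat \<Rightarrow> nat) \<Rightarrow> (nat \<Rightarrow> nat) \<Rightarrow> 'v coeffs \<Rightarrow> complex
     \<Rightarrow> (nat \<Rightarrow> nat \<Rightarrow> 'v, nat \<Rightarrow> nat \<Rightarrow> 'v) lop" where
  "E_mat n H d l P z =
     matrix_op {1..n} {1..n} (\<lambda>i. spow (H i) (d i))
       (\<lambda>j i. matrix_pow (d j) (d i) (H i) (E_ents H d l P z j i))"

definition F_alpha_ents :: "'v::complex_vector nspace \<Rightarrow> nat \<Rightarrow> complex \<Rightarrow> nat \<Rightarrow> nat \<Rightarrow> ('v, 'v) lop" where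
  "F_alpha_ents X di z r c =
     (if c = 1 then scalar_op X (z ^ (di - r))
      else if c = r + 1 then scalar_op X 1
      else zero_op X)"

definition F_beta_ents :: "'v::complex_vector nspace \<Rightarrow> nat \<Rightarrow> complex \<Rightarrow> nat \<Rightarrow> nat \<Rightarrow> ('v, 'v) lop" where
  "F_beta_ents X li z r c = (if c = 1 then scalar_op X (z ^ (li - r)) else zero_op X)"

definition F_ents :: "'v::complex_vector nspace \<Rightarrow> nat \<Rightarrow> nat \<Rightarrow> complex \<Rightarrow> nat \<Rightarrow> nat \<Rightarrow> ('v, 'v) lop" where
  "F_ents X di li z =
     block22 (di - li) (di - li)
       (F_alpha_ents X di z)  (zero_ents X)
       (F_beta_ents X li z)   (id_ents X)"

definition F_mat ::
  "nat \<Rightarrow> (nat \<Rightarrow> 'v::complex_vector nspace) \<Rightarrow> (nat \<Rightarrow> nat) \<Rightarrow> (nat \<Rightarrow> nat) \<Rightarrow> complex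
     \<Rightarrow> (nat \<Rightarrow> nat \<Rightarrow> 'v, nat \<Rightarrow> nat \<Rightarrow> 'v) lop" where
  "F_mat n H d l z =
     dirsum_op {1..n} (\<lambda>i. spow (H i) (d i))
       (\<lambda>i. matrix_pow (d i) (d i) (H i) (F_ents (H i) (d i) (l i) z))"

end

theory Submission
  imports Defs
begin

text \<open>
  Write \<open>(x, w)\<close> for an element of \<open>D(P \<oplus> W)\<close> and \<open>(u, y)\<close> for one of \<open>D(P_d \<oplus> (T - z))\<close>.  The transformation
  \<open>F\<close> puts \<open>y_(i,r) = z^(d_i - r) x_i + f_(i,r)\<close>, where \<open>f\<close> is \<open>w\<close> with a zero inserted at position
  \<open>d_i - l_i\<close>, so that \<open>T - z\<close> maps \<open>y\<close> to the differences \<open>f_(i,r-1) - z f_(i,r)\<close> below the first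
  rows and the only possibly unbounded coefficient in column \<open>i\<close> is applied to \<open>z^(l_i) x_i\<close>.  For
  \<open>i \<in> L\<close>, where the leading coefficient \<open>A_i\<close> may be unbounded, \<open>u_i\<close> is \<open>z^(d_i) x_i\<close> plus the bounded
  closure of the first row of \<open>- T\<close>: on the domain this correction lies in \<open>D(A_i)\<close>, and \<open>A_i u_i\<close>
  recovers the unbounded part of row \<open>i\<close> of \<open>P(z) x\<close>.  In both cases the terms in \<open>f\<close> left over in
  row \<open>j\<close> are removed by summation by parts, which expresses them by bounded operators applied to \<open>W(z) w\<close>.
  Both transformations are a block triangular map followed by a shear, hence invertible.  If \<open>L\<close> is
  empty they are the matrices of the theorem up to the reordering of the spaces.
\<close>

section \<open>Bounded linear maps between normed spaces\<close>

text \<open>Counting copies of \<open>H_i\<close> explains the two cases: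
  \<open>P \<oplus> W\<close> has \<open>max d_i (l_i + 1)\<close> of them and \<open>T\<close> has
  \<open>d_i\<close>, so one is missing exactly when \<open>l_i = d_i\<close>, and
  \<open>P_d\<close> supplies it. For \<open>l_i < d_i\<close> the zero in \<open>f\<close> keeps
  \<open>w\<close> away from the unbounded coefficient, so the domains match although
  \<open>w\<close> is arbitrary, and one entry of \<open>y\<close> determines \<open>x_i\<close>
  after division by \<open>z^l_i\<close>; hence \<open>z = 0\<close> is excluded unless all
  \<open>l_i\<close> vanish. For \<open>i \<in> L\<close> there is no such position. The obstacle is
  that \<open>F\<close> must be bounded on the whole space, while row \<open>i\<close> of
  \<open>T\<close> may contain unbounded entries from other columns; the bounded closures overcome
  it. On the ranges a shear can only use the second component, here \<open>W(z) w\<close>. The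
  leftover terms in \<open>f\<close> therefore have to be expressed through differences
  \<open>f_(r-1) - z f_r\<close>. This forces Horner sums from the leading coefficient down to index
  \<open>l_i + 1\<close> and, from the other end, sums with negative powers of \<open>z\<close> over
  indices below \<open>l_i\<close>; these are the entries in the first rows of
  \<open>E\<close>.\<close>

lemma normed_subspace: "complex_normed_space X \<Longrightarrow> complex_vector.subspace (carr X)"
  by (simp add: complex_normed_space_def)

lemma normed_0 [simp]: "complex_normed_space X \<Longrightarrow> 0 \<in> carr X"
  by (simp add: normed_subspace complex_vector.subspace_0)

lemma normed_add: "complex_normed_space X \<Longrightarrow> x \<in> carr X \<Longrightarrow> y \<in> carr X \<Longrightarrow> x + y \<in> carr X"
  by (simp add: normed_subspace complex_vector.subspace_add)

lemma normed_diff: "complex_normed_space X \<Longrightarrow> x \<in> carr X \<Longrightarrow> y \<in> carr X \<Longrightarrow> x - y \<in> carr X"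
  by (simp add: normed_subspace complex_vector.subspace_diff)

lemma normed_scale: "complex_normed_space X \<Longrightarrow> x \<in> carr X \<Longrightarrow> c *\<^sub>C x \<in> carr X"
  by (simp add: normed_subspace complex_vector.subspace_scale)

lemma normed_neg: "complex_normed_space X \<Longrightarrow> x \<in> carr X \<Longrightarrow> - x \<in> carr X"
  by (simp add: normed_subspace complex_vector.subspace_neg)

lemma normed_sum: "complex_normed_space X \<Longrightarrow> (\<And>k. k \<in> K \<Longrightarrow> f k \<in> carr X) \<Longrightarrow> sum f K \<in> carr X"
  by (simp add: normed_subspace complex_vector.subspace_sum)

lemma nrm_nonneg: "complex_normed_space X \<Longrightarrow> x \<in> carr X \<Longrightarrow> nrm X x \<ge> 0"
  by (simp add: complex_normed_space_def)

lemma nrm_0: "complex_normed_space X \<Longrightarrow> nrm X 0 = 0"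
  using normed_0 by (auto simp add: complex_normed_space_def)

lemma nrm_scale: "complex_normed_space X \<Longrightarrow> x \<in> carr X \<Longrightarrow> nrm X (c *\<^sub>C x) = cmod c * nrm X x"
  by (simp add: complex_normed_space_def)

lemma nrm_triangle:
  "complex_normed_space X \<Longrightarrow> x \<in> carr X \<Longrightarrow> y \<in> carr X \<Longrightarrow> nrm X (x + y) \<le> nrm X x + nrm X y"
  by (simp add: complex_normed_space_def)

lemma scaleC_0_right [simp]: "c *\<^sub>C (0::'a::complex_vector) = 0"
  by (rule complex_vector.scale_zero_right)

lemma scaleC_0_left [simp]: "0 *\<^sub>C (x::'a::complex_vector) = 0"
  by (rule complex_vector.scale_zero_left)

lemma scaleC_minus1 [simp]: "(- 1) *\<^sub>C (x::'a::complex_vector) = - x"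
  by (metis complex_vector.scale_minus_left scaleC_one)

lemma scaleC_1 [simp]: "1 *\<^sub>C (x::'a::complex_vector) = x"
  by (rule scaleC_one)

lemma scaleC_fun_apply [simp]: "(c *\<^sub>C f) i = c *\<^sub>C f i"
  by (simp add: scaleC_fun_def)

lemma fst_scaleC [simp]: "fst (c *\<^sub>C p) = c *\<^sub>C fst p"
  and snd_scaleC [simp]: "snd (c *\<^sub>C p) = c *\<^sub>C snd p"
  by (simp_all add: scaleC_prod_def)

text \<open>Bounded operators as bare functions, constrained only on the carrier: composition is
  plain function composition, and the record with its domain enters only through
  \<open>bounded_op_iff\<close>.\<close>

definition blin :: "'v::complex_vector nspace \<Rightarrow> 'w::complex_vector nspace \<Rightarrow> ('v \<Rightarrow> 'w) \<Rightarrow> bool" where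
  "blin X Y f \<longleftrightarrow>
     (\<forall>x\<in>carr X. f x \<in> carr Y) \<and>
     (\<forall>x\<in>carr X. \<forall>y\<in>carr X. f (x + y) = f x + f y) \<and>
     (\<forall>c. \<forall>x\<in>carr X. f (c *\<^sub>C x) = c *\<^sub>C f x) \<and>
     (\<exists>C. \<forall>x\<in>carr X. nrm Y (f x) \<le> C * nrm X x)"

lemma blinI:
  assumes "\<And>x. x \<in> carr X \<Longrightarrow> f x \<in> carr Y"
    and "\<And>x y. x \<in> carr X \<Longrightarrow> y \<in> carr X \<Longrightarrow> f (x + y) = f x + f y"
    and "\<And>c x. x \<in> carr X \<Longrightarrow> f (c *\<^sub>C x) = c *\<^sub>C f x"
    and "\<And>x. x \<in> carr X \<Longrightarrow> nrm Y (f x) \<le> C * nrm X x"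
  shows "blin X Y f"
  using assms unfolding blin_def by blast

lemma blin_carr: "blin X Y f \<Longrightarrow> x \<in> carr X \<Longrightarrow> f x \<in> carr Y"
  and blin_add: "blin X Y f \<Longrightarrow> x \<in> carr X \<Longrightarrow> y \<in> carr X \<Longrightarrow> f (x + y) = f x + f y"
  and blin_scale: "blin X Y f \<Longrightarrow> x \<in> carr X \<Longrightarrow> f (c *\<^sub>C x) = c *\<^sub>C f x"
  by (auto simp add: blin_def)

lemma blin_bound: "blin X Y f \<Longrightarrow> \<exists>C. \<forall>x\<in>carr X. nrm Y (f x) \<le> C * nrm X x"
  by (simp add: blin_def)

lemma blin_0: "complex_normed_space X \<Longrightarrow> blin X Y f \<Longrightarrow> f 0 = 0"
  using blin_scale[of X Y f 0 0] by simp

lemma blin_neg: "blin X Y f \<Longrightarrow> x \<in> carr X \<Longrightarrow> f (- x) = - f x"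
  using blin_scale[of X Y f x "- 1"] by simp

lemma blin_diff: "complex_normed_space X \<Longrightarrow> blin X Y f \<Longrightarrow> x \<in> carr X \<Longrightarrow> y \<in> carr X \<Longrightarrow> f (x - y) = f x - f y"
  using blin_add[of X Y f x "- y"] by (simp add: blin_neg normed_neg)

lemma blin_cong: "blin X Y f \<Longrightarrow> complex_normed_space X \<Longrightarrow> (\<And>x. x \<in> carr X \<Longrightarrow> g x = f x) \<Longrightarrow> blin X Y g"
  unfolding blin_def by (simp add: normed_add normed_scale)

lemma bounded_op_iff:
  assumes "complex_normed_space X"
  shows "bounded_op X Y A \<longleftrightarrow> odom A = carr X \<and> blin X Y (oapp A)"
  using normed_subspace[OF assms] by (auto simp add: bounded_op_def linear_op_def blin_def)

lemma blin_zero_map: "complex_normed_space Y \<Longrightarrow> blin X Y (\<lambda>x. 0)"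
  by (rule blinI[where C = 0]) (simp_all add: nrm_0)

lemma blin_id_map: "blin X X (\<lambda>x. x)"
  by (rule blinI[where C = 1]) simp_all

lemma blin_add_map:
  assumes "complex_normed_space Y" "blin X Y f" "blin X Y g"
  shows "blin X Y (\<lambda>x. f x + g x)"
proof -
  obtain C D where C: "\<forall>x\<in>carr X. nrm Y (f x) \<le> C * nrm X x"
    and D: "\<forall>x\<in>carr X. nrm Y (g x) \<le> D * nrm X x"
    using assms by (auto simp add: blin_def)
  show ?thesis
  proof (rule blinI[where C = "C + D"])
    fix x assume x: "x \<in> carr X"
    have "nrm Y (f x + g x) \<le> nrm Y (f x) + nrm Y (g x)"
      using assms x by (intro nrm_triangle) (auto simp add: blin_carr)
    also have "\<dots> \<le> (C + D) * nrm X x"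
      using C D x by (force simp add: algebra_simps)
    finally show "nrm Y (f x + g x) \<le> (C + D) * nrm X x" .
  qed (use assms in \<open>simp_all add: blin_carr blin_add blin_scale normed_add scaleC_add_right\<close>)
qed

lemma blin_scale_map:
  assumes "complex_normed_space Y" "blin X Y f"
  shows "blin X Y (\<lambda>x. c *\<^sub>C f x)"
proof -
  obtain C where C: "\<forall>x\<in>carr X. nrm Y (f x) \<le> C * nrm X x"
    using assms by (auto simp add: blin_def)
  show ?thesis
  proof (rule blinI[where C = "cmod c * C"])
    fix x assume x: "x \<in> carr X"
    show "nrm Y (c *\<^sub>C f x) \<le> cmod c * C * nrm X x"
      using C x assms by (simp add: nrm_scale blin_carr mult.assoc mult_left_mono)
  qed (use assms in \<open>simp_all add: blin_carr blin_add blin_scale normed_scale scaleC_add_right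
        scaleC_scaleC mult.commute\<close>)
qed

lemma blin_neg_map: "complex_normed_space Y \<Longrightarrow> blin X Y f \<Longrightarrow> blin X Y (\<lambda>x. - f x)"
  using blin_scale_map[of Y X f "- 1"] by simp

lemma blin_diff_map:
  "complex_normed_space Y \<Longrightarrow> blin X Y f \<Longrightarrow> blin X Y g \<Longrightarrow> blin X Y (\<lambda>x. f x - g x)"
  using blin_add_map[of Y X f "\<lambda>x. - g x"] by (simp add: blin_neg_map)

lemma blin_sum_map:
  assumes "complex_normed_space Y" "\<And>k. k \<in> K \<Longrightarrow> blin X Y (f k)"
  shows "blin X Y (\<lambda>x. \<Sum>k\<in>K. f k x)"
  using assms(2)
  by (induction K rule: infinite_finite_induct) (simp_all add: blin_zero_map blin_add_map assms(1))

text \<open>The condition does not depend on the argument, so case distinctions over indices in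
  later definitions reduce to their branches.\<close>

lemma blin_if_map:
  "(b \<Longrightarrow> blin X Y f) \<Longrightarrow> (\<not> b \<Longrightarrow> blin X Y g) \<Longrightarrow> blin X Y (\<lambda>x. if b then f x else g x)"
  by (cases b) simp_all

lemma blin_comp:
  assumes "complex_normed_space Y" "blin Y Z g" "blin X Y f"
  shows "blin X Z (\<lambda>x. g (f x))"
proof -
  obtain C D where C: "\<forall>y\<in>carr Y. nrm Z (g y) \<le> C * nrm Y y"
    and D: "\<forall>x\<in>carr X. nrm Y (f x) \<le> D * nrm X x"
    using assms by (auto simp add: blin_def)
  \<comment> \<open>The bound \<open>C\<close> of \<open>g\<close> may be negative; its absolute
    value keeps the multiplication of the bound for \<open>f\<close> monotone.\<close>
  show ?thesis
  proof (rule blinI[where C = "\<bar>C\<bar> * D"])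
    fix x assume x: "x \<in> carr X"
    then have fx: "f x \<in> carr Y" using assms blin_carr by blast
    have "nrm Z (g (f x)) \<le> C * nrm Y (f x)" using C fx by blast
    also have "\<dots> \<le> \<bar>C\<bar> * nrm Y (f x)"
      using nrm_nonneg[OF assms(1) fx] by (intro mult_right_mono) auto
    also have "\<dots> \<le> \<bar>C\<bar> * (D * nrm X x)" using D x by (intro mult_left_mono) auto
    finally show "nrm Z (g (f x)) \<le> \<bar>C\<bar> * D * nrm X x" by (simp add: mult.assoc)
  qed (use assms in \<open>simp_all add: blin_carr blin_add blin_scale\<close>)
qed


section \<open>Direct sums\<close>

lemma carr_dirsum: "x \<in> carr (dirsum I X) \<longleftrightarrow> (\<forall>i\<in>I. x i \<in> carr (X i)) \<and> (\<forall>i. i \<notin> I \<longrightarrow> x i = 0)"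
  by (simp add: dirsum_def)

lemma carr_sprod: "carr (sprod X Y) = carr X \<times> carr Y"
  by (simp add: sprod_def)

lemma dirsum_normed:
  assumes "finite I" "\<And>i. i \<in> I \<Longrightarrow> complex_normed_space (X i)"
  shows "complex_normed_space (dirsum I X)"
proof -
  have sub: "complex_vector.subspace (carr (dirsum I X))"
    using assms(2) by (auto simp add: complex_vector.subspace_def carr_dirsum normed_add normed_scale)
  have zero: "(\<Sum>i\<in>I. nrm (X i) (x i)) = 0 \<longleftrightarrow> x = 0" if x: "x \<in> carr (dirsum I X)" for x
  proof -
    have "(\<Sum>i\<in>I. nrm (X i) (x i)) = 0 \<longleftrightarrow> (\<forall>i\<in>I. nrm (X i) (x i) = 0)"
      using assms x by (intro sum_nonneg_eq_0_iff) (auto simp add: carr_dirsum nrm_nonneg)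
    also have "\<dots> \<longleftrightarrow> (\<forall>i\<in>I. x i = 0)"
      using assms(2) x by (auto simp add: complex_normed_space_def carr_dirsum)
    \<comment> \<open>Definiteness rests on the convention that families vanish off
      \<open>I\<close>.\<close>
    also have "\<dots> \<longleftrightarrow> x = 0"
      using x by (auto simp add: carr_dirsum fun_eq_iff)
    finally show ?thesis .
  qed
  show ?thesis
    unfolding complex_normed_space_def
    using sub zero assms(2)
    by (auto simp add: dirsum_def sum_distrib_left nrm_scale nrm_nonneg sum_nonneg
        simp flip: sum.distrib intro!: sum_mono nrm_triangle)
qed

lemma sprod_normed:
  assumes "complex_normed_space X" "complex_normed_space Y"
  shows "complex_normed_space (sprod X Y)"
proof -
  have sub: "complex_vector.subspace (carr (sprod X Y))"
    using assms by (auto simp add: complex_vector.subspace_def carr_sprod normed_add normed_scale zero_prod_def scaleC_prod_def)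
  have zero: "nrm X x + nrm Y y = 0 \<longleftrightarrow> (x, y) = 0" if "x \<in> carr X" "y \<in> carr Y" for x y
    using that assms nrm_nonneg[OF assms(1) that(1)] nrm_nonneg[OF assms(2) that(2)]
    by (auto simp add: zero_prod_def complex_normed_space_def add_nonneg_eq_0_iff)
  have tri: "nrm X (x + x') + nrm Y (y + y') \<le> nrm X x + nrm Y y + (nrm X x' + nrm Y y')"
    if "x \<in> carr X" "y \<in> carr Y" "x' \<in> carr X" "y' \<in> carr Y" for x y x' y'
    using nrm_triangle[OF assms(1), of x x'] nrm_triangle[OF assms(2), of y y'] that by simp
  show ?thesis
    unfolding complex_normed_space_def
    using sub zero assms tri
    by (auto simp add: sprod_def nrm_scale nrm_nonneg distrib_left add_nonneg_nonneg scaleC_prod_def)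
qed

lemma blin_proj:
  assumes "finite I" "\<And>i. i \<in> I \<Longrightarrow> complex_normed_space (X i)" "i \<in> I"
  shows "blin (dirsum I X) (X i) (\<lambda>x. x i)"
proof (rule blinI[where C = 1])
  fix x assume "x \<in> carr (dirsum I X)"
  then show "nrm (X i) (x i) \<le> 1 * nrm (dirsum I X) x"
    using assms member_le_sum[of i I "\<lambda>i. nrm (X i) (x i)"]
    by (auto simp add: dirsum_def nrm_nonneg)
qed (use assms in \<open>auto simp add: carr_dirsum\<close>)

lemma blin_dirsum_map:
  assumes "\<And>i. i \<in> I \<Longrightarrow> blin Z (X i) (\<lambda>x. f x i)" "\<And>x i. i \<notin> I \<Longrightarrow> f x i = 0"
  shows "blin Z (dirsum I X) f"
proof -
  have "\<forall>i\<in>I. \<exists>C. \<forall>x\<in>carr Z. nrm (X i) (f x i) \<le> C * nrm Z x"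
    using assms(1) blin_bound by blast
  then obtain C where C: "\<And>i x. i \<in> I \<Longrightarrow> x \<in> carr Z \<Longrightarrow> nrm (X i) (f x i) \<le> C i * nrm Z x"
    by metis
  show ?thesis
  proof (rule blinI[where C = "sum C I"])
    fix x assume x: "x \<in> carr Z"
    show "f x \<in> carr (dirsum I X)"
      using assms blin_carr[OF assms(1) x] by (auto simp add: carr_dirsum)
    show "nrm (dirsum I X) (f x) \<le> sum C I * nrm Z x"
      using C x by (auto simp add: dirsum_def sum_distrib_right intro!: sum_mono)
    show "f (c *\<^sub>C x) = c *\<^sub>C f x" for c
    proof
      fix i show "f (c *\<^sub>C x) i = (c *\<^sub>C f x) i"
        using blin_scale[OF assms(1) x] assms(2) by (cases "i \<in> I") auto
    qed
    show "f (x + y) = f x + f y" if y: "y \<in> carr Z" for y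
    proof
      fix i show "f (x + y) i = (f x + f y) i"
        using blin_add[OF assms(1) x y] assms(2) by (cases "i \<in> I") auto
    qed
  qed
qed

lemma blin_fst:
  assumes "complex_normed_space X" "complex_normed_space Y"
  shows "blin (sprod X Y) X fst"
  by (rule blinI[where C = 1]) (use assms in \<open>auto simp add: sprod_def nrm_nonneg\<close>)

lemma blin_snd:
  assumes "complex_normed_space X" "complex_normed_space Y"
  shows "blin (sprod X Y) Y snd"
  by (rule blinI[where C = 1]) (use assms in \<open>auto simp add: sprod_def nrm_nonneg\<close>)

lemma blin_Pair_map:
  assumes "blin Z X f" "blin Z Y g"
  shows "blin Z (sprod X Y) (\<lambda>x. (f x, g x))"
proof -
  obtain C D where C: "\<forall>x\<in>carr Z. nrm X (f x) \<le> C * nrm Z x"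
    and D: "\<forall>x\<in>carr Z. nrm Y (g x) \<le> D * nrm Z x"
    using assms by (auto simp add: blin_def)
  show ?thesis
  proof (rule blinI[where C = "C + D"])
    fix x assume "x \<in> carr Z"
    then show "nrm (sprod X Y) (f x, g x) \<le> (C + D) * nrm Z x"
      using C D by (force simp add: sprod_def distrib_right)
  qed (use assms in \<open>auto simp add: carr_sprod blin_carr blin_add blin_scale scaleC_prod_def\<close>)
qed


section \<open>Mutually inverse bounded maps\<close>

text \<open>The inverse is carried along as an explicit bounded map, so bounded invertibility of a
  composition results from composing the data.\<close>

definition biso :: "'v::complex_vector nspace \<Rightarrow> 'w::complex_vector nspace \<Rightarrow> ('v \<Rightarrow> 'w) \<Rightarrow> ('w \<Rightarrow> 'v) \<Rightarrow> bool" where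
  "biso X Y f g \<longleftrightarrow> blin X Y f \<and> blin Y X g \<and> (\<forall>x\<in>carr X. g (f x) = x) \<and> (\<forall>y\<in>carr Y. f (g y) = y)"

lemma biso_sym: "biso X Y f g \<Longrightarrow> biso Y X g f"
  by (auto simp add: biso_def)

lemma biso_comp:
  assumes "complex_normed_space X" "complex_normed_space Y" "complex_normed_space Z"
    and "biso X Y f g" "biso Y Z f' g'"
  shows "biso X Z (\<lambda>x. f' (f x)) (\<lambda>y. g (g' y))"
  using assms blin_comp[of Y Z f' X f] blin_comp[of Y X g Z g'] blin_carr
  unfolding biso_def by metis

text \<open>A unipotent block triangular map is invertible for every bounded \<open>h\<close>. The
  corrections \<open>KS\<close> and \<open>BV\<close> below therefore only have to be
  bounded.\<close>

lemma biso_shear: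
  assumes "complex_normed_space X" "complex_normed_space Y" "blin Y X h"
  shows "biso (sprod X Y) (sprod X Y) (\<lambda>q. (fst q + h (snd q), snd q)) (\<lambda>q. (fst q - h (snd q), snd q))"
  unfolding biso_def using assms
  by (auto intro!: blin_Pair_map blin_add_map blin_diff_map blin_fst blin_snd
      blin_comp[OF assms(2,3)])

definition map_op :: "'v::complex_vector nspace \<Rightarrow> ('v \<Rightarrow> 'w) \<Rightarrow> ('v, 'w) lop" where
  "map_op X f = \<lparr> odom = carr X, oapp = f \<rparr>"

text \<open>Agreement with \<open>f\<close> is required on the carrier only; this fits operator
  matrices, which are evaluated there.\<close>

lemma biso_op_invertible:
  assumes "complex_normed_space X" "complex_normed_space Y" "biso X Y f g"
    and "odom A = carr X" "\<And>x. x \<in> carr X \<Longrightarrow> oapp A x = f x"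
  shows "bounded_op X Y A \<and> op_invertible X Y A"
proof -
  have f: "blin X Y f" and g: "blin Y X g" and gf: "\<And>x. x \<in> carr X \<Longrightarrow> g (f x) = x"
    and fg: "\<And>y. y \<in> carr Y \<Longrightarrow> f (g y) = y"
    using assms(3) by (auto simp add: biso_def)
  have b: "bij_betw (oapp A) (odom A) (carr Y)"
    unfolding assms(4)
    by (rule bij_betw_byWitness[where f' = g])
      (auto simp add: assms(5) gf fg blin_carr[OF f] blin_carr[OF g])
  \<comment> \<open>\<open>op_inv\<close> is built from \<open>inv_into\<close>, which agrees with
    \<open>g\<close> on the carrier of \<open>Y\<close>; boundedness is transferred from
    \<open>g\<close> by \<open>blin_cong\<close>.\<close>
  have "inv_into (carr X) (oapp A) y = g y" if "y \<in> carr Y" for y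
    using that b by (auto simp add: assms(4,5) bij_betw_def inv_into_f_eq fg blin_carr[OF g])
  then have "blin Y X (oapp (op_inv A))"
    by (intro blin_cong[OF g assms(2)]) (simp add: op_inv_def assms(4))
  moreover have "odom (op_inv A) = carr Y"
    using b by (simp add: op_inv_def bij_betw_def)
  moreover have "blin X Y (oapp A)"
    by (rule blin_cong[OF f assms(1)]) (rule assms(5))
  ultimately show ?thesis
    using b assms by (simp add: op_invertible_def bounded_op_iff)
qed

lemma biso_map_op:
  assumes "complex_normed_space X" "complex_normed_space Y" "biso X Y f g"
  shows "bounded_op X Y (map_op X f) \<and> op_invertible X Y (map_op X f)"
  by (rule biso_op_invertible[OF assms]) (simp_all add: map_op_def)


section \<open>Linear operators\<close>

lemma linear_op_carr: "linear_op X Y A \<Longrightarrow> x \<in> odom A \<Longrightarrow> x \<in> carr X"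
  and linear_op_app: "linear_op X Y A \<Longrightarrow> x \<in> odom A \<Longrightarrow> oapp A x \<in> carr Y"
  and linear_op_subspace: "linear_op X Y A \<Longrightarrow> complex_vector.subspace (odom A)"
  and linear_op_add: "linear_op X Y A \<Longrightarrow> x \<in> odom A \<Longrightarrow> y \<in> odom A \<Longrightarrow> oapp A (x + y) = oapp A x + oapp A y"
  and linear_op_scale: "linear_op X Y A \<Longrightarrow> x \<in> odom A \<Longrightarrow> oapp A (c *\<^sub>C x) = c *\<^sub>C oapp A x"
  by (auto simp add: linear_op_def)

lemma linear_op_dom_0: "linear_op X Y A \<Longrightarrow> 0 \<in> odom A"
  and linear_op_dom_add: "linear_op X Y A \<Longrightarrow> x \<in> odom A \<Longrightarrow> y \<in> odom A \<Longrightarrow> x + y \<in> odom A"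
  and linear_op_dom_scale: "linear_op X Y A \<Longrightarrow> x \<in> odom A \<Longrightarrow> c *\<^sub>C x \<in> odom A"
  by (simp_all add: linear_op_subspace complex_vector.subspace_0 complex_vector.subspace_add
      complex_vector.subspace_scale)

lemma linear_op_0: "linear_op X Y A \<Longrightarrow> oapp A 0 = 0"
  using linear_op_scale[of X Y A 0 0] by (simp add: linear_op_dom_0)

lemma linear_op_dom_diff: "linear_op X Y A \<Longrightarrow> x \<in> odom A \<Longrightarrow> y \<in> odom A \<Longrightarrow> x - y \<in> odom A"
  by (simp add: linear_op_subspace complex_vector.subspace_diff)

text \<open>A domain is a subspace, so a nonzero power of \<open>z\<close> in front of a vector does
  not affect membership.\<close>

lemma linear_op_dom_scale_iff:
  assumes "linear_op X Y A" "c \<noteq> 0"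
  shows "c *\<^sub>C x \<in> odom A \<longleftrightarrow> x \<in> odom A"
proof
  assume "c *\<^sub>C x \<in> odom A"
  then have "inverse c *\<^sub>C (c *\<^sub>C x) \<in> odom A" using assms linear_op_dom_scale by blast
  then show "x \<in> odom A" using assms(2) by (simp add: scaleC_scaleC)
qed (use assms linear_op_dom_scale in blast)

lemma linear_opI:
  assumes "\<And>x. x \<in> odom A \<Longrightarrow> x \<in> carr X" "\<And>x. x \<in> odom A \<Longrightarrow> oapp A x \<in> carr Y"
    and "0 \<in> odom A"
    and "\<And>x y. x \<in> odom A \<Longrightarrow> y \<in> odom A \<Longrightarrow> x + y \<in> odom A \<and> oapp A (x + y) = oapp A x + oapp A y"
    and "\<And>c x. x \<in> odom A \<Longrightarrow> c *\<^sub>C x \<in> odom A \<and> oapp A (c *\<^sub>C x) = c *\<^sub>C oapp A x"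
  shows "linear_op X Y A"
  using assms unfolding linear_op_def complex_vector.subspace_def by blast

lemma bounded_op_linear: "bounded_op X Y A \<Longrightarrow> linear_op X Y A"
  by (simp add: bounded_op_def)

lemma linear_op_zero:
  "complex_normed_space X \<Longrightarrow> complex_normed_space Y \<Longrightarrow> linear_op X Y (zero_op X)"
  by (rule linear_opI) (auto simp add: zero_op_def normed_add normed_scale)

lemma linear_op_scalar: "complex_normed_space X \<Longrightarrow> linear_op X X (scalar_op X c)"
  by (rule linear_opI)
    (auto simp add: scalar_op_def normed_add normed_scale scaleC_add_right scaleC_scaleC mult.commute)

lemma linear_op_scale_op:
  assumes "complex_normed_space Y" "linear_op X Y A"
  shows "linear_op X Y (scale_op c A)"
  using assms(1) by (intro linear_opI)
    (auto simp add: scale_op_def normed_scale scaleC_add_right scaleC_scaleC mult.commute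
      linear_op_carr[OF assms(2)] linear_op_app[OF assms(2)] linear_op_dom_0[OF assms(2)]
      linear_op_dom_add[OF assms(2)] linear_op_dom_scale[OF assms(2)]
      linear_op_add[OF assms(2)] linear_op_scale[OF assms(2)])

lemma linear_op_sum_op:
  assumes "complex_normed_space X" "complex_normed_space Y" "\<And>k. k \<in> K \<Longrightarrow> linear_op X Y (A k)"
  shows "linear_op X Y (sum_op X K A)"
proof (rule linear_opI)
  fix x y c assume x: "x \<in> odom (sum_op X K A)"
  show "c *\<^sub>C x \<in> odom (sum_op X K A) \<and> oapp (sum_op X K A) (c *\<^sub>C x) = c *\<^sub>C oapp (sum_op X K A) x"
    using x assms linear_op_dom_scale[OF assms(3)] linear_op_scale[OF assms(3)]
    by (auto simp add: sum_op_def normed_scale complex_vector.scale_sum_right intro!: sum.cong)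
  assume y: "y \<in> odom (sum_op X K A)"
  show "x + y \<in> odom (sum_op X K A) \<and> oapp (sum_op X K A) (x + y) = oapp (sum_op X K A) x + oapp (sum_op X K A) y"
    using x y assms linear_op_dom_add[OF assms(3)] linear_op_add[OF assms(3)]
    by (auto simp add: sum_op_def normed_add sum.distrib[symmetric] intro!: sum.cong)
qed (use assms linear_op_dom_0[OF assms(3)] linear_op_app[OF assms(3)] in
    \<open>auto simp add: sum_op_def intro!: normed_sum\<close>)

lemma linear_op_comp:
  assumes "linear_op Y Z A" "linear_op X Y B"
  shows "linear_op X Z (A \<circ>\<^sub>o B)"
  by (intro linear_opI)
    (auto simp add: comp_op_def linear_op_carr[OF assms(2)] linear_op_app[OF assms(1)]
      linear_op_dom_0[OF assms(1)] linear_op_dom_0[OF assms(2)] linear_op_0[OF assms(2)]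
      linear_op_dom_add[OF assms(1)] linear_op_dom_scale[OF assms(1)]
      linear_op_dom_add[OF assms(2)] linear_op_dom_scale[OF assms(2)]
      linear_op_add[OF assms(1)] linear_op_scale[OF assms(1)]
      linear_op_add[OF assms(2)] linear_op_scale[OF assms(2)])

lemma linear_op_minus_scalar:
  assumes "complex_normed_space X" "linear_op X X A"
  shows "linear_op X X (minus_scalar A c)"
  using assms(1) by (intro linear_opI)
    (auto simp add: minus_scalar_def linear_op_carr[OF assms(2)] linear_op_app[OF assms(2)]
      normed_diff normed_scale
      linear_op_dom_0[OF assms(2)] linear_op_dom_add[OF assms(2)] linear_op_dom_scale[OF assms(2)]
      linear_op_add[OF assms(2)] linear_op_scale[OF assms(2)] scaleC_add_right scaleC_scaleC
      complex_vector.scale_right_diff_distrib mult.commute)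

lemma linear_op_oplus:
  assumes "linear_op X X' A" "linear_op Y Y' B"
  shows "linear_op (sprod X Y) (sprod X' Y') (A \<oplus>\<^sub>o B)"
  by (intro linear_opI)
    (auto simp add: oplus_op_def carr_sprod zero_prod_def scaleC_prod_def
      linear_op_carr[OF assms(1)] linear_op_app[OF assms(1)] linear_op_dom_0[OF assms(1)]
      linear_op_dom_add[OF assms(1)] linear_op_dom_scale[OF assms(1)]
      linear_op_add[OF assms(1)] linear_op_scale[OF assms(1)]
      linear_op_carr[OF assms(2)] linear_op_app[OF assms(2)] linear_op_dom_0[OF assms(2)]
      linear_op_dom_add[OF assms(2)] linear_op_dom_scale[OF assms(2)]
      linear_op_add[OF assms(2)] linear_op_scale[OF assms(2)])

lemma linear_op_matrix:
  assumes "\<And>i. i \<in> I \<Longrightarrow> complex_normed_space (X i)" "\<And>j. j \<in> J \<Longrightarrow> complex_normed_space (Y j)"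
    and "\<And>j i. j \<in> J \<Longrightarrow> i \<in> I \<Longrightarrow> linear_op (X i) (Y j) (A j i)"
  shows "linear_op (dirsum I X) (dirsum J Y) (matrix_op J I X A)"
proof (rule linear_opI)
  fix x y c assume x: "x \<in> odom (matrix_op J I X A)"
  show "oapp (matrix_op J I X A) x \<in> carr (dirsum J Y)"
    using x assms(2) linear_op_app[OF assms(3)]
    by (auto simp add: matrix_op_def carr_dirsum intro!: normed_sum)
  show "c *\<^sub>C x \<in> odom (matrix_op J I X A) \<and>
      oapp (matrix_op J I X A) (c *\<^sub>C x) = c *\<^sub>C oapp (matrix_op J I X A) x"
    using x assms linear_op_dom_scale[OF assms(3)] linear_op_scale[OF assms(3)]
    by (auto simp add: matrix_op_def carr_dirsum normed_scale complex_vector.scale_sum_right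
        fun_eq_iff intro!: sum.cong)
  assume y: "y \<in> odom (matrix_op J I X A)"
  show "x + y \<in> odom (matrix_op J I X A) \<and>
      oapp (matrix_op J I X A) (x + y) = oapp (matrix_op J I X A) x + oapp (matrix_op J I X A) y"
    using x y assms linear_op_dom_add[OF assms(3)] linear_op_add[OF assms(3)]
    by (auto simp add: matrix_op_def carr_dirsum normed_add sum.distrib[symmetric]
        fun_eq_iff intro!: sum.cong)
qed (use assms linear_op_dom_0[OF assms(3)] in \<open>auto simp add: matrix_op_def carr_dirsum\<close>)

lemma linear_op_dirsum:
  assumes "\<And>i. i \<in> I \<Longrightarrow> complex_normed_space (X i)"
    and "\<And>i. i \<in> I \<Longrightarrow> linear_op (X i) (Y i) (A i)"
  shows "linear_op (dirsum I X) (dirsum I Y) (dirsum_op I X A)"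
  using assms(1) by (intro linear_opI)
    (auto simp add: dirsum_op_def carr_dirsum fun_eq_iff normed_add normed_scale
      linear_op_app[OF assms(2)] linear_op_dom_0[OF assms(2)]
      linear_op_dom_add[OF assms(2)] linear_op_dom_scale[OF assms(2)]
      linear_op_add[OF assms(2)] linear_op_scale[OF assms(2)])

text \<open>The constant sequence puts the graph of \<open>A\<close> into its closure; closability
  makes the description by \<open>THE\<close> pick exactly this value.\<close>

lemma graph_closure_extends:
  assumes "complex_normed_space X" "complex_normed_space Y" "linear_op X Y A" "closable X Y A"
    and x: "x \<in> odom A"
  shows "oapp (op_closure X Y A) x = oapp A x"
proof -
  have "(x, oapp A x) \<in> graph_closure X Y A"
    using assms by (auto simp add: graph_closure_def linear_op_carr linear_op_app nrm_0
        intro!: exI[where x = "\<lambda>_. x"])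
  then show ?thesis
    using assms(4) unfolding op_closure_def closable_def
    by (auto intro!: the_equality dest: single_valuedD)
qed

section \<open>Summation by parts in a column\<close>

text \<open>Horner's partial sums, started at the leading coefficient \<open>Q d\<close>. Up to sign
  they are the first rows of the alpha blocks of \<open>E\<close>.\<close>

definition upper_sum :: "complex \<Rightarrow> nat \<Rightarrow> (nat \<Rightarrow> 'v \<Rightarrow> 'w::complex_vector) \<Rightarrow> nat \<Rightarrow> 'v \<Rightarrow> 'w" where
  "upper_sum z d Q c v = (\<Sum>k<c. (z ^ k) *\<^sub>C Q (d - c + 1 + k) v)"

text \<open>The counterpart started at \<open>Q 0\<close>, in negative powers of \<open>z\<close>;
  these are the first rows of the beta blocks of \<open>E\<close>.\<close>

definition lower_sum :: "complex \<Rightarrow> nat \<Rightarrow> (nat \<Rightarrow> 'v \<Rightarrow> 'w::complex_vector) \<Rightarrow> nat \<Rightarrow> 'v \<Rightarrow> 'w" where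
  "lower_sum z l Q c v = (\<Sum>k<Suc l - c. (1 / z ^ (Suc l - c - k)) *\<^sub>C Q k v)"

lemma upper_sum_Suc:
  assumes "c < d"
  shows "upper_sum z d Q (Suc c) v = Q (d - c) v + z *\<^sub>C upper_sum z d Q c v"
  using assms
  by (simp add: upper_sum_def sum.lessThan_Suc_shift complex_vector.scale_sum_right scaleC_scaleC
      Suc_diff_le Suc_diff_Suc del: sum.lessThan_Suc)

lemma upper_sum_1: "0 < d \<Longrightarrow> upper_sum z d Q (Suc 0) v = Q d v"
  by (simp add: upper_sum_def)

lemma scale_lower_sum:
  assumes "c \<le> l" "z \<noteq> 0"
  shows "z *\<^sub>C lower_sum z l Q c v = Q (l - c) v + lower_sum z l Q (Suc c) v"
proof -
  have "z *\<^sub>C ((1 / z ^ (Suc (l - c) - k)) *\<^sub>C Q k v) = (1 / z ^ (l - c - k)) *\<^sub>C Q k v"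
    if "k < Suc (l - c)" for k
    using that assms by (simp add: scaleC_scaleC Suc_diff_le)
  then show ?thesis
    using assms by (simp add: lower_sum_def complex_vector.scale_sum_right Suc_diff_le
        scaleC_add_right scaleC_scaleC)
qed

lemma lower_sum_end: "lower_sum z l Q (Suc l) v = 0"
  by (simp add: lower_sum_def)

text \<open>Up to \<open>c = d - l\<close> only coefficients with index above \<open>l\<close>
  occur.\<close>

lemma blin_upper_sum:
  assumes "complex_normed_space Y" "c \<le> d - l" "\<And>k. k \<noteq> l \<Longrightarrow> blin X Y (Q k)"
  shows "blin X Y (upper_sum z d Q c)"
  unfolding upper_sum_def using assms
  by (intro blin_sum_map blin_scale_map) (auto intro!: assms(3))

text \<open>From \<open>c = 1\<close> on only coefficients with index below \<open>l\<close>
  occur.\<close>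

lemma blin_lower_sum:
  assumes "complex_normed_space Y" "1 \<le> c" "\<And>k. k \<noteq> l \<Longrightarrow> blin X Y (Q k)"
  shows "blin X Y (lower_sum z l Q c)"
  unfolding lower_sum_def using assms
  by (intro blin_sum_map blin_scale_map) (auto intro!: assms(3))

text \<open>The Horner recursion \<open>upper_sum_Suc\<close> drives the summation. The extra term
  with \<open>Q d\<close> starts the chain at \<open>c = 1\<close>, where no predecessor of
  \<open>f 1\<close> is available; the zero at position \<open>s\<close> ends it, so
  \<open>Q l\<close> is applied to 0 only.\<close>

lemma upper_summation_by_parts:
  assumes X: "complex_normed_space X" and Y: "complex_normed_space Y"
    and Q: "\<And>k. k \<noteq> l \<Longrightarrow> blin X Y (Q k)" and Ql: "Q l 0 = 0"
    and f: "\<And>c. f c \<in> carr X" and s: "s = d - l" "s > 0" "f s = 0"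
  shows "(\<Sum>c=1..s. Q (d - c) (f c)) + z *\<^sub>C Q d (f 1)
    = (\<Sum>c=2..s. upper_sum z d Q c (f (c - 1) - z *\<^sub>C f c))"
proof -
  have R: "upper_sum z d Q c (u - z *\<^sub>C v) = upper_sum z d Q c u - z *\<^sub>C upper_sum z d Q c v"
    if "c \<le> s" "u \<in> carr X" "v \<in> carr X" for c u v
  proof -
    have *: "blin X Y (upper_sum z d Q c)"
      using that by (intro blin_upper_sum Q Y) (simp_all add: s)
    show ?thesis
      using that by (simp add: blin_diff[OF X *] blin_scale[OF *] normed_scale X)
  qed
  \<comment> \<open>The last summand is the remainder that the next Horner step absorbs.\<close>
  have *: "(\<Sum>c=1..t. Q (d - c) (f c)) + z *\<^sub>C Q d (f 1)
    = (\<Sum>c=2..t. upper_sum z d Q c (f (c - 1) - z *\<^sub>C f c)) + upper_sum z d Q (Suc t) (f t)"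
    if "1 \<le> t" "t < s" for t
    using that
  proof (induction t rule: nat_induct_at_least)
    case base
    then show ?case
      using s by (simp add: upper_sum_Suc[of "Suc 0"] upper_sum_1)
  next
    case (Suc t)
    then have "Suc t < d" using s by simp
    with Suc show ?case
      by (simp add: R f upper_sum_Suc[of "Suc t"] algebra_simps)
  qed
  \<comment> \<open>At \<open>t = s - 1\<close> the hypothesis \<open>f s = 0\<close> turns the
    remainder into the summand for \<open>c = s\<close> and removes the term with
    \<open>Q l\<close>. The case \<open>s = 1\<close> lies outside the range of the invariant; there
    both sides vanish.\<close>
  show ?thesis
  proof (cases "s = 1")
    case True
    then have "d - Suc 0 = l" using s by simp
    then show ?thesis
      using True s Ql blin_0[OF X Q[of d]] by simp
  next
    case False
    then obtain t where "s = Suc t"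
      using s(2) by (cases s) auto
    with False have t: "s = Suc t" "1 \<le> t" "t < s" by auto
    then have "d - Suc t = l" using s by simp
    then show ?thesis
      using *[of t] t s(3) Ql by simp
  qed
qed

text \<open>Here the recursion is \<open>scale_lower_sum\<close>, which needs
  \<open>z \<noteq> 0\<close>. The chain starts with \<open>g 0 = 0\<close> and ends because
  \<open>lower_sum\<close> is empty at \<open>l + 1\<close>.\<close>

lemma lower_summation_by_parts:
  assumes X: "complex_normed_space X" and Y: "complex_normed_space Y"
    and Q: "\<And>k. k \<noteq> l \<Longrightarrow> blin X Y (Q k)"
    and g: "\<And>c. g c \<in> carr X" "g 0 = 0" and z: "z \<noteq> 0"
  shows "(\<Sum>c=1..l. Q (l - c) (g c)) = - (\<Sum>c=1..l. lower_sum z l Q c (g (c - 1) - z *\<^sub>C g c))"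
proof -
  have S: "lower_sum z l Q c (u - z *\<^sub>C v) = lower_sum z l Q c u - z *\<^sub>C lower_sum z l Q c v"
    if "1 \<le> c" "u \<in> carr X" "v \<in> carr X" for c u v
  proof -
    have *: "blin X Y (lower_sum z l Q c)"
      using that by (intro blin_lower_sum Q Y)
    show ?thesis
      using that by (simp add: blin_diff[OF X *] blin_scale[OF *] normed_scale X)
  qed
  have S1: "lower_sum z l Q (Suc 0) 0 = 0"
    by (rule blin_0[OF X blin_lower_sum[OF Y _ Q]]) simp_all
  \<comment> \<open>The invariant keeps the remainder on the right-hand side; it disappears at
    \<open>t = l\<close>.\<close>
  have "(\<Sum>c=1..t. Q (l - c) (g c)) + (\<Sum>c=1..t. lower_sum z l Q c (g (c - 1) - z *\<^sub>C g c))
    = - lower_sum z l Q (Suc t) (g t)" if "t \<le> l" for t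
    using that
  proof (induction t)
    case 0
    then show ?case by (simp add: g S1)
  next
    case (Suc t)
    then show ?case
      by (simp add: S g scale_lower_sum[of "Suc t"] z algebra_simps)
  qed
  from this[of l] show ?thesis
    by (simp add: lower_sum_end eq_neg_iff_add_eq_0)
qed

text \<open>The zero at position \<open>s\<close> cuts the column in two: before it the coefficients
  have index above \<open>l\<close>, after it index below \<open>l\<close>. For \<open>s = 0\<close>
  only the second part exists. The right-hand side involves no \<open>Q l\<close>, hence only
  bounded operators.\<close>

lemma column_summation_by_parts:
  assumes X: "complex_normed_space X" and Y: "complex_normed_space Y"
    and Q: "\<And>k. k \<noteq> l \<Longrightarrow> blin X Y (Q k)" and Ql: "Q l 0 = 0"
    and f: "\<And>c. f c \<in> carr X" and s: "s = d - l" "l \<le> d" "s > 0 \<Longrightarrow> f s = 0" and z: "z \<noteq> 0 \<or> l = 0"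
  shows "(\<Sum>c=1..d. Q (d - c) (f c)) + (if s > 0 then z *\<^sub>C Q d (f 1) else 0)
    = (\<Sum>c=2..s. upper_sum z d Q c (f (c - 1) - z *\<^sub>C f c))
      - (\<Sum>c=1..l. lower_sum z l Q c ((if c > 1 then f (s + (c - 1)) else 0) - z *\<^sub>C f (s + c)))"
proof -
  have d: "d = s + l" using s by simp
  have split: "(\<Sum>c=1..d. Q (d - c) (f c))
    = (\<Sum>c=1..s. Q (d - c) (f c)) + (\<Sum>c=1..l. Q (l - c) (f (s + c)))"
  proof -
    have "(\<Sum>c=1..s + l. Q (d - c) (f c)) = (\<Sum>c=1..s. Q (d - c) (f c)) + (\<Sum>c=s + 1..s + l. Q (d - c) (f c))"
      by (rule sum.ub_add_nat) simp
    also have "(\<Sum>c=s + 1..s + l. Q (d - c) (f c)) = (\<Sum>c=1..l. Q (l - c) (f (s + c)))"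
      using sum.shift_bounds_cl_nat_ivl[of "\<lambda>c. Q (d - c) (f c)" 1 s l]
      by (simp add: d add.commute)
    finally show ?thesis by (simp add: d)
  qed
  have low: "(\<Sum>c=1..l. Q (l - c) (f (s + c)))
    = - (\<Sum>c=1..l. lower_sum z l Q c ((if c > 1 then f (s + (c - 1)) else 0) - z *\<^sub>C f (s + c)))"
  proof (cases "l = 0")
    case False
    \<comment> \<open>For \<open>s = 0\<close> the value \<open>f 0\<close> lies outside the column
      and need not vanish, so the initial zero is put in by hand.\<close>
    define g where "g c = (if c = 0 then 0 else f (s + c))" for c
    have g: "g c \<in> carr X" "g 0 = 0" for c
      using X f by (auto simp add: g_def)
    have "(\<Sum>c=1..l. Q (l - c) (g c)) = - (\<Sum>c=1..l. lower_sum z l Q c (g (c - 1) - z *\<^sub>C g c))"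
      by (rule lower_summation_by_parts[where g = g, OF X Y Q g]) (use z False in simp_all)
    moreover have "(\<Sum>c=1..l. Q (l - c) (g c)) = (\<Sum>c=1..l. Q (l - c) (f (s + c)))"
      by (rule sum.cong) (auto simp add: g_def)
    moreover have "(\<Sum>c=1..l. lower_sum z l Q c (g (c - 1) - z *\<^sub>C g c))
      = (\<Sum>c=1..l. lower_sum z l Q c ((if c > 1 then f (s + (c - 1)) else 0) - z *\<^sub>C f (s + c)))"
      by (rule sum.cong) (auto simp add: g_def)
    ultimately show ?thesis by simp
  qed simp
  show ?thesis
  proof (cases "s = 0")
    case True
    then show ?thesis unfolding split low by simp
  next
    case False
    then show ?thesis
      unfolding split low
      using upper_summation_by_parts[where Q = Q and f = f and z = z, OF X Y Q Ql f s(1)] s(3)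
      by (simp add: algebra_simps)
  qed
qed

section \<open>Operators of the block matrices\<close>

lemma op_eq_linear:
  "A \<doteq> B \<Longrightarrow> linear_op X Y B \<Longrightarrow> linear_op X Y A"
  unfolding op_eq_def linear_op_def complex_vector.subspace_def by auto

lemma odom_matrix_op_total:
  assumes "\<And>j i. j \<in> J \<Longrightarrow> i \<in> I \<Longrightarrow> odom (A j i) = carr (X i)"
  shows "odom (matrix_op J I X A) = carr (dirsum I X)"
  using assms by (auto simp add: matrix_op_def carr_dirsum)

lemma sum_fun_apply: "(\<Sum>i\<in>I. f i) r = (\<Sum>i\<in>I. f i r)"
  by (induction I rule: infinite_finite_induct) simp_all

lemma carr_spow: "x \<in> carr (spow X m) \<longleftrightarrow> (\<forall>r\<in>{1..m}. x r \<in> carr X) \<and> (\<forall>r. r \<notin> {1..m} \<longrightarrow> x r = 0)"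
  by (simp add: spow_def carr_dirsum)

lemma spow_normed: "complex_normed_space X \<Longrightarrow> complex_normed_space (spow X m)"
  by (simp add: spow_def dirsum_normed)

lemma carr_dirsum_spow:
  "x \<in> carr (dirsum I (\<lambda>i. spow (X i) (e i))) \<longleftrightarrow> (\<forall>i\<in>I. \<forall>r\<in>{1..e i}. x i r \<in> carr (X i)) \<and>
    (\<forall>i r. i \<notin> I \<or> r \<notin> {1..e i} \<longrightarrow> x i r = 0)"
  unfolding carr_dirsum carr_spow fun_eq_iff zero_fun_apply by blast

lemma blin_dirsum_spow_map:
  assumes "\<And>i r. i \<in> I \<Longrightarrow> r \<in> {1..e i} \<Longrightarrow> blin Z (X i) (\<lambda>x. f x i r)"
    and "\<And>x i r. i \<notin> I \<or> r \<notin> {1..e i} \<Longrightarrow> f x i r = 0"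
  shows "blin Z (dirsum I (\<lambda>i. spow (X i) (e i))) f"
proof (rule blin_dirsum_map)
  fix i assume "i \<in> I"
  then show "blin Z (spow (X i) (e i)) (\<lambda>x. f x i)"
    unfolding spow_def by (intro blin_dirsum_map) (use assms in blast)+
next
  fix x i assume "i \<notin> I"
  then show "f x i = 0" using assms(2) by (simp add: fun_eq_iff)
qed

lemma blin_dirsum_spow_proj:
  assumes "finite I" "\<And>i. i \<in> I \<Longrightarrow> complex_normed_space (X i)" "i \<in> I" "r \<in> {1..e i}"
  shows "blin (dirsum I (\<lambda>i. spow (X i) (e i))) (X i) (\<lambda>x. x i r)"
proof -
  have 1: "blin (dirsum I (\<lambda>i. spow (X i) (e i))) (spow (X i) (e i)) (\<lambda>x. x i)"
    by (rule blin_proj) (use assms spow_normed in blast)+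
  have 2: "blin (spow (X i) (e i)) (X i) (\<lambda>x. x r)"
    unfolding spow_def by (rule blin_proj) (use assms in simp_all)
  show ?thesis
    by (rule blin_comp[OF _ 2 1]) (simp add: spow_normed assms)
qed

text \<open>The form as a sum of two Kronecker terms lets \<open>sum.delta\<close> evaluate the
  rows. In row \<open>b + 1\<close>, the first row of \<open>N\<close>, the subdiagonal entry is
  missing.\<close>

lemma W_ents_app:
  assumes "b = di - li - 1" "1 \<le> c"
  shows "oapp (W_ents X di li z r c) v =
    (if c = r then (if r \<le> b then v else - (z *\<^sub>C v)) else 0) + (if c = r - 1 then (if r \<le> Suc b then 0 else v) else 0)"
proof -
  have "r - b = c - b + 1 \<longleftrightarrow> c = r - 1" "r - b = c - b \<longleftrightarrow> c = r" if "c > b" "r > b"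
    using that by auto
  then show ?thesis
    unfolding W_ents_def block22_def vcat_def hcat_def assms(1)[symmetric] using assms(2)
    by (auto simp add: id_ents_def zero_ents_def N_ents_def scalar_op_def zero_op_def)
qed

lemma W_ents_sum:
  assumes "b = di - li - 1" "r \<in> {1..m}"
  shows "(\<Sum>c=1..m. oapp (W_ents X di li z r c) (u c)) =
    (if r \<le> b then u r else (if r - b > 1 then u (r - 1) else 0) - z *\<^sub>C u r)"
proof -
  have "(\<Sum>c=1..m. oapp (W_ents X di li z r c) (u c))
    = (\<Sum>c=1..m. if c = r then (if r \<le> b then u r else - (z *\<^sub>C u r)) else 0)
      + (\<Sum>c=1..m. if c = r - 1 then (if r \<le> Suc b then 0 else u (r - 1)) else 0)"
    unfolding sum.distrib[symmetric]
    by (intro sum.cong) (auto simp add: W_ents_app[OF assms(1)])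
  also have "(\<Sum>c=1..m. if c = r then (if r \<le> b then u r else - (z *\<^sub>C u r)) else 0)
    = (if r \<le> b then u r else - (z *\<^sub>C u r))"
    using assms(2) by simp
  also have "(\<Sum>c=1..m. if c = r - 1 then (if r \<le> Suc b then 0 else u (r - 1)) else 0)
    = (if r \<le> Suc b then 0 else u (r - 1))"
    using assms(2) by (subst sum.delta) auto
  finally show ?thesis by auto
qed

section \<open>The data at a fixed point \<open>z\<close>: domains and rows of \<open>P\<close>,
  \<open>T\<close> and \<open>W\<close>\<close>

locale operator_matrix_polynomial =
  fixes n :: nat
    and H :: "nat \<Rightarrow> 'v::complex_vector nspace"
    and deg :: "nat \<Rightarrow> nat \<Rightarrow> nat"
    and d l :: "nat \<Rightarrow> nat"
    and P :: "'v coeffs"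
    and z :: complex
    and I L :: "nat set"
  assumes I: "I = {1..n}"
    and H: "\<And>i. i \<in> I \<Longrightarrow> complex_banach_space (H i)"
    and P: "\<And>j i k. j \<in> I \<Longrightarrow> i \<in> I \<Longrightarrow> k \<le> deg j i \<Longrightarrow>
              linear_op (H i) (H j) (P j i k)"
    and P_zero: "\<And>j i k. j \<in> I \<Longrightarrow> i \<in> I \<Longrightarrow> k > deg j i \<Longrightarrow> P j i k \<doteq> zero_op (H i)"
    and d: "\<And>i. i \<in> I \<Longrightarrow> d i = deg i i"
    and d_pos: "\<And>i. i \<in> I \<Longrightarrow> d i > 0"
    and d_gt: "\<And>j i. j \<in> I \<Longrightarrow> i \<in> I \<Longrightarrow> j \<noteq> i \<Longrightarrow> d i > deg j i"
    and lead: "\<And>i. i \<in> I \<Longrightarrow> op_invertible (H i) (H i) (P i i (d i))"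
    and l: "\<And>i. i \<in> I \<Longrightarrow> l i \<in> {0..d i}"
    and bdd: "\<And>j i k. j \<in> I \<Longrightarrow> i \<in> I \<Longrightarrow> k \<noteq> l i \<Longrightarrow> bounded_op (H i) (H j) (P j i k)"
    and clos: "\<And>i j k. i \<in> I \<Longrightarrow> l i = d i \<Longrightarrow> j \<in> I \<Longrightarrow> k < d j \<Longrightarrow>
              closable (H j) (H i) (P_hat d P i j k) \<and>
              bounded_op (H j) (H i) (op_closure (H j) (H i) (P_hat d P i j k))"
    and z: "z \<noteq> 0 \<or> (\<forall>i\<in>I. l i = 0)"
    and L: "L = {i \<in> I. l i = d i}"
begin

abbreviation "s i \<equiv> d i - l i"
abbreviation "b i \<equiv> d i - l i - 1"
abbreviation "m i \<equiv> max (d i - 1) (l i)"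

abbreviation "HH \<equiv> dirsum I H"
abbreviation "HL \<equiv> dirsum L H"
abbreviation "WW \<equiv> W_space n H d l"
abbreviation "TT \<equiv> dirsum I (\<lambda>i. spow (H i) (d i))"

abbreviation "app j i k \<equiv> oapp (P j i k)"
abbreviation "A i \<equiv> oapp (P i i (d i))"
definition "Ai i = oapp (op_inv (P i i (d i)))"
text \<open>For \<open>i \<in> L\<close> and \<open>k < d j\<close>, the bounded extension of \<open>(P_ii^(d_i))^-1 P_ij^(k)\<close>.\<close>

definition "K i j k = oapp (op_closure (H j) (H i) (P_hat d P i j k))"

lemma HN: "i \<in> I \<Longrightarrow> complex_normed_space (H i)"
  using H by (simp add: complex_banach_space_def)

lemma L_sub: "i \<in> L \<Longrightarrow> i \<in> I" and L_l: "i \<in> L \<Longrightarrow> l i = d i" and L_I: "i \<in> I \<Longrightarrow> i \<in> L \<longleftrightarrow> l i = d i"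
  and L_fin: "finite L" and I_fin: "finite I"
  by (auto simp add: L I)

lemma l_le: "i \<in> I \<Longrightarrow> l i \<le> d i"
  using l by simp

lemma l_less: "i \<in> I \<Longrightarrow> i \<notin> L \<Longrightarrow> l i < d i"
  using l_le L_I by (simp add: le_neq_implies_less)

text \<open>Truncated subtraction gives \<open>b i = 0\<close> for \<open>l i = d i\<close>, so one
  index formula serves both cases.\<close>

lemma m_eq: "i \<in> I \<Longrightarrow> m i = b i + l i"
  using l_le[of i] by auto

lemma W_space_eq: "WW = dirsum I (\<lambda>i. spow (H i) (m i))"
  and P_mat_eq: "P_mat n H deg P z = matrix_op I I H (P_entry H deg P z)"
  and T_mat_eq: "T_mat n H d P =
    matrix_op I I (\<lambda>i. spow (H i) (d i)) (\<lambda>j i. matrix_pow (d j) (d i) (H i) (T_ents H d P j i))"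
  and W_op_eq: "W_op n H d l z = dirsum_op I (\<lambda>i. spow (H i) (m i))
    (\<lambda>i. matrix_pow (m i) (m i) (H i) (W_ents (H i) (d i) (l i) z))"
  by (simp_all only: W_space_def P_mat_def T_mat_def W_op_def I)

lemma HH_N: "complex_normed_space HH" and HL_N: "complex_normed_space HL"
  and WW_N: "complex_normed_space WW" and TT_N: "complex_normed_space TT"
  by (auto intro!: dirsum_normed spow_normed HN simp add: W_space_eq L_fin I_fin dest: L_sub)

lemma HW_N: "complex_normed_space (sprod HH WW)" and LT_N: "complex_normed_space (sprod HL TT)"
  by (simp_all add: sprod_normed HH_N HL_N WW_N TT_N)

lemmas carr_TT = carr_dirsum_spow[where I = I and X = H and e = d]
lemmas carr_WW = carr_dirsum_spow[where I = I and X = H and e = m, folded W_space_eq]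
lemmas blin_TT_map = blin_dirsum_spow_map[where I = I and X = H and e = d]
lemmas blin_WW_map = blin_dirsum_spow_map[where I = I and X = H and e = m, folded W_space_eq]
lemmas blin_TT_proj = blin_dirsum_spow_proj[where I = I and X = H and e = d, OF I_fin HN]
lemmas blin_WW_proj = blin_dirsum_spow_proj[where I = I and X = H and e = m, OF I_fin HN,
    folded W_space_eq]

text \<open>Beyond the degree a coefficient is only \<open>\<doteq>\<close> to the zero operator, so
  its linearity is transported along that relation.\<close>

lemma P_lin: "j \<in> I \<Longrightarrow> i \<in> I \<Longrightarrow> linear_op (H i) (H j) (P j i k)"
  using P P_zero op_eq_linear linear_op_zero HN by (metis not_le)

lemma P_dom: "j \<in> I \<Longrightarrow> i \<in> I \<Longrightarrow> k \<noteq> l i \<Longrightarrow> odom (P j i k) = carr (H i)"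
  and P_blin: "j \<in> I \<Longrightarrow> i \<in> I \<Longrightarrow> k \<noteq> l i \<Longrightarrow> blin (H i) (H j) (app j i k)"
  using bdd by (simp_all add: bounded_op_iff HN)

lemma P_beyond:
  assumes "j \<in> I" "i \<in> I" "k > deg j i"
  shows "odom (P j i k) = carr (H i)" "x \<in> carr (H i) \<Longrightarrow> app j i k x = 0"
  using P_zero[OF assms] by (auto simp add: op_eq_def zero_op_def)

lemma P_0: "j \<in> I \<Longrightarrow> i \<in> I \<Longrightarrow> app j i k 0 = 0"
  using P_lin linear_op_0 by blast

lemma A_bij: "j \<in> I \<Longrightarrow> bij_betw (A j) (odom (P j j (d j))) (carr (H j))"
  using lead by (simp add: op_invertible_def)

lemma Ai_blin: "j \<in> I \<Longrightarrow> blin (H j) (H j) (Ai j)"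
  and Ai_dom: "j \<in> I \<Longrightarrow> odom (op_inv (P j j (d j))) = carr (H j)"
  using lead by (simp_all add: op_invertible_def bounded_op_iff HN Ai_def)

lemma Ai_A: "j \<in> I \<Longrightarrow> x \<in> odom (P j j (d j)) \<Longrightarrow> Ai j (A j x) = x"
  and A_Ai: "j \<in> I \<Longrightarrow> y \<in> carr (H j) \<Longrightarrow> A j (Ai j y) = y"
  and Ai_odom: "j \<in> I \<Longrightarrow> y \<in> carr (H j) \<Longrightarrow> Ai j y \<in> odom (P j j (d j))"
  using A_bij[of j]
  by (simp_all add: Ai_def op_inv_def bij_betw_def inv_into_f_f f_inv_into_f inv_into_into)

lemma A_blin: "j \<in> I \<Longrightarrow> j \<notin> L \<Longrightarrow> blin (H j) (H j) (A j)"
  using l_less[of j] by (intro P_blin) auto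

lemma P_hat_dom: "j \<in> I \<Longrightarrow> i \<in> I \<Longrightarrow> odom (P_hat d P j i k) = odom (P j i k)"
  using linear_op_app[OF P_lin] by (auto simp add: P_hat_def comp_op_def Ai_dom)

lemma P_hat_app: "oapp (P_hat d P j i k) x = Ai j (app j i k x)"
  by (simp add: P_hat_def comp_op_def Ai_def)

lemma P_hat_lin: "j \<in> I \<Longrightarrow> i \<in> I \<Longrightarrow> linear_op (H i) (H j) (P_hat d P j i k)"
  unfolding P_hat_def using lead
  by (intro linear_op_comp[OF _ P_lin]) (auto simp add: op_invertible_def bounded_op_linear)

lemma K_blin: "i \<in> L \<Longrightarrow> j \<in> I \<Longrightarrow> k < d j \<Longrightarrow> blin (H j) (H i) (K i j k)"
  using clos[of i j k] by (simp add: L_sub L_l bounded_op_iff HN K_def)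

lemma K_app:
  assumes "i \<in> L" "j \<in> I" "k < d j" "x \<in> odom (P i j k)"
  shows "K i j k x = Ai i (app i j k x)"
proof -
  have i: "i \<in> I" using assms by (simp add: L_sub)
  have "K i j k x = oapp (P_hat d P i j k) x"
    unfolding K_def
    by (rule graph_closure_extends[OF HN HN P_hat_lin])
      (use assms i clos[of i j k] in \<open>simp_all add: L_l P_hat_dom\<close>)
  then show ?thesis by (simp add: P_hat_app)
qed

text \<open>All coefficients other than the one of index \<open>l i\<close> are everywhere defined,
  and so is that one if \<open>l i\<close> exceeds the degree. Since \<open>scale_op\<close> keeps
  the domain even for the factor 0, this also holds at \<open>z = 0\<close>.\<close>

lemma P_entry_dom:
  assumes "j \<in> I" "i \<in> I"
  shows "odom (P_entry H deg P z j i) = odom (P j i (l i))"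
proof -
  have *: "x \<in> odom (P j i k)" if "x \<in> carr (H i)" "k \<noteq> l i \<or> l i > deg j i" for x k
    using that P_dom[OF assms] P_beyond(1)[OF assms, of "l i"] by (cases "k = l i") auto
  have "x \<in> carr (H i)" if "x \<in> odom (P j i (l i))" for x
    using linear_op_carr[OF P_lin[OF assms] that] .
  moreover have "x \<in> odom (P j i (l i))" if "x \<in> carr (H i)" "\<forall>k\<in>{0..deg j i}. x \<in> odom (P j i k)" for x
    using that *[of x "l i"] by (cases "l i \<le> deg j i") auto
  moreover have "x \<in> odom (P j i k)" if "x \<in> odom (P j i (l i))" "x \<in> carr (H i)" for x k
    using that *[of x k] by (cases "k = l i") auto
  ultimately show ?thesis
    unfolding P_entry_def sum_op_def scale_op_def lop.simps by blast
qed

lemma deg_le: "j \<in> I \<Longrightarrow> i \<in> I \<Longrightarrow> deg j i \<le> d i"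
  using d_gt[of j i] d[of i] by (cases "j = i") simp_all

lemma P_entry_app:
  assumes "j \<in> I" "i \<in> I" "x \<in> carr (H i)"
  shows "oapp (P_entry H deg P z j i) x = (\<Sum>k\<le>d i. z ^ k *\<^sub>C app j i k x)"
proof -
  have "(\<Sum>k\<le>d i. z ^ k *\<^sub>C app j i k x) = (\<Sum>k=0..deg j i. z ^ k *\<^sub>C app j i k x)"
    using deg_le[OF assms(1,2)] P_beyond[OF assms(1,2)] assms(3)
    by (intro sum.mono_neutral_right) auto
  then show ?thesis by (simp add: P_entry_def sum_op_def scale_op_def)
qed

lemma P_top: "j \<in> I \<Longrightarrow> i \<in> I \<Longrightarrow> j \<noteq> i \<Longrightarrow> x \<in> carr (H i) \<Longrightarrow> app j i (d i) x = 0"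
  and P_top_dom: "j \<in> I \<Longrightarrow> i \<in> I \<Longrightarrow> j \<noteq> i \<Longrightarrow> odom (P j i (d i)) = carr (H i)"
  using P_beyond[of j i "d i"] d_gt[of j i] by auto

lemma P_entry_lin: "j \<in> I \<Longrightarrow> i \<in> I \<Longrightarrow> linear_op (H i) (H j) (P_entry H deg P z j i)"
  unfolding P_entry_def by (intro linear_op_sum_op linear_op_scale_op P_lin HN)

lemma P_mat_lin: "linear_op HH HH (P_mat n H deg P z)"
  unfolding P_mat_eq by (intro linear_op_matrix P_entry_lin HN)

lemma P_mat_dom: "x \<in> odom (P_mat n H deg P z) \<longleftrightarrow>
    x \<in> carr HH \<and> (\<forall>i\<in>I. \<forall>j\<in>I. x i \<in> odom (P j i (l i)))"
  by (auto simp add: P_mat_eq matrix_op_def P_entry_dom)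

lemma P_mat_app:
  assumes "x \<in> carr HH" "j \<in> I"
  shows "oapp (P_mat n H deg P z) x j = (\<Sum>i\<in>I. \<Sum>k\<le>d i. z ^ k *\<^sub>C app j i k (x i))"
  using assms by (auto simp add: P_mat_eq matrix_op_def P_entry_app carr_dirsum intro!: sum.cong)

lemma T_ents_lin: "j \<in> I \<Longrightarrow> i \<in> I \<Longrightarrow> linear_op (H i) (H j) (T_ents H d P j i r c)"
  by (auto simp add: T_ents_def intro!: linear_op_scale_op P_hat_lin linear_op_scalar linear_op_zero HN)

lemma T_mat_lin: "linear_op TT TT (T_mat n H d P)"
  unfolding T_mat_eq
  by (intro linear_op_matrix spow_normed HN)
    (auto simp add: spow_def intro!: linear_op_matrix T_ents_lin HN)

text \<open>Column \<open>c\<close> of a first row contains the coefficient of index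
  \<open>d i - c\<close>, which is \<open>l i\<close> exactly for \<open>c = s i\<close>. For
  \<open>i \<in> L\<close> this would be column 0, so such block columns impose no condition;
  composing with the everywhere defined inverse of the leading coefficient does not change
  domains.\<close>

lemma T_mat_dom: "y \<in> odom (T_mat n H d P) \<longleftrightarrow>
    y \<in> carr TT \<and> (\<forall>i\<in>I - L. \<forall>j\<in>I. y i (s i) \<in> odom (P j i (l i)))"
proof -
  have dom: "odom (T_ents H d P j i r c) = (if r = 1 then odom (P j i (d i - c)) else carr (H i))"
    if "j \<in> I" "i \<in> I" for j i r c
    using that by (auto simp add: T_ents_def scale_op_def P_hat_dom scalar_op_def zero_op_def)
  have iff: "(\<forall>c\<in>{1..d i}. \<forall>r\<in>{1..d j}. u c \<in> odom (T_ents H d P j i r c)) \<longleftrightarrow>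
      (i \<in> L \<or> u (s i) \<in> odom (P j i (l i)))"
    if ij: "i \<in> I" "j \<in> I" and u: "\<forall>c\<in>{1..d i}. u c \<in> carr (H i)" for i j and u :: "nat \<Rightarrow> 'v"
  proof
    assume *: "\<forall>c\<in>{1..d i}. \<forall>r\<in>{1..d j}. u c \<in> odom (T_ents H d P j i r c)"
    show "i \<in> L \<or> u (s i) \<in> odom (P j i (l i))"
    proof (cases "i \<in> L")
      case False
      then have "s i \<in> {1..d i}" "1 \<in> {1..d j}" "d i - s i = l i"
        using l_less[OF ij(1)] d_pos[OF ij(2)] by auto
      then show ?thesis using * dom[OF ij(2,1)] by metis
    qed simp
  next
    assume *: "i \<in> L \<or> u (s i) \<in> odom (P j i (l i))"
    show "\<forall>c\<in>{1..d i}. \<forall>r\<in>{1..d j}. u c \<in> odom (T_ents H d P j i r c)"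
    proof (intro ballI)
      fix c r assume c: "c \<in> {1..d i}" and "r \<in> {1..d j}"
      have "u c \<in> odom (P j i (d i - c))"
      proof (cases "d i - c = l i")
        case True
        then have "c = s i" "i \<notin> L" using c l_le[OF ij(1)] L_I[OF ij(1)] by auto
        then show ?thesis using * True by simp
      next
        case False
        then show ?thesis using P_dom[OF ij(2,1) False] u c by auto
      qed
      then show "u c \<in> odom (T_ents H d P j i r c)"
        using dom[OF ij(2,1)] u c by simp
    qed
  qed
  have "y \<in> odom (T_mat n H d P) \<longleftrightarrow> y \<in> carr TT \<and>
      (\<forall>i\<in>I. \<forall>j\<in>I. \<forall>c\<in>{1..d i}. \<forall>r\<in>{1..d j}. y i c \<in> odom (T_ents H d P j i r c))"
    by (auto simp add: T_mat_eq matrix_op_def carr_dirsum spow_def)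
  also have "\<dots> \<longleftrightarrow> y \<in> carr TT \<and> (\<forall>i\<in>I. \<forall>j\<in>I. i \<in> L \<or> y i (s i) \<in> odom (P j i (l i)))"
    using iff by (intro conj_cong refl ball_cong) (auto simp add: carr_TT)
  finally show ?thesis by blast
qed

lemma T_mat_app:
  assumes y: "y \<in> carr TT" and j: "j \<in> I" "r \<in> {1..d j}"
  shows "oapp (T_mat n H d P) y j r =
    (if r = 1 then - (\<Sum>i\<in>I. \<Sum>c=1..d i. Ai j (app j i (d i - c) (y i c))) else y j (r - 1))"
proof -
  have *: "oapp (T_mat n H d P) y j r = (\<Sum>i\<in>I. \<Sum>c=1..d i. oapp (T_ents H d P j i r c) (y i c))"
    using j unfolding T_mat_eq matrix_op_def by (simp add: sum_fun_apply)
  show ?thesis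
  proof (cases "r = 1")
    case True
    then show ?thesis
      unfolding * by (simp add: T_ents_def scale_op_def P_hat_app sum_negf)
  next
    case False
    \<comment> \<open>Below the first row only the diagonal block acts, through the identities on
      its subdiagonal.\<close>
    have "(\<Sum>c=1..d i. oapp (T_ents H d P j i r c) (y i c)) = (if i = j then y j (r - 1) else 0)"
      if "i \<in> I" for i
    proof -
      have "(\<Sum>c=1..d i. oapp (T_ents H d P j i r c) (y i c))
        = (\<Sum>c=1..d i. if c = r - 1 then (if i = j then y j (r - 1) else 0) else 0)"
        using False j by (intro sum.cong) (auto simp add: T_ents_def scalar_op_def zero_op_def)
      also have "\<dots> = (if i = j then y j (r - 1) else 0)"
        using False j by (subst sum.delta) auto
      finally show ?thesis .
    qed
    then show ?thesis
      unfolding * using False j by (simp add: I_fin)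
  qed
qed

lemma W_ents_lin: "i \<in> I \<Longrightarrow> linear_op (H i) (H i) (W_ents (H i) di li z r c)"
  by (auto simp add: W_ents_def block22_def vcat_def hcat_def id_ents_def zero_ents_def N_ents_def
      intro!: linear_op_scalar linear_op_zero HN)

lemma W_op_lin: "linear_op WW WW (W_op n H d l z)"
  unfolding W_op_eq W_space_eq
  by (intro linear_op_dirsum spow_normed HN)
    (auto simp add: spow_def intro!: linear_op_matrix W_ents_lin HN)

lemma W_ents_dom: "odom (W_ents X di li z r c) = carr X"
  by (auto simp add: W_ents_def block22_def vcat_def hcat_def id_ents_def zero_ents_def N_ents_def
      scalar_op_def zero_op_def)

lemma W_op_dom: "odom (W_op n H d l z) = carr WW"
proof -
  have "odom (matrix_pow (m i) (m i) (H i) (W_ents (H i) (d i) (l i) z)) = carr (spow (H i) (m i))" for i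
    unfolding spow_def by (rule odom_matrix_op_total) (rule W_ents_dom)
  then show ?thesis
    by (auto simp add: W_op_eq W_space_eq dirsum_op_def carr_dirsum)
qed

lemma W_op_app:
  assumes i: "i \<in> I" "r \<in> {1..m i}"
  shows "oapp (W_op n H d l z) w i r =
    (if r \<le> b i then w i r else (if r - b i > 1 then w i (r - 1) else 0) - z *\<^sub>C w i r)"
proof -
  have "oapp (W_op n H d l z) w i r = (\<Sum>c=1..m i. oapp (W_ents (H i) (d i) (l i) z r c) (w i c))"
    using i by (simp add: W_op_eq dirsum_op_def matrix_op_def)
  also note W_ents_sum[OF refl i(2)]
  finally show ?thesis .
qed

end

lemma blin_sum:
  assumes "complex_normed_space X" "blin X Y f" "\<And>k. k \<in> K \<Longrightarrow> u k \<in> carr X"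
  shows "f (sum u K) = (\<Sum>k\<in>K. f (u k))"
  using assms(3)
  by (induction K rule: infinite_finite_induct)
    (simp_all add: blin_0[OF assms(1,2)] blin_add[OF assms(2)] normed_sum[OF assms(1)])

context operator_matrix_polynomial
begin

section \<open>The transformation of the domains\<close>

text \<open>Families are padded with zeros, so no range condition on \<open>r\<close> has to be
  tracked.\<close>

lemma WW_carr: "w \<in> carr WW \<Longrightarrow> i \<in> I \<Longrightarrow> w i r \<in> carr (H i)"
  and TT_carr: "y \<in> carr TT \<Longrightarrow> i \<in> I \<Longrightarrow> y i r \<in> carr (H i)"
  and HH_carr: "x \<in> carr HH \<Longrightarrow> i \<in> I \<Longrightarrow> x i \<in> carr (H i)"
proof -
  show "w \<in> carr WW \<Longrightarrow> i \<in> I \<Longrightarrow> w i r \<in> carr (H i)"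
    using HN[of i] by (cases "r \<in> {1..m i}") (auto simp add: carr_WW)
  show "y \<in> carr TT \<Longrightarrow> i \<in> I \<Longrightarrow> y i r \<in> carr (H i)"
    using HN[of i] by (cases "r \<in> {1..d i}") (auto simp add: carr_TT)
qed (auto simp add: carr_dirsum)

lemma blin_WW: "i \<in> I \<Longrightarrow> blin WW (H i) (\<lambda>w. w i r)"
proof (cases "r \<in> {1..m i}")
  case False
  then show "i \<in> I \<Longrightarrow> blin WW (H i) (\<lambda>w. w i r)"
    using carr_WW by (intro blin_cong[OF blin_zero_map[OF HN] WW_N]) blast+
qed (rule blin_WW_proj)

lemma blin_TT: "i \<in> I \<Longrightarrow> blin TT (H i) (\<lambda>y. y i r)"
proof (cases "r \<in> {1..d i}")
  case False
  then show "i \<in> I \<Longrightarrow> blin TT (H i) (\<lambda>y. y i r)"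
    using carr_TT by (intro blin_cong[OF blin_zero_map[OF HN] TT_N]) blast+
qed (rule blin_TT_proj)

lemma blin_HW_fst: "i \<in> I \<Longrightarrow> blin (sprod HH WW) (H i) (\<lambda>q. fst q i)"
  by (rule blin_comp[OF HH_N blin_proj blin_fst]) (auto simp add: I_fin HN HH_N WW_N)

lemma blin_LT_fst: "i \<in> L \<Longrightarrow> blin (sprod HL TT) (H i) (\<lambda>q. fst q i)"
  by (rule blin_comp[OF HL_N blin_proj blin_fst]) (auto simp add: L_fin HN HL_N TT_N dest: L_sub)

lemma blin_HW_snd: "i \<in> I \<Longrightarrow> blin (sprod HH WW) (H i) (\<lambda>q. snd q i r)"
  by (rule blin_comp[OF WW_N blin_WW blin_snd]) (auto simp add: HH_N WW_N)

lemma blin_LT_snd: "i \<in> I \<Longrightarrow> blin (sprod HL TT) (H i) (\<lambda>q. snd q i r)"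
  by (rule blin_comp[OF TT_N blin_TT blin_snd]) (auto simp add: HL_N TT_N)

text \<open>For \<open>i \<notin> L\<close> the last branch is \<open>w i (r - 1)\<close>. For
  \<open>i \<in> L\<close> both \<open>s i\<close> and \<open>b i\<close> are 0, the inserted zero
  falls on position 0, and \<open>shift\<close> changes nothing on positions
  \<open>1..d i\<close>.\<close>

definition "shift w i r = (if r < s i then w i r else if r = s i then 0 else w i (b i + (r - s i)))"

definition "FA q =
  (\<lambda>i. if i \<in> L then z ^ d i *\<^sub>C fst q i else 0,
   \<lambda>i r. if i \<in> I \<and> r \<in> {1..d i} then z ^ (d i - r) *\<^sub>C fst q i + shift (snd q) i r else 0)"

text \<open>Outside \<open>L\<close> the entry at \<open>s i\<close> contains \<open>x_i\<close>
  without any contribution of \<open>w\<close>; on \<open>L\<close> no entry of \<open>y\<close>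
  does, and the extra component is read instead.\<close>

definition "x_part q i =
  (if i \<in> L then inverse (z ^ d i) *\<^sub>C fst q i else inverse (z ^ l i) *\<^sub>C snd q i (s i))"

text \<open>Once \<open>x_i\<close> is known, its multiples are subtracted from the remaining
  entries and the inserted zero is skipped. The exponent in the second branch is \<open>d i\<close>
  minus the position \<open>s i + (r - b i)\<close>.\<close>

definition "FA_inv q =
  (\<lambda>i. if i \<in> I then x_part q i else 0,
   \<lambda>i r. if i \<in> I \<and> r \<in> {1..m i} then
           if r \<le> b i then snd q i r - z ^ (d i - r) *\<^sub>C x_part q i
           else snd q i (s i + (r - b i)) - z ^ (l i - (r - b i)) *\<^sub>C x_part q i
         else 0)"

lemma z_power: "i \<in> I \<Longrightarrow> z ^ l i \<noteq> 0" and z_power_L: "i \<in> L \<Longrightarrow> z ^ d i \<noteq> 0"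
  using z L_sub[of i] L_l[of i] by auto

lemma blin_x_part: "i \<in> I \<Longrightarrow> blin (sprod HL TT) (H i) (\<lambda>q. x_part q i)"
  unfolding x_part_def
  by (intro blin_if_map blin_scale_map blin_LT_fst blin_LT_snd HN)

lemma blin_shift: "i \<in> I \<Longrightarrow> blin (sprod HH WW) (H i) (\<lambda>q. shift (snd q) i r)"
  unfolding shift_def by (intro blin_if_map blin_HW_snd blin_zero_map HN)

lemma blin_FA: "blin (sprod HH WW) (sprod HL TT) FA"
  unfolding FA_def
proof (intro blin_Pair_map blin_TT_map blin_dirsum_map[where I = L])
  fix i assume i: "i \<in> L"
  show "blin (sprod HH WW) (H i) (\<lambda>q. if i \<in> L then z ^ d i *\<^sub>C fst q i else 0)"
    using L_sub[OF i] by (intro blin_if_map blin_scale_map blin_HW_fst blin_zero_map HN)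
next
  fix i r assume i: "i \<in> I" "r \<in> {1..d i}"
  show "blin (sprod HH WW) (H i) (\<lambda>q. if i \<in> I \<and> r \<in> {1..d i}
      then z ^ (d i - r) *\<^sub>C fst q i + shift (snd q) i r else 0)"
    using i by (intro blin_if_map blin_add_map blin_scale_map blin_HW_fst blin_shift blin_zero_map HN)
qed auto

lemma blin_FA_inv: "blin (sprod HL TT) (sprod HH WW) FA_inv"
  unfolding FA_inv_def
proof (intro blin_Pair_map blin_dirsum_map blin_WW_map)
  fix i assume i: "i \<in> I"
  show "blin (sprod HL TT) (H i) (\<lambda>q. if i \<in> I then x_part q i else 0)"
    using i by (intro blin_if_map blin_x_part blin_zero_map HN)
next
  fix i r assume i: "i \<in> I" "r \<in> {1..m i}"
  show "blin (sprod HL TT) (H i) (\<lambda>q. if i \<in> I \<and> r \<in> {1..m i} then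
           if r \<le> b i then snd q i r - z ^ (d i - r) *\<^sub>C x_part q i
           else snd q i (s i + (r - b i)) - z ^ (l i - (r - b i)) *\<^sub>C x_part q i
         else 0)"
    using i by (intro blin_if_map blin_diff_map blin_scale_map blin_x_part blin_LT_snd blin_zero_map HN)
qed auto

lemma FA_fst: "i \<in> L \<Longrightarrow> fst (FA q) i = z ^ d i *\<^sub>C fst q i"
  and FA_snd: "i \<in> I \<Longrightarrow> r \<in> {1..d i} \<Longrightarrow> snd (FA q) i r = z ^ (d i - r) *\<^sub>C fst q i + shift (snd q) i r"
  by (simp_all add: FA_def)

lemma FA_snd_s: "i \<in> I \<Longrightarrow> i \<notin> L \<Longrightarrow> snd (FA q) i (s i) = z ^ l i *\<^sub>C fst q i"
  using l_less[of i] l_le[of i] by (subst FA_snd) (auto simp add: shift_def)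

lemma x_part_FA:
  assumes "i \<in> I"
  shows "x_part (FA q) i = fst q i"
proof (cases "i \<in> L")
  case True
  then show ?thesis
    using z_power_L[OF True] by (simp add: x_part_def FA_fst scaleC_scaleC)
next
  case False
  then show ?thesis
    using z_power[OF assms] by (simp add: x_part_def FA_snd_s[OF assms False] scaleC_scaleC)
qed

lemma shift_small: "r < s i \<Longrightarrow> shift w i r = w i r"
  and shift_s: "shift w i (s i) = 0"
  and shift_large: "r > 0 \<Longrightarrow> shift w i (s i + r) = w i (b i + r)"
  by (simp_all add: shift_def)

lemma FA_inv_FA:
  assumes q: "q \<in> carr (sprod HH WW)"
  shows "FA_inv (FA q) = q"
proof (rule prod_eqI)
  show "fst (FA_inv (FA q)) = fst q"
    using q by (auto simp add: FA_inv_def x_part_FA carr_sprod carr_dirsum fun_eq_iff)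
  show "snd (FA_inv (FA q)) = snd q"
  proof (intro ext)
    fix i r
    show "snd (FA_inv (FA q)) i r = snd q i r"
    proof (cases "i \<in> I \<and> r \<in> {1..m i}")
      case False
      moreover from this have "snd q i r = 0" using q by (auto simp add: carr_sprod carr_WW)
      ultimately show ?thesis by (auto simp add: FA_inv_def)
    next
      case True
      then have i: "i \<in> I" and r: "r \<in> {1..m i}" by auto
      show ?thesis
      proof (cases "r \<le> b i")
        case True
        then have "r \<in> {1..d i}" "r < s i" using r by auto
        then show ?thesis
          using True i r by (simp add: FA_inv_def x_part_FA FA_snd shift_small)
      next
        case False
        define r' where "r' = r - b i"
        have r': "r = b i + r'" "0 < r'" "r' \<le> l i" using False r m_eq[OF i] by (auto simp add: r'_def)
        have "s i + r' \<in> {1..d i}" "d i - (s i + r') = l i - r'"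
          using r' l_le[OF i] by auto
        then have "snd (FA q) i (s i + r') = z ^ (l i - r') *\<^sub>C fst q i + snd q i r"
          using i r' by (simp only: FA_snd shift_large)
        then show ?thesis
          using False i r by (simp add: FA_inv_def x_part_FA r'_def)
      qed
    qed
  qed
qed

lemma FA_FA_inv:
  assumes q: "q \<in> carr (sprod HL TT)"
  shows "FA (FA_inv q) = q"
proof (rule prod_eqI)
  show "fst (FA (FA_inv q)) = fst q"
  proof
    fix i show "fst (FA (FA_inv q)) i = fst q i"
    proof (cases "i \<in> L")
      case True
      then show ?thesis
        using z_power_L[OF True] L_sub[OF True] by (simp add: FA_def FA_inv_def x_part_def scaleC_scaleC)
    next
      case False
      then show ?thesis using q by (auto simp add: FA_def carr_sprod carr_dirsum)
    qed
  qed
  show "snd (FA (FA_inv q)) = snd q"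
  proof (intro ext)
    fix i r
    show "snd (FA (FA_inv q)) i r = snd q i r"
    proof (cases "i \<in> I \<and> r \<in> {1..d i}")
      case False
      moreover from this have "snd q i r = 0" using q by (auto simp add: carr_sprod carr_TT)
      ultimately show ?thesis by (auto simp add: FA_def)
    next
      case True
      then have i: "i \<in> I" and r: "r \<in> {1..d i}" by auto
      consider "r < s i" | "r = s i" | "r > s i" by linarith
      then show ?thesis
      proof cases
        case 1
        then have "r \<in> {1..m i}" "r \<le> b i" using r by auto
        then show ?thesis
          using i r 1 by (simp add: FA_snd shift_small) (simp add: FA_inv_def)
      next
        case 2
        \<comment> \<open>On \<open>L\<close> the value \<open>s i\<close> is 0, outside the range
          of \<open>r\<close>.\<close>
        then have "i \<notin> L" using r L_l by auto
        then show ?thesis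
          using i r 2 z_power[OF i] l_le[OF i]
          by (simp add: FA_snd shift_s) (simp add: FA_inv_def x_part_def scaleC_scaleC)
      next
        case 3
        define r' where "r' = r - s i"
        have r': "r = s i + r'" "0 < r'" "r' \<le> l i" using 3 r by (auto simp add: r'_def)
        have "b i + r' \<in> {1..m i}" "\<not> b i + r' \<le> b i" "b i + r' - b i = r'" "d i - r = l i - r'"
          using r' m_eq[OF i] l_le[OF i] by auto
        then have "snd (FA_inv q) i (b i + r') = snd q i r - z ^ (d i - r) *\<^sub>C x_part q i"
          using i r'(1) by (simp add: FA_inv_def)
        then show ?thesis
          using i r by (simp add: FA_snd) (simp add: r'(1,2) shift_large FA_inv_def)
      qed
    qed
  qed
qed

lemma FA_biso: "biso (sprod HH WW) (sprod HL TT) FA FA_inv"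
  by (simp add: biso_def blin_FA blin_FA_inv FA_inv_FA FA_FA_inv)

text \<open>The bounded extension, to all of \<open>TT\<close>, of minus the first row of block row
  \<open>i\<close> of \<open>T\<close>.\<close>

definition "KS y i = (if i \<in> L then \<Sum>j\<in>I. \<Sum>c=1..d j. K i j (d j - c) (y j c) else 0)"

lemma blin_KS: "blin TT HL KS"
  unfolding KS_def
proof (rule blin_dirsum_map)
  fix i assume i: "i \<in> L"
  have "blin TT (H i) (\<lambda>y. K i j (d j - c) (y j c))" if "j \<in> I" "c \<in> {1..d j}" for j c
    using that i d_pos[of j] by (intro blin_comp[OF HN K_blin blin_TT]) auto
  then show "blin TT (H i) (\<lambda>y. if i \<in> L then \<Sum>j\<in>I. \<Sum>c=1..d j. K i j (d j - c) (y j c) else 0)"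
    using L_sub[OF i] by (intro blin_if_map blin_sum_map blin_zero_map HN)
qed auto

definition "F q = (fst (FA q) + KS (snd (FA q)), snd (FA q))"
definition "F_inv q = FA_inv (fst q - KS (snd q), snd q)"

lemma F_biso: "biso (sprod HH WW) (sprod HL TT) F F_inv"
  unfolding F_def F_inv_def
  using biso_comp[OF HW_N LT_N LT_N FA_biso biso_shear[OF HL_N TT_N blin_KS]] by simp


section \<open>The transformation of the ranges\<close>

text \<open>The geometric sums undo the differences produced by \<open>T - z\<close> where
  \<open>W\<close> has identity rows. On \<open>L\<close> the first component of \<open>q\<close> is
  \<open>A_i u_i\<close>, so \<open>Ai i (fst q i)\<close> restores \<open>u_i\<close>; added to the
  first row of \<open>T - z\<close> it leaves \<open>- z w_(i,1)\<close>, the first row of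
  \<open>W\<close>.\<close>

definition "EA q =
  (\<lambda>i. if i \<in> L then fst q i else if i \<in> I then - A i (snd q i 1) else 0,
   \<lambda>i r. if i \<in> I \<and> r \<in> {1..m i} then
           if r \<le> b i then \<Sum>c=Suc r..s i. z ^ (c - Suc r) *\<^sub>C snd q i c
           else snd q i (s i + (r - b i)) + (if i \<in> L \<and> r = 1 then Ai i (fst q i) else 0)
         else 0)"

text \<open>For \<open>i \<notin> L\<close> this recovers the entries of \<open>t\<close> from the geometric sums in \<open>EA\<close>.\<close>

definition "row_diff v i c = v i (c - 1) - (if c < s i then z *\<^sub>C v i c else 0)"

text \<open>Outside \<open>L\<close> the formula for \<open>row_diff\<close> also covers positions
  \<open>c \<ge> s i\<close>: there it returns entry \<open>c - 1\<close>, which is where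
  \<open>EA\<close> stores entry \<open>c\<close>.\<close>

definition "EA_inv q =
  (\<lambda>i. if i \<in> L then fst q i else 0,
   \<lambda>i c. if i \<in> I \<and> c \<in> {1..d i} then
           if i \<in> L then snd q i c - (if c = 1 then Ai i (fst q i) else 0)
           else if c = 1 then - Ai i (fst q i)
           else row_diff (snd q) i c
         else 0)"

lemma blin_EA: "blin (sprod HL TT) (sprod HH WW) EA"
  unfolding EA_def
proof (intro blin_Pair_map blin_dirsum_map blin_WW_map)
  fix i assume i: "i \<in> I"
  show "blin (sprod HL TT) (H i) (\<lambda>q. if i \<in> L then fst q i else if i \<in> I then - A i (snd q i 1) else 0)"
    using i by (intro blin_if_map blin_LT_fst blin_neg_map blin_comp[OF HN A_blin blin_LT_snd] blin_zero_map HN)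
next
  fix i r assume i: "i \<in> I" "r \<in> {1..m i}"
  show "blin (sprod HL TT) (H i) (\<lambda>q. if i \<in> I \<and> r \<in> {1..m i} then
           if r \<le> b i then \<Sum>c=Suc r..s i. z ^ (c - Suc r) *\<^sub>C snd q i c
           else snd q i (s i + (r - b i)) + (if i \<in> L \<and> r = 1 then Ai i (fst q i) else 0)
         else 0)"
    using i by (intro blin_if_map blin_add_map blin_sum_map blin_scale_map blin_LT_snd
        blin_comp[OF HN Ai_blin blin_LT_fst] blin_zero_map HN) auto
qed (auto dest: L_sub)

lemma blin_EA_inv: "blin (sprod HH WW) (sprod HL TT) EA_inv"
  unfolding EA_inv_def row_diff_def
proof (intro blin_Pair_map blin_TT_map blin_dirsum_map[where I = L])
  fix i assume i: "i \<in> L"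
  show "blin (sprod HH WW) (H i) (\<lambda>q. if i \<in> L then fst q i else 0)"
    using L_sub[OF i] by (intro blin_if_map blin_HW_fst blin_zero_map HN)
next
  fix i c assume i: "i \<in> I" "c \<in> {1..d i}"
  show "blin (sprod HH WW) (H i) (\<lambda>q. if i \<in> I \<and> c \<in> {1..d i} then
           if i \<in> L then snd q i c - (if c = 1 then Ai i (fst q i) else 0)
           else if c = 1 then - Ai i (fst q i)
           else snd q i (c - 1) - (if c < s i then z *\<^sub>C snd q i c else 0)
         else 0)"
    using i by (intro blin_if_map blin_diff_map blin_neg_map blin_scale_map blin_HW_snd
        blin_comp[OF HN Ai_blin blin_HW_fst] blin_zero_map HN)
qed auto

text \<open>Later \<open>t\<close> is a position where \<open>f\<close> vanishes, so that only
  \<open>f r\<close> survives.\<close>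

lemma telescope_scale:
  assumes "r \<le> t"
  shows "(\<Sum>c=Suc r..t. z ^ (c - Suc r) *\<^sub>C (f (c - 1) - z *\<^sub>C f c)) = f r - z ^ (t - r) *\<^sub>C (f t :: 'a::complex_vector)"
  using assms
proof (induction t rule: dec_induct)
  case (step t)
  then show ?case
    by (simp add: Suc_diff_le complex_vector.scale_right_diff_distrib scaleC_scaleC mult.commute)
qed simp

lemma geometric_row_diff:
  assumes "c < t"
  shows "(\<Sum>k=c..t. z ^ (k - c) *\<^sub>C f k) = f c + z *\<^sub>C (\<Sum>k=Suc c..t. z ^ (k - Suc c) *\<^sub>C (f k :: 'a::complex_vector))"
proof -
  have "(\<Sum>k=c..t. z ^ (k - c) *\<^sub>C f k) = f c + (\<Sum>k=Suc c..t. z ^ (k - c) *\<^sub>C f k)"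
    using assms by (simp add: sum.atLeast_Suc_atMost)
  also have "(\<Sum>k=Suc c..t. z ^ (k - c) *\<^sub>C f k) = z *\<^sub>C (\<Sum>k=Suc c..t. z ^ (k - Suc c) *\<^sub>C f k)"
    unfolding complex_vector.scale_sum_right
  proof (rule sum.cong)
    fix k assume "k \<in> {Suc c..t}"
    then have "k - c = Suc (k - Suc c)" by auto
    then show "z ^ (k - c) *\<^sub>C f k = z *\<^sub>C z ^ (k - Suc c) *\<^sub>C f k"
      by (simp add: scaleC_scaleC)
  qed simp
  finally show ?thesis .
qed

lemma EA_snd_small: "i \<in> I \<Longrightarrow> r \<in> {1..b i} \<Longrightarrow> snd (EA q) i r = (\<Sum>c=Suc r..s i. z ^ (c - Suc r) *\<^sub>C snd q i c)"
  by (auto simp add: EA_def)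

lemma EA_snd_large:
  "i \<in> I \<Longrightarrow> r \<in> {1..l i} \<Longrightarrow>
    snd (EA q) i (b i + r) = snd q i (s i + r) + (if i \<in> L \<and> r = 1 then Ai i (fst q i) else 0)"
  using m_eq[of i] L_l[of i] by (auto simp add: EA_def)

lemma EA_inv_EA:
  assumes q: "q \<in> carr (sprod HL TT)"
  shows "EA_inv (EA q) = q"
proof (rule prod_eqI)
  show "fst (EA_inv (EA q)) = fst q"
    using q by (auto simp add: EA_inv_def EA_def carr_sprod carr_dirsum fun_eq_iff)
  show "snd (EA_inv (EA q)) = snd q"
  proof (intro ext)
    fix i c
    show "snd (EA_inv (EA q)) i c = snd q i c"
    proof (cases "i \<in> I \<and> c \<in> {1..d i}")
      case False
      moreover from this have "snd q i c = 0" using q by (auto simp add: carr_sprod carr_TT)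
      ultimately show ?thesis by (auto simp add: EA_inv_def)
    next
      case True
      then have i: "i \<in> I" and c: "c \<in> {1..d i}" by auto
      consider "i \<in> L" | "i \<notin> L" "c = 1" | "i \<notin> L" "c \<noteq> 1" "c < s i" | "i \<notin> L" "c \<noteq> 1" "c = s i"
        | "i \<notin> L" "c > s i" by linarith
      then show ?thesis
      proof cases
        case 1
        then show ?thesis
          using EA_snd_large[OF i, of c q] c i L_l[OF 1] by (simp add: EA_inv_def) (simp add: EA_def)
      next
        case 2
        have x: "snd q i 1 \<in> carr (H i)" using TT_carr q i by (auto simp add: carr_sprod)
        \<comment> \<open>Outside \<open>L\<close> the leading coefficient is everywhere defined, so
          its inverse cancels it on every vector.\<close>
        have "odom (P i i (d i)) = carr (H i)" using P_dom[OF i i, of "d i"] l_less[OF i 2(1)] by simp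
        then have "- Ai i (- A i (snd q i 1)) = snd q i 1"
          using x blin_neg[OF Ai_blin[OF i]] blin_carr[OF A_blin[OF i 2(1)]] Ai_A[OF i] by simp
        then show ?thesis using 2 c i by (simp add: EA_inv_def) (simp add: EA_def)
      next
        case 3
        then have "c - 1 \<in> {1..b i}" "c \<in> {1..b i}" "Suc (c - 1) = c" using c by auto
        then have "snd (EA q) i (c - 1) = (\<Sum>k=c..s i. z ^ (k - c) *\<^sub>C snd q i k)"
          and "snd (EA q) i c = (\<Sum>k=Suc c..s i. z ^ (k - Suc c) *\<^sub>C snd q i k)"
          using EA_snd_small[OF i, of "c - 1" q] EA_snd_small[OF i, of c q] by simp_all
        then have "row_diff (snd (EA q)) i c = snd q i c"
          using geometric_row_diff[OF 3(3), of "snd q i"] 3(3) by (simp add: row_diff_def)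
        then show ?thesis
          using 3 c i by (simp add: EA_inv_def)
      next
        case 4
        then have "c - 1 \<in> {1..b i}" "Suc (c - 1) = c" using c by auto
        then show ?thesis
          using 4 c i EA_snd_small[OF i, of "c - 1" q]
          by (simp add: EA_inv_def row_diff_def)
      next
        case 5
        then have "c - s i \<in> {1..l i}" "b i + (c - s i) = c - 1" "s i + (c - s i) = c" "c \<noteq> 1"
          using c l_less[OF i] by auto
        then show ?thesis
          using 5 c i EA_snd_large[OF i, of "c - s i" q]
          by (simp add: EA_inv_def row_diff_def)
      qed
    qed
  qed
qed

lemma EA_EA_inv:
  assumes q: "q \<in> carr (sprod HH WW)"
  shows "EA (EA_inv q) = q"
proof (rule prod_eqI)
  show "fst (EA (EA_inv q)) = fst q"
  proof
    fix i
    consider "i \<in> L" | "i \<in> I" "i \<notin> L" | "i \<notin> I" by blast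
    then show "fst (EA (EA_inv q)) i = fst q i"
    proof cases
      case 1
      then show ?thesis by (simp add: EA_def EA_inv_def)
    next
      case 2
      have x: "fst q i \<in> carr (H i)" using HH_carr q 2 by (auto simp add: carr_sprod)
      then have "- A i (- Ai i (fst q i)) = fst q i"
        using blin_neg[OF A_blin[OF 2]] blin_carr[OF Ai_blin[OF 2(1)]] A_Ai[OF 2(1)] by simp
      then show ?thesis using 2 d_pos[OF 2(1)] by (simp add: EA_def EA_inv_def)
    next
      case 3
      then show ?thesis using q L_sub by (auto simp add: EA_def carr_sprod carr_dirsum)
    qed
  qed
  show "snd (EA (EA_inv q)) = snd q"
  proof (intro ext)
    fix i r
    show "snd (EA (EA_inv q)) i r = snd q i r"
    proof (cases "i \<in> I \<and> r \<in> {1..m i}")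
      case False
      moreover from this have "snd q i r = 0" using q by (auto simp add: carr_sprod carr_WW)
      ultimately show ?thesis by (auto simp add: EA_def)
    next
      case True
      then have i: "i \<in> I" and r: "r \<in> {1..m i}" by auto
      consider "r \<le> b i" | "r > b i" "i \<in> L" | "r > b i" "i \<notin> L" by linarith
      then show ?thesis
      proof cases
        case 1
        \<comment> \<open>Cutting off at \<open>s i\<close> absorbs the case distinction of
          \<open>row_diff\<close> and makes the telescoping remainder vanish.\<close>
        define f where "f c = (if c < s i then snd q i c else 0)" for c
        have iL: "i \<notin> L" using 1 r L_l by auto
        have "snd (EA (EA_inv q)) i r = (\<Sum>c=Suc r..s i. z ^ (c - Suc r) *\<^sub>C snd (EA_inv q) i c)"
          using 1 r i by (simp add: EA_snd_small)
        also have "\<dots> = (\<Sum>c=Suc r..s i. z ^ (c - Suc r) *\<^sub>C (f (c - 1) - z *\<^sub>C f c))"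
          using 1 r i iL by (intro sum.cong refl) (auto simp add: EA_inv_def row_diff_def f_def)
        also have "\<dots> = f r" using 1 r by (subst telescope_scale) (auto simp add: f_def)
        finally show ?thesis using 1 r by (auto simp add: f_def)
      next
        case 2
        then show ?thesis
          using EA_snd_large[OF i, of r "EA_inv q"] r i L_l[OF 2(2)] d_pos[OF i]
          by (auto simp add: EA_inv_def)
      next
        case 3
        then have "r - b i \<in> {1..l i}" "b i + (r - b i) = r" "s i + (r - b i) = Suc r" "s i + (r - b i) \<in> {1..d i}"
          "\<not> Suc r < s i"
          using r l_less[OF i] m_eq[OF i] by auto
        then show ?thesis
          using EA_snd_large[OF i, of "r - b i" "EA_inv q"] 3 r i
          by (simp add: EA_inv_def row_diff_def)
      qed
    qed
  qed
qed

lemma EA_biso: "biso (sprod HL TT) (sprod HH WW) EA EA_inv"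
  by (simp add: biso_def blin_EA blin_EA_inv EA_inv_EA EA_EA_inv)

text \<open>Being added by a shear, the correction may depend on \<open>v = W(z) w\<close> only. The
  lower entries of \<open>v\<close> already are the differences that \<open>lower_sum\<close>
  consumes; for \<open>upper_sum\<close> they are recovered from the identity rows by
  \<open>row_diff\<close>.\<close>

definition "BV v j = (if j \<in> I then
  \<Sum>i\<in>I. (\<Sum>c=1..l i. lower_sum z (l i) (app j i) c (v i (b i + c)))
       - (\<Sum>c=2..s i. upper_sum z (d i) (app j i) c (row_diff v i c)) else 0)"

lemma blin_row_diff: "i \<in> I \<Longrightarrow> blin WW (H i) (\<lambda>v. row_diff v i c)"
  unfolding row_diff_def by (intro blin_diff_map blin_if_map blin_scale_map blin_WW blin_zero_map HN)

lemma blin_BV: "blin WW HH BV"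
  unfolding BV_def
proof (rule blin_dirsum_map)
  fix j assume j: "j \<in> I"
  have "blin WW (H j) (\<lambda>v. lower_sum z (l i) (app j i) c (v i (b i + c)))" if "i \<in> I" "c \<in> {1..l i}" for i c
    using that j by (intro blin_comp[OF HN blin_lower_sum blin_WW] P_blin HN) auto
  moreover have "blin WW (H j) (\<lambda>v. upper_sum z (d i) (app j i) c (row_diff v i c))"
    if "i \<in> I" "c \<in> {2..s i}" for i c
    using that j by (intro blin_comp[OF HN blin_upper_sum[where l = "l i"] blin_row_diff] P_blin HN) auto
  ultimately show "blin WW (H j) (\<lambda>v. if j \<in> I then
    \<Sum>i\<in>I. (\<Sum>c=1..l i. lower_sum z (l i) (app j i) c (v i (b i + c)))
       - (\<Sum>c=2..s i. upper_sum z (d i) (app j i) c (row_diff v i c)) else 0)"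
    using j by (intro blin_if_map blin_sum_map blin_diff_map blin_zero_map HN)
qed auto

definition "E q = (fst (EA q) + BV (snd (EA q)), snd (EA q))"
definition "E_inv q = EA_inv (fst q - BV (snd q), snd q)"

lemma E_biso: "biso (sprod HL TT) (sprod HH WW) E E_inv"
  unfolding E_def E_inv_def
  using biso_comp[OF LT_N HW_N HW_N EA_biso biso_shear[OF HH_N WW_N blin_BV]] by simp

end

section \<open>From isomorphisms at single points to equivalence\<close>

lemma op_equivalentI:
  assumes N: "complex_normed_space X" "complex_normed_space X'" "complex_normed_space Y" "complex_normed_space Y'"
    and f: "biso X Y f f'" and e: "biso Y' X' e e'"
    and S: "linear_op X X' S" and T: "linear_op Y Y' T"
    and dom: "\<And>x. x \<in> carr X \<Longrightarrow> x \<in> odom S \<longleftrightarrow> f x \<in> odom T"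
    and app: "\<And>x. x \<in> odom S \<Longrightarrow> oapp S x = e (oapp T (f x))"
  shows "\<exists>E F. bounded_op Y' X' E \<and> op_invertible Y' X' E \<and> bounded_op X Y F \<and> op_invertible X Y F \<and>
    S \<doteq> E \<circ>\<^sub>o T \<circ>\<^sub>o F \<and> odom S = {x \<in> carr X. oapp F x \<in> odom T}"
proof (intro exI conjI)
  show "bounded_op Y' X' (map_op Y' e)" "op_invertible Y' X' (map_op Y' e)"
    using biso_map_op[OF N(4,2) e] by simp_all
  show "bounded_op X Y (map_op X f)" "op_invertible X Y (map_op X f)"
    using biso_map_op[OF N(1,3) f] by simp_all
  have *: "odom S = {x \<in> carr X. f x \<in> odom T}"
    using dom linear_op_carr[OF S] by blast
  then show "odom S = {x \<in> carr X. oapp (map_op X f) x \<in> odom T}"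
    by (simp add: map_op_def)
  show "S \<doteq> map_op Y' e \<circ>\<^sub>o T \<circ>\<^sub>o map_op X f"
    using * app linear_op_app[OF T] by (auto simp add: op_eq_def comp_op_def map_op_def)
qed

text \<open>The families \<open>E\<close> and \<open>F\<close> are arbitrary functions of
  \<open>z\<close>, so choices made separately at each point can be combined.\<close>

lemma equivalent_onI:
  assumes "\<And>z. z \<in> \<Omega> \<Longrightarrow> linear_op X X' (S z)" "\<And>z. z \<in> \<Omega> \<Longrightarrow> linear_op Y Y' (T z)"
    and "\<And>z. z \<in> \<Omega> \<Longrightarrow> \<exists>E F. bounded_op Y' X' E \<and> op_invertible Y' X' E \<and>
      bounded_op X Y F \<and> op_invertible X Y F \<and>
      S z \<doteq> E \<circ>\<^sub>o T z \<circ>\<^sub>o F \<and> odom (S z) = {x \<in> carr X. oapp F x \<in> odom (T z)}"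
  shows "equivalent_on \<Omega> X X' S Y Y' T"
proof -
  have "\<exists>E. \<forall>z\<in>\<Omega>. \<exists>F. bounded_op Y' X' (E z) \<and> op_invertible Y' X' (E z) \<and>
      bounded_op X Y F \<and> op_invertible X Y F \<and>
      S z \<doteq> E z \<circ>\<^sub>o T z \<circ>\<^sub>o F \<and> odom (S z) = {x \<in> carr X. oapp F x \<in> odom (T z)}"
    by (rule bchoice) (use assms(3) in blast)
  then obtain E where "\<forall>z\<in>\<Omega>. \<exists>F. bounded_op Y' X' (E z) \<and> op_invertible Y' X' (E z) \<and>
      bounded_op X Y F \<and> op_invertible X Y F \<and>
      S z \<doteq> E z \<circ>\<^sub>o T z \<circ>\<^sub>o F \<and> odom (S z) = {x \<in> carr X. oapp F x \<in> odom (T z)}"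
    by blast
  from bchoice[OF this] show ?thesis
    using assms(1,2) unfolding equivalent_on_def by blast
qed

context operator_matrix_polynomial
begin

section \<open>The equivalence\<close>

text \<open>First row \<open>j\<close> of \<open>T\<close> before multiplication by
  \<open>- A_j^-1\<close>; the unbounded coefficients themselves appear, so it is meaningful on the
  domain of \<open>T\<close>.\<close>

definition "coeff_sum y j = (\<Sum>i\<in>I. \<Sum>c=1..d i. app j i (d i - c) (y i c))"

abbreviation "Pd \<equiv> dirsum_op L H (\<lambda>i. P i i (d i))"
abbreviation "Tz \<equiv> minus_scalar (T_mat n H d P) z"

lemma coeff_dom:
  assumes "y \<in> odom (T_mat n H d P)" "i \<in> I" "j \<in> I" "c \<in> {1..d i}"
  shows "y i c \<in> odom (P j i (d i - c))"
proof (cases "d i - c = l i")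
  case True
  then have "c = s i" "i \<notin> L" using assms l_le L_l by auto
  then show ?thesis using assms True by (simp add: T_mat_dom)
next
  case False
  have "y i c \<in> carr (H i)" using assms by (intro TT_carr) (auto simp add: T_mat_dom)
  then show ?thesis using P_dom[OF assms(3,2) False] by simp
qed

lemma coeff_carr:
  assumes "y \<in> odom (T_mat n H d P)" "i \<in> I" "j \<in> I" "c \<in> {1..d i}"
  shows "app j i (d i - c) (y i c) \<in> carr (H j)"
  using linear_op_app[OF P_lin coeff_dom] assms by blast

lemma coeff_sum_carr: "y \<in> odom (T_mat n H d P) \<Longrightarrow> j \<in> I \<Longrightarrow> coeff_sum y j \<in> carr (H j)"
  unfolding coeff_sum_def by (intro normed_sum HN coeff_carr)

lemma Ai_coeff_sum:
  assumes y: "y \<in> odom (T_mat n H d P)" and j: "j \<in> I"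
  shows "Ai j (coeff_sum y j) = (\<Sum>i\<in>I. \<Sum>c=1..d i. Ai j (app j i (d i - c) (y i c)))"
proof -
  have "Ai j (coeff_sum y j) = (\<Sum>i\<in>I. Ai j (\<Sum>c=1..d i. app j i (d i - c) (y i c)))"
    unfolding coeff_sum_def
    by (rule blin_sum[OF HN Ai_blin]) (use j y coeff_carr HN in \<open>auto intro!: normed_sum\<close>)
  also have "\<dots> = (\<Sum>i\<in>I. \<Sum>c=1..d i. Ai j (app j i (d i - c) (y i c)))"
    by (intro sum.cong refl blin_sum[OF HN Ai_blin] coeff_carr j y)
  finally show ?thesis .
qed

lemma T_row_1:
  assumes "y \<in> odom (T_mat n H d P)" "j \<in> I"
  shows "oapp (T_mat n H d P) y j 1 = - Ai j (coeff_sum y j)"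
  using assms d_pos[of j] by (simp only: Ai_coeff_sum) (simp add: T_mat_app T_mat_dom)

text \<open>On the domain of \<open>T\<close> the closures agree with the operators they close,
  which places the correction in the range of \<open>A_i^-1\<close>.\<close>

lemma KS_coeff_sum:
  assumes "y \<in> odom (T_mat n H d P)" "i \<in> L"
  shows "KS y i = Ai i (coeff_sum y i)"
proof -
  have "K i j (d j - c) (y j c) = Ai i (app i j (d j - c) (y j c))" if "j \<in> I" "c \<in> {1..d j}" for j c
    by (rule K_app) (use that assms d_pos[of j] coeff_dom L_sub in auto)
  then show ?thesis
    using assms by (simp only: Ai_coeff_sum[OF assms(1) L_sub[OF assms(2)]]) (simp add: KS_def)
qed

text \<open>The domain of \<open>T\<close> tests only the entries at \<open>s i\<close>, and these
  are nonzero multiples of \<open>x_i\<close>.\<close>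

lemma FA_dom:
  assumes q: "q \<in> carr (sprod HH WW)"
  shows "snd (FA q) \<in> odom (T_mat n H d P) \<longleftrightarrow> (\<forall>i\<in>I - L. \<forall>j\<in>I. fst q i \<in> odom (P j i (l i)))"
proof -
  have "snd (FA q) \<in> carr TT" using blin_carr[OF blin_FA q] by (auto simp add: carr_sprod)
  moreover have "snd (FA q) i (s i) \<in> odom (P j i (l i)) \<longleftrightarrow> fst q i \<in> odom (P j i (l i))"
    if "i \<in> I - L" "j \<in> I" for i j
    using that linear_op_dom_scale_iff[OF P_lin z_power] by (simp add: FA_snd_s)
  ultimately show ?thesis by (simp add: T_mat_dom)
qed

text \<open>The correction \<open>KS\<close> lies in the range of \<open>A_i^-1\<close>, hence in
  the domain of \<open>A_i\<close>; adding it does not change membership, and \<open>A_i\<close>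
  turns it into the coefficient sum of row \<open>i\<close>.\<close>

lemma F_fst_dom:
  assumes y: "snd (FA q) \<in> odom (T_mat n H d P)" and i: "i \<in> L"
  shows "fst (F q) i \<in> odom (P i i (d i)) \<longleftrightarrow> fst q i \<in> odom (P i i (d i))"
    and "fst q i \<in> odom (P i i (d i)) \<Longrightarrow>
      A i (fst (F q) i) = z ^ d i *\<^sub>C A i (fst q i) + coeff_sum (snd (FA q)) i"
proof -
  have iI: "i \<in> I" using i L_sub by blast
  note lin = P_lin[OF iI iI, of "d i"]
  have F: "fst (F q) i = z ^ d i *\<^sub>C fst q i + Ai i (coeff_sum (snd (FA q)) i)"
    using KS_coeff_sum[OF y i] i by (simp add: F_def FA_fst)
  have S: "Ai i (coeff_sum (snd (FA q)) i) \<in> odom (P i i (d i))"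
    using Ai_odom[OF iI coeff_sum_carr[OF y iI]] .
  show *: "fst (F q) i \<in> odom (P i i (d i)) \<longleftrightarrow> fst q i \<in> odom (P i i (d i))"
  proof
    assume "fst (F q) i \<in> odom (P i i (d i))"
    then have "z ^ d i *\<^sub>C fst q i \<in> odom (P i i (d i))"
      using linear_op_dom_diff[OF lin, of "fst (F q) i", OF _ S] by (simp add: F)
    then show "fst q i \<in> odom (P i i (d i))"
      using linear_op_dom_scale_iff[OF lin z_power_L[OF i]] by simp
  qed (simp add: F linear_op_dom_add[OF lin _ S] linear_op_dom_scale[OF lin])
  assume x: "fst q i \<in> odom (P i i (d i))"
  show "A i (fst (F q) i) = z ^ d i *\<^sub>C A i (fst q i) + coeff_sum (snd (FA q)) i"
    unfolding F using x S A_Ai[OF iI coeff_sum_carr[OF y iI]]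
    by (simp add: linear_op_add[OF lin] linear_op_scale[OF lin] linear_op_dom_scale[OF lin])
qed

text \<open>For \<open>l i = d i\<close> the possibly unbounded coefficient is the leading one, and
  off the diagonal this coefficient is zero by the degree condition.\<close>

lemma P_dom_L: "i \<in> L \<Longrightarrow> (\<forall>j\<in>I. x \<in> odom (P j i (l i))) \<longleftrightarrow> x \<in> odom (P i i (d i))"
  using P_top_dom[of _ i] linear_op_carr[OF P_lin[of i i "d i"]] L_sub[of i] L_l[of i] by metis

lemma F_dom:
  assumes q: "q \<in> carr (sprod HH WW)"
  shows "q \<in> odom (P_mat n H deg P z \<oplus>\<^sub>o W_op n H d l z) \<longleftrightarrow> F q \<in> odom (Pd \<oplus>\<^sub>o Tz)"
proof -
  have Fq: "F q \<in> carr (sprod HL TT)"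
    using blin_carr[OF _ q] F_biso unfolding biso_def by blast
  have "q \<in> odom (P_mat n H deg P z \<oplus>\<^sub>o W_op n H d l z) \<longleftrightarrow>
      (\<forall>i\<in>I - L. \<forall>j\<in>I. fst q i \<in> odom (P j i (l i))) \<and> (\<forall>i\<in>L. \<forall>j\<in>I. fst q i \<in> odom (P j i (l i)))"
    using q L_sub by (auto simp add: oplus_op_def W_op_dom P_mat_dom carr_sprod mem_Times_iff)
  also have "\<dots> \<longleftrightarrow> snd (FA q) \<in> odom (T_mat n H d P) \<and> (\<forall>i\<in>L. fst q i \<in> odom (P i i (d i)))"
    using P_dom_L by (simp add: FA_dom[OF q])
  \<comment> \<open>\<open>F_fst_dom\<close> presupposes the first conjunct: only on the domain of
    \<open>T\<close> is \<open>KS\<close> known to lie in the domain of \<open>A_i\<close>.\<close>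
  also have "\<dots> \<longleftrightarrow> snd (FA q) \<in> odom (T_mat n H d P) \<and> (\<forall>i\<in>L. fst (F q) i \<in> odom (P i i (d i)))"
    using F_fst_dom(1) by blast
  also have "\<dots> \<longleftrightarrow> F q \<in> odom (Pd \<oplus>\<^sub>o Tz)"
    using Fq by (auto simp add: oplus_op_def dirsum_op_def minus_scalar_def mem_Times_iff carr_sprod F_def)
  finally show ?thesis .
qed

text \<open>The powers \<open>z^(d_i - r) x_i\<close> are annihilated by the difference of one entry
  and \<open>z\<close> times the next, so only \<open>f\<close> remains.\<close>

lemma Tz_row:
  assumes i: "i \<in> I" and c: "c \<in> {2..d i}" and y: "snd (FA q) \<in> carr TT"
  shows "oapp Tz (snd (FA q)) i c = shift (snd q) i (c - 1) - z *\<^sub>C shift (snd q) i c"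
proof -
  have c': "c \<in> {1..d i}" "c - 1 \<in> {1..d i}" "d i - (c - 1) = Suc (d i - c)" using c by auto
  then have "snd (FA q) i (c - 1) - z *\<^sub>C snd (FA q) i c = shift (snd q) i (c - 1) - z *\<^sub>C shift (snd q) i c"
    unfolding FA_snd[OF i c'(1)] FA_snd[OF i c'(2)] c'(3) by (simp add: scaleC_add_right scaleC_scaleC)
  then show ?thesis
    using i c by (simp add: minus_scalar_def T_mat_app[OF y])
qed

lemma W_row_small: "i \<in> I \<Longrightarrow> r \<in> {1..b i} \<Longrightarrow> oapp (W_op n H d l z) w i r = w i r"
  by (subst W_op_app) auto

lemma W_row_large:
  "i \<in> I \<Longrightarrow> r \<in> {1..l i} \<Longrightarrow> oapp (W_op n H d l z) w i (b i + r) =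
    (if r > 1 then w i (b i + (r - 1)) else 0) - z *\<^sub>C w i (b i + r)"
  using m_eq[of i] by (subst W_op_app) (auto simp add: Nat.add_diff_assoc)

lemma W_row_outside: "\<not> (i \<in> I \<and> r \<in> {1..m i}) \<Longrightarrow> oapp (W_op n H d l z) w i r = 0"
  unfolding W_op_eq dirsum_op_def matrix_op_def
  by (cases "i \<in> I") (simp_all del: atLeastAtMost_iff)

lemma EA_snd_outside: "\<not> (i \<in> I \<and> r \<in> {1..m i}) \<Longrightarrow> snd (EA q) i r = 0"
  unfolding EA_def snd_conv by (rule if_not_P)

text \<open>Identity rows of \<open>W\<close> arise by telescoping, the rows of \<open>N\<close>
  directly from the differences of \<open>f\<close>. Only the first row for \<open>i \<in> L\<close>
  meets a first row of \<open>T\<close>, which \<open>EA\<close> cancels.\<close>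

lemma E_snd:
  assumes q: "q \<in> odom (P_mat n H deg P z \<oplus>\<^sub>o W_op n H d l z)" and qc: "q \<in> carr (sprod HH WW)"
  shows "snd (EA (oapp (Pd \<oplus>\<^sub>o Tz) (F q))) = oapp (W_op n H d l z) (snd q)" (is "snd (EA ?p) = _")
proof (intro ext)
  fix i r
  have F: "F q \<in> odom (Pd \<oplus>\<^sub>o Tz)" using F_dom[OF qc] q by blast
  then have y: "snd (FA q) \<in> odom (T_mat n H d P)"
    by (simp add: oplus_op_def minus_scalar_def mem_Times_iff F_def)
  then have yc: "snd (FA q) \<in> carr TT" by (simp add: T_mat_dom)
  have p2: "snd ?p = oapp Tz (snd (FA q))" by (simp add: oplus_op_def F_def)
  show "snd (EA ?p) i r = oapp (W_op n H d l z) (snd q) i r"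
  proof (cases "i \<in> I \<and> r \<in> {1..m i}")
    case False
    show ?thesis unfolding EA_snd_outside[OF False] W_row_outside[OF False] ..
  next
    case True
    then have i: "i \<in> I" and r: "r \<in> {1..m i}" by auto
    show ?thesis
    proof (cases "r \<le> b i")
      case True
      then have rb: "r \<in> {1..b i}" using r by auto
      then have "snd (EA ?p) i r = (\<Sum>c=Suc r..s i. z ^ (c - Suc r) *\<^sub>C oapp Tz (snd (FA q)) i c)"
        using i by (simp only: EA_snd_small p2)
      also have "\<dots> = (\<Sum>c=Suc r..s i. z ^ (c - Suc r) *\<^sub>C (shift (snd q) i (c - 1) - z *\<^sub>C shift (snd q) i c))"
        using rb i by (intro sum.cong refl arg_cong[where f = "scaleC _"] Tz_row yc) auto
      \<comment> \<open>The telescoping remainder carries the entry at \<open>s i\<close>, which is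
        the inserted zero.\<close>
      also have "\<dots> = shift (snd q) i r"
        using rb by (subst telescope_scale) (auto simp add: shift_s)
      also have "\<dots> = snd q i r" using rb by (intro shift_small) auto
      finally show ?thesis using i rb by (simp only: W_row_small)
    next
      case False
      define r' where "r' = r - b i"
      have r': "r = b i + r'" "r' \<in> {1..l i}" using False r m_eq[OF i] by (auto simp add: r'_def)
      have "oapp Tz (snd (FA q)) i (s i + r') + (if i \<in> L \<and> r' = 1 then Ai i (fst ?p i) else 0)
        = (if r' > 1 then snd q i (b i + (r' - 1)) else 0) - z *\<^sub>C snd q i (b i + r')"
      proof (cases "i \<in> L \<and> r' = 1")
        case True
        have L: "l i = d i" "s i = 0" "b i = 0" using True L_l by auto
        have x: "fst q i \<in> odom (P i i (d i))"
          using F F_fst_dom(1)[OF y] True by (auto simp add: oplus_op_def dirsum_op_def mem_Times_iff)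
        have "fst ?p i = A i (fst (F q) i)" using True by (simp add: oplus_op_def dirsum_op_def)
        moreover have "fst (F q) i \<in> odom (P i i (d i))" using F_fst_dom(1)[OF y] True x by blast
        ultimately have "Ai i (fst ?p i) = z ^ d i *\<^sub>C fst q i + Ai i (coeff_sum (snd (FA q)) i)"
          using Ai_A[OF i] KS_coeff_sum[OF y] True by (simp add: F_def FA_fst)
        moreover have "z ^ d i = z * z ^ (d i - 1)" using d_pos[OF i] by (cases "d i") auto
        moreover have "snd (FA q) i 1 = z ^ (d i - 1) *\<^sub>C fst q i + snd q i 1"
          using FA_snd[OF i, of 1 q] d_pos[OF i] shift_large[of 1 "snd q" i] L by simp
        ultimately show ?thesis
          using True L T_row_1[OF y i]
          by (simp add: minus_scalar_def scaleC_add_right scaleC_scaleC)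
      next
        case False
        \<comment> \<open>\<open>Tz_row\<close> needs an index of at least 2: outside
          \<open>L\<close> because \<open>s i \<ge> 1\<close>, on \<open>L\<close> because
          \<open>r' = 1\<close> is excluded in this case.\<close>
        have "r' \<ge> 1" "r' \<le> l i" using r'(2) by simp_all
        moreover have "r' \<noteq> 1" if "i \<in> L" using False that by blast
        moreover have "s i \<ge> 1" if "i \<notin> L" using l_less[OF i that] by simp
        ultimately have "2 \<le> s i + r'" "s i + r' \<le> d i" using l_le[OF i] by linarith+
        then have c: "s i + r' \<in> {2..d i}" by simp
        have "s i + r' - 1 = s i + (r' - 1)" using \<open>r' \<ge> 1\<close> by simp
        then have "shift (snd q) i (s i + r' - 1) = (if r' > 1 then snd q i (b i + (r' - 1)) else 0)"
          using shift_large[of "r' - 1" "snd q" i] shift_s[of "snd q" i] \<open>r' \<ge> 1\<close>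
          by (cases "r' > 1") (simp_all only: if_True if_False zero_less_diff, simp)
        moreover have "shift (snd q) i (s i + r') = snd q i (b i + r')"
          using r' by (intro shift_large) auto
        ultimately show ?thesis
          using False Tz_row[OF i c yc] by auto
      qed
      then show ?thesis
        unfolding r'(1) EA_snd_large[OF i r'(2)] W_row_large[OF i r'(2)] p2 .
    qed
  qed
qed

text \<open>Only powers below \<open>d i\<close> arise, since \<open>T\<close> does not contain the
  leading coefficients; the missing term is contributed by \<open>e\<close> in
  \<open>E_fst\<close>.\<close>

lemma coeff_sum_split:
  assumes j: "j \<in> I" and i: "i \<in> I" and x: "x \<in> odom (P j i (l i))" and w: "w \<in> carr WW"
  shows "(\<Sum>c=1..d i. app j i (d i - c) (z ^ (d i - c) *\<^sub>C x + shift w i c))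
    = (\<Sum>k<d i. z ^ k *\<^sub>C app j i k x) + (\<Sum>c=1..d i. app j i (d i - c) (shift w i c))"
proof -
  have xc: "x \<in> carr (H i)" using linear_op_carr[OF P_lin[OF j i] x] .
  have dom: "x \<in> odom (P j i k)" for k
    using x xc P_dom[OF j i] by (cases "k = l i") auto
  \<comment> \<open>The only index with a possibly unbounded coefficient is \<open>c = s i\<close>,
    where \<open>shift\<close> is zero; this legitimates additivity on the domain.\<close>
  have "shift w i c \<in> odom (P j i (d i - c))" if "c \<in> {1..d i}" for c
  proof (cases "d i - c = l i")
    case True
    then have "c = s i" using that l_le[OF i] by auto
    then show ?thesis using linear_op_dom_0[OF P_lin[OF j i]] by (simp add: shift_s)
  next
    case False
    then show ?thesis using P_dom[OF j i] WW_carr[OF w i] normed_0[OF HN[OF i]] by (simp add: shift_def)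
  qed
  then have "(\<Sum>c=1..d i. app j i (d i - c) (z ^ (d i - c) *\<^sub>C x + shift w i c))
    = (\<Sum>c=1..d i. z ^ (d i - c) *\<^sub>C app j i (d i - c) x + app j i (d i - c) (shift w i c))"
    by (intro sum.cong refl)
      (simp add: linear_op_add[OF P_lin[OF j i]] linear_op_scale[OF P_lin[OF j i]]
        linear_op_dom_scale[OF P_lin[OF j i]] dom)
  also have "\<dots> = (\<Sum>c=1..d i. z ^ (d i - c) *\<^sub>C app j i (d i - c) x)
      + (\<Sum>c=1..d i. app j i (d i - c) (shift w i c))"
    by (rule sum.distrib)
  also have "(\<Sum>c=1..d i. z ^ (d i - c) *\<^sub>C app j i (d i - c) x) = (\<Sum>k<d i. z ^ k *\<^sub>C app j i k x)"
    by (rule sum.reindex_bij_witness[where i = "\<lambda>k. d i - k" and j = "\<lambda>c. d i - c"]) auto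
  finally show ?thesis .
qed

lemma shift_carr: "w \<in> carr WW \<Longrightarrow> i \<in> I \<Longrightarrow> shift w i r \<in> carr (H i)"
  using WW_carr HN normed_0 by (simp add: shift_def)

text \<open>Summation by parts in every column, applied to \<open>f = shift w i\<close>, and read
  from right to left.\<close>

lemma BV_W:
  assumes w: "w \<in> carr WW" and j: "j \<in> I"
  shows "BV (oapp (W_op n H d l z) w) j = - (\<Sum>i\<in>I. (\<Sum>c=1..d i. app j i (d i - c) (shift w i c))
    + (if i = j \<and> i \<notin> L then z *\<^sub>C A j (shift w j 1) else 0))"
proof -
  let ?v = "oapp (W_op n H d l z) w"
  have "(\<Sum>c=1..l i. lower_sum z (l i) (app j i) c (?v i (b i + c)))
       - (\<Sum>c=2..s i. upper_sum z (d i) (app j i) c (row_diff ?v i c))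
    = - ((\<Sum>c=1..d i. app j i (d i - c) (shift w i c)) + (if i = j \<and> i \<notin> L then z *\<^sub>C A j (shift w j 1) else 0))"
    if i: "i \<in> I" for i
  proof -
    have zl: "z \<noteq> 0 \<or> l i = 0" using z i by auto
    have low: "(\<Sum>c=1..l i. lower_sum z (l i) (app j i) c (?v i (b i + c))) =
      (\<Sum>c=1..l i. lower_sum z (l i) (app j i) c
        ((if c > 1 then shift w i (s i + (c - 1)) else 0) - z *\<^sub>C shift w i (s i + c)))"
    proof (intro sum.cong refl arg_cong[where f = "lower_sum z (l i) (app j i) _"])
      fix c assume c: "c \<in> {1..l i}"
      have 1: "shift w i (s i + c) = w i (b i + c)"
        and 2: "c > 1 \<Longrightarrow> shift w i (s i + (c - 1)) = w i (b i + (c - 1))"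
        using c by (intro shift_large; simp)+
      show "?v i (b i + c) = (if c > 1 then shift w i (s i + (c - 1)) else 0) - z *\<^sub>C shift w i (s i + c)"
        unfolding W_row_large[OF i c] using 1 2 by (cases "c > 1") (simp_all only: if_True if_False)
    qed
    have up: "(\<Sum>c=2..s i. upper_sum z (d i) (app j i) c (row_diff ?v i c)) =
      (\<Sum>c=2..s i. upper_sum z (d i) (app j i) c (shift w i (c - 1) - z *\<^sub>C shift w i c))"
    proof (intro sum.cong refl arg_cong[where f = "upper_sum z (d i) (app j i) _"])
      fix c assume c: "c \<in> {2..s i}"
      have "?v i (c - 1) = w i (c - 1)" using c by (intro W_row_small[OF i]) auto
      moreover have "?v i c = w i c" if "c < s i" using c that by (intro W_row_small[OF i]) auto
      ultimately show "row_diff ?v i c = shift w i (c - 1) - z *\<^sub>C shift w i c"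
        using c by (auto simp add: row_diff_def shift_def)
    qed
    \<comment> \<open>Off the diagonal the coefficient of index \<open>d i\<close> is zero, and for
      \<open>i \<in> L\<close> the value \<open>s i\<close> is 0.\<close>
    have top: "(if s i > 0 then z *\<^sub>C app j i (d i) (shift w i 1) else 0)
      = (if i = j \<and> i \<notin> L then z *\<^sub>C A j (shift w j 1) else 0)"
      using P_top[OF j i] shift_carr[OF w i] l_le[OF i] L_I[OF i] by auto
    have "(\<Sum>c=1..d i. app j i (d i - c) (shift w i c)) + (if s i > 0 then z *\<^sub>C app j i (d i) (shift w i 1) else 0)
      = (\<Sum>c=2..s i. upper_sum z (d i) (app j i) c (shift w i (c - 1) - z *\<^sub>C shift w i c))
        - (\<Sum>c=1..l i. lower_sum z (l i) (app j i) c
            ((if c > 1 then shift w i (s i + (c - 1)) else 0) - z *\<^sub>C shift w i (s i + c)))"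
      by (rule column_summation_by_parts[OF HN[OF i] HN[OF j]])
        (simp_all only: P_blin[OF j i] P_0[OF j i] shift_carr[OF w i] shift_s l_le[OF i] zl not_False_eq_True)
    then show ?thesis
      unfolding low up top by simp
  qed
  then show ?thesis
    using j by (simp add: BV_def sum_negf del: minus_add_distrib cong: sum.cong)
qed

text \<open>Row \<open>j\<close> of \<open>P(z) x\<close> is assembled from the lower powers in
  \<open>coeff_sum\<close> and the leading term in \<open>e\<close>; the contributions of
  \<open>f\<close> to both are exactly what \<open>BV\<close> subtracts.\<close>

lemma E_fst:
  assumes q: "q \<in> odom (P_mat n H deg P z \<oplus>\<^sub>o W_op n H d l z)" and qc: "q \<in> carr (sprod HH WW)"
    and j: "j \<in> I"
  shows "fst (E (oapp (Pd \<oplus>\<^sub>o Tz) (F q))) j = oapp (P_mat n H deg P z) (fst q) j"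
proof -
  let ?p = "oapp (Pd \<oplus>\<^sub>o Tz) (F q)"
  define x where "x = fst q"
  define w where "w = snd q"
  define y where "y = snd (FA q)"
  have F: "F q \<in> odom (Pd \<oplus>\<^sub>o Tz)" using F_dom[OF qc] q by blast
  then have y: "y \<in> odom (T_mat n H d P)"
    by (simp add: oplus_op_def minus_scalar_def mem_Times_iff F_def y_def)
  have w: "w \<in> carr WW" and xc: "x \<in> carr HH"
    using qc by (auto simp add: carr_sprod w_def x_def)
  have x: "x i \<in> odom (P j i (l i))" if "i \<in> I" for i
    using q that j by (auto simp add: oplus_op_def P_mat_dom x_def)
  \<comment> \<open>The part of the first component beyond the coefficient sum: on \<open>L\<close>
    the leading term itself, otherwise \<open>z A_j y_(j,1)\<close>, which also contains a term in
    \<open>f\<close>.\<close>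
  define e where "e = (if j \<in> L then z ^ d j *\<^sub>C A j (x j) else z *\<^sub>C A j (y j 1))"
  have a: "fst (EA ?p) j = coeff_sum y j + e"
  proof (cases "j \<in> L")
    case True
    have "x j \<in> odom (P j j (d j))" using x[OF j] True L_l by simp
    then have "A j (fst (F q) j) = z ^ d j *\<^sub>C A j (x j) + coeff_sum y j"
      using F_fst_dom(2) y True unfolding x_def y_def by blast
    then show ?thesis using True by (simp add: EA_def oplus_op_def dirsum_op_def e_def)
  next
    case False
    have c: "coeff_sum y j \<in> carr (H j)" "y j 1 \<in> carr (H j)"
      using coeff_sum_carr[OF y j] y TT_carr j by (auto simp add: T_mat_dom)
    have "fst (EA ?p) j = - A j (oapp Tz y j 1)"
      using False j by (simp add: EA_def oplus_op_def F_def y_def)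
    also have "oapp Tz y j 1 = - (Ai j (coeff_sum y j) + z *\<^sub>C y j 1)"
      using T_row_1[OF y j] by (simp add: minus_scalar_def)
    also have "- A j \<dots> = A j (Ai j (coeff_sum y j) + z *\<^sub>C y j 1)"
      using c by (subst blin_neg[OF A_blin[OF j False]])
        (simp_all add: normed_add normed_scale HN j blin_carr[OF Ai_blin[OF j]])
    also have "\<dots> = coeff_sum y j + e"
      using c False A_Ai[OF j c(1)]
      by (simp add: e_def blin_add[OF A_blin[OF j False]] blin_scale[OF A_blin[OF j False]] normed_scale HN j
          blin_carr[OF Ai_blin[OF j]])
    finally show ?thesis .
  qed
  have "coeff_sum y j = (\<Sum>i\<in>I. \<Sum>c=1..d i. app j i (d i - c) (z ^ (d i - c) *\<^sub>C x i + shift w i c))"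
    unfolding coeff_sum_def by (intro sum.cong refl) (simp add: y_def FA_snd x_def w_def)
  also have "\<dots> = (\<Sum>i\<in>I. (\<Sum>k<d i. z ^ k *\<^sub>C app j i k (x i)) + (\<Sum>c=1..d i. app j i (d i - c) (shift w i c)))"
    by (intro sum.cong refl coeff_sum_split j x w)
  finally have cs: "coeff_sum y j = (\<Sum>i\<in>I. \<Sum>k<d i. z ^ k *\<^sub>C app j i k (x i))
      + (\<Sum>i\<in>I. \<Sum>c=1..d i. app j i (d i - c) (shift w i c))"
    by (simp add: sum.distrib)
  \<comment> \<open>Since \<open>y_(j,1) = z^(d_j - 1) x_j + f_(j,1)\<close>, removing the part in
    \<open>f\<close> leaves the leading term in both cases.\<close>
  have top: "e - (if j \<notin> L then z *\<^sub>C A j (shift w j 1) else 0) = z ^ d j *\<^sub>C A j (x j)"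
  proof (cases "j \<in> L")
    case False
    have "y j 1 = z ^ (d j - 1) *\<^sub>C x j + shift w j 1"
      using d_pos[OF j] by (simp add: y_def FA_snd[OF j] x_def w_def)
    moreover have "z * z ^ (d j - 1) = z ^ d j" using d_pos[OF j] by (cases "d j") auto
    ultimately show ?thesis
      using False shift_carr[OF w j] HH_carr[OF xc j]
      by (simp add: e_def blin_add[OF A_blin[OF j False]] blin_scale[OF A_blin[OF j False]] normed_scale HN j
          scaleC_add_right scaleC_scaleC)
  qed (simp add: e_def)
  have "fst (E ?p) j = coeff_sum y j + e + BV (oapp (W_op n H d l z) w) j"
    unfolding E_def using E_snd[OF q qc] a by (simp add: w_def)
  also have "BV (oapp (W_op n H d l z) w) j = - (\<Sum>i\<in>I. \<Sum>c=1..d i. app j i (d i - c) (shift w i c))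
      - (if j \<notin> L then z *\<^sub>C A j (shift w j 1) else 0)"
  proof -
    have "(\<Sum>i\<in>I. if i = j \<and> i \<notin> L then z *\<^sub>C A j (shift w j 1) else 0)
      = (\<Sum>i\<in>I. if i = j then (if j \<notin> L then z *\<^sub>C A j (shift w j 1) else 0) else 0)"
      by (intro sum.cong refl) auto
    then show ?thesis
      unfolding BV_W[OF w j] using j I_fin by (simp add: sum.distrib)
  qed
  also have "coeff_sum y j + e + \<dots> = (\<Sum>i\<in>I. \<Sum>k<d i. z ^ k *\<^sub>C app j i k (x i)) + z ^ d j *\<^sub>C A j (x j)"
    unfolding cs top[symmetric] by simp
  also have "\<dots> = (\<Sum>i\<in>I. (\<Sum>k<d i. z ^ k *\<^sub>C app j i k (x i)) + (if i = j then z ^ d j *\<^sub>C A j (x j) else 0))"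
    using j I_fin by (simp add: sum.distrib)
  also have "\<dots> = (\<Sum>i\<in>I. \<Sum>k\<le>d i. z ^ k *\<^sub>C app j i k (x i))"
  proof (intro sum.cong refl)
    fix i assume i: "i \<in> I"
    have "(if i = j then z ^ d j *\<^sub>C A j (x j) else 0) = z ^ d i *\<^sub>C app j i (d i) (x i)"
      using P_top[OF j i] HH_carr[OF xc i] by auto
    then show "(\<Sum>k<d i. z ^ k *\<^sub>C app j i k (x i)) + (if i = j then z ^ d j *\<^sub>C A j (x j) else 0)
      = (\<Sum>k\<le>d i. z ^ k *\<^sub>C app j i k (x i))"
      by (simp add: lessThan_Suc_atMost[symmetric])
  qed
  finally show ?thesis
    using P_mat_app[OF xc j] by (simp add: x_def)
qed

lemma Pd_lin: "linear_op HL HL Pd"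
  by (intro linear_op_dirsum P_lin HN L_sub)

lemma E_eq:
  assumes q: "q \<in> odom (P_mat n H deg P z \<oplus>\<^sub>o W_op n H d l z)"
  shows "oapp (P_mat n H deg P z \<oplus>\<^sub>o W_op n H d l z) q = E (oapp (Pd \<oplus>\<^sub>o Tz) (F q))"
proof -
  have qc: "q \<in> carr (sprod HH WW)"
    using linear_op_carr[OF linear_op_oplus[OF P_mat_lin W_op_lin] q] .
  have "oapp (Pd \<oplus>\<^sub>o Tz) (F q) \<in> carr (sprod HL TT)"
    using linear_op_app[OF linear_op_oplus[OF Pd_lin linear_op_minus_scalar[OF TT_N T_mat_lin]]] F_dom[OF qc] q
    by blast
  then have "E (oapp (Pd \<oplus>\<^sub>o Tz) (F q)) \<in> carr (sprod HH WW)"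
    using E_biso blin_carr unfolding biso_def by blast
  then have "fst (E (oapp (Pd \<oplus>\<^sub>o Tz) (F q))) \<in> carr HH"
    by (simp add: carr_sprod mem_Times_iff)
  \<comment> \<open>Off \<open>I\<close> both sides vanish; for the left-hand side this comes from
    membership in the carrier of \<open>HH\<close>.\<close>
  then have "fst (E (oapp (Pd \<oplus>\<^sub>o Tz) (F q))) j = oapp (P_mat n H deg P z) (fst q) j" for j
    using E_fst[OF q qc, of j] by (cases "j \<in> I") (auto simp add: carr_dirsum P_mat_eq matrix_op_def)
  then show ?thesis
    using E_snd[OF q qc] by (auto simp add: oplus_op_def E_def prod_eq_iff)
qed

end

section \<open>The explicit transformation\<close>

lemma block_matrix_app:
  assumes "j \<in> I" "r \<in> {1..e j}"
  shows "oapp (matrix_op I I X (\<lambda>j i. matrix_pow (e j) (e i) (H i) (B j i))) x j r =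
    (\<Sum>i\<in>I. \<Sum>c=1..e i. oapp (B j i r c) (x i c))"
  using assms unfolding matrix_op_def by (simp add: sum_fun_apply)

lemma block_matrix_outside:
  assumes "\<not> (j \<in> I \<and> r \<in> {1..e j})"
  shows "oapp (matrix_op I I X (\<lambda>j i. matrix_pow (e j) (e i) (H i) (B j i))) x j r = 0"
  using assms unfolding matrix_op_def
  by (cases "j \<in> I") (simp_all add: sum_fun_apply del: atLeastAtMost_iff)

lemma block_matrix_dom:
  "x \<in> odom (matrix_op I I (\<lambda>i. spow (X i) (e i)) (\<lambda>j i. matrix_pow (e j) (e i) (X i) (B j i))) \<longleftrightarrow>
    x \<in> carr (dirsum I (\<lambda>i. spow (X i) (e i))) \<and>
    (\<forall>i\<in>I. \<forall>j\<in>I. \<forall>c\<in>{1..e i}. \<forall>r\<in>{1..e j}. x i c \<in> odom (B j i r c))"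
  by (auto simp add: matrix_op_def carr_dirsum spow_def)

lemma sum_split_first: "e > 0 \<Longrightarrow> (\<Sum>c=1..e. g c) = g 1 + (\<Sum>c=1..e - 1. g (Suc c :: nat) :: 'a::ab_group_add)"
  using sum.atLeast_Suc_atMost[of 1 e g] sum.shift_bounds_cl_Suc_ivl[of g 1 "e - 1"] by simp

context operator_matrix_polynomial
begin

lemma equivalence:
  "\<exists>E' F'. bounded_op (sprod HL TT) (sprod HH WW) E' \<and> op_invertible (sprod HL TT) (sprod HH WW) E' \<and>
    bounded_op (sprod HH WW) (sprod HL TT) F' \<and> op_invertible (sprod HH WW) (sprod HL TT) F' \<and>
    P_mat n H deg P z \<oplus>\<^sub>o W_op n H d l z \<doteq> E' \<circ>\<^sub>o (Pd \<oplus>\<^sub>o Tz) \<circ>\<^sub>o F' \<and>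
    odom (P_mat n H deg P z \<oplus>\<^sub>o W_op n H d l z) = {x \<in> carr (sprod HH WW). oapp F' x \<in> odom (Pd \<oplus>\<^sub>o Tz)}"
  by (rule op_equivalentI[OF HW_N HW_N LT_N LT_N F_biso E_biso])
    (intro linear_op_oplus P_mat_lin W_op_lin Pd_lin linear_op_minus_scalar TT_N T_mat_lin F_dom E_eq; assumption)+

end

section \<open>Empty \<open>L\<close>: removal of the trivial summand and reordering of the
  spaces\<close>

locale operator_matrix_polynomial_regular = operator_matrix_polynomial +
  assumes L_empty: "L = {}"
begin

lemma not_L: "i \<notin> L"
  by (simp add: L_empty)

lemma HL_carr_0: "x \<in> carr HL \<longleftrightarrow> x = 0"
  by (auto simp add: carr_dirsum L_empty fun_eq_iff)

text \<open>For empty \<open>L\<close> the summand \<open>HL\<close> is the zero space, so the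
  general transformations restrict to \<open>TT\<close> without losing invertibility.\<close>

lemma Pair_0_biso: "biso TT (sprod HL TT) (\<lambda>y. (0, y)) snd"
  unfolding biso_def
  by (auto intro!: blin_Pair_map blin_zero_map blin_id_map blin_snd HL_N TT_N simp add: carr_sprod HL_carr_0)

lemma ET_biso: "biso TT (sprod HH WW) (\<lambda>t. E (0, t)) (\<lambda>q. snd (E_inv q))"
  using biso_comp[OF TT_N LT_N HW_N Pair_0_biso E_biso] .

lemma FT_biso: "biso (sprod HH WW) TT (\<lambda>q. snd (F q)) (\<lambda>y. F_inv (0, y))"
  using biso_comp[OF HW_N LT_N TT_N F_biso biso_sym[OF Pair_0_biso]] .

lemma FT_dom:
  assumes "q \<in> carr (sprod HH WW)"
  shows "q \<in> odom (P_mat n H deg P z \<oplus>\<^sub>o W_op n H d l z) \<longleftrightarrow> snd (F q) \<in> odom Tz"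
proof -
  have "F q \<in> carr (sprod HL TT)" using F_biso assms blin_carr unfolding biso_def by blast
  then have "fst (F q) \<in> odom Pd"
    by (simp add: carr_sprod mem_Times_iff dirsum_op_def L_empty)
  then show ?thesis
    using F_dom[OF assms] by (simp add: oplus_op_def mem_Times_iff)
qed

lemma ET_eq:
  assumes "q \<in> odom (P_mat n H deg P z \<oplus>\<^sub>o W_op n H d l z)"
  shows "oapp (P_mat n H deg P z \<oplus>\<^sub>o W_op n H d l z) q = E (0, oapp Tz (snd (F q)))"
proof -
  have "oapp (Pd \<oplus>\<^sub>o Tz) (F q) = (0, oapp Tz (snd (F q)))"
    by (simp add: oplus_op_def dirsum_op_def L_empty fun_eq_iff)
  then show ?thesis using E_eq[OF assms] by simp
qed

lemma equivalence_regular: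
  "\<exists>E' F'. bounded_op TT (sprod HH WW) E' \<and> op_invertible TT (sprod HH WW) E' \<and>
    bounded_op (sprod HH WW) TT F' \<and> op_invertible (sprod HH WW) TT F' \<and>
    P_mat n H deg P z \<oplus>\<^sub>o W_op n H d l z \<doteq> E' \<circ>\<^sub>o Tz \<circ>\<^sub>o F' \<and>
    odom (P_mat n H deg P z \<oplus>\<^sub>o W_op n H d l z) = {x \<in> carr (sprod HH WW). oapp F' x \<in> odom Tz}"
  by (rule op_equivalentI[OF HW_N HW_N TT_N TT_N FT_biso ET_biso])
    (intro linear_op_oplus P_mat_lin W_op_lin linear_op_minus_scalar TT_N T_mat_lin FT_dom ET_eq; assumption)+

lemma l_lt: "i \<in> I \<Longrightarrow> l i < d i"
  using l_less by (simp add: L_empty)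

lemma m_d: "i \<in> I \<Longrightarrow> m i = d i - 1"
  using l_lt[of i] by auto

text \<open>The reordering that puts \<open>x_i\<close> in front of the entries of
  \<open>w_i\<close>; the sizes match because \<open>m i = d i - 1\<close> when \<open>L\<close> is
  empty.\<close>

definition "glue q = (\<lambda>i r. if i \<in> I \<and> r \<in> {1..d i} then if r = 1 then fst q i else snd q i (r - 1) else 0)"

definition "unglue x =
  (\<lambda>i. if i \<in> I then x i 1 else 0, \<lambda>i r. if i \<in> I \<and> r \<in> {1..m i} then x i (Suc r) else 0)"

lemma glue_biso: "biso (sprod HH WW) TT glue unglue"
  unfolding biso_def
proof (intro conjI ballI)
  show "blin (sprod HH WW) TT glue"
    unfolding glue_def
  proof (rule blin_TT_map)
    fix i r assume i: "i \<in> I" "r \<in> {1..d i}"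
    show "blin (sprod HH WW) (H i) (\<lambda>q. if i \<in> I \<and> r \<in> {1..d i} then if r = 1 then fst q i else snd q i (r - 1) else 0)"
      using i by (intro blin_if_map blin_HW_fst blin_HW_snd blin_zero_map HN)
  qed auto
  show "blin TT (sprod HH WW) unglue"
    unfolding unglue_def
  proof (intro blin_Pair_map blin_WW_map blin_dirsum_map)
    fix i assume i: "i \<in> I"
    show "blin TT (H i) (\<lambda>x. if i \<in> I then x i 1 else 0)"
      using i by (intro blin_if_map blin_TT blin_zero_map HN)
  next
    fix i r assume i: "i \<in> I" "r \<in> {1..m i}"
    show "blin TT (H i) (\<lambda>x. if i \<in> I \<and> r \<in> {1..m i} then x i (Suc r) else 0)"
      using i by (intro blin_if_map blin_TT blin_zero_map HN)
  qed auto
  show "unglue (glue q) = q" if q: "q \<in> carr (sprod HH WW)" for q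
  proof (rule prod_eqI)
    show "fst (unglue (glue q)) = fst q"
      using q d_pos by (auto simp add: unglue_def glue_def fun_eq_iff carr_sprod carr_dirsum Suc_le_eq)
    show "snd (unglue (glue q)) = snd q"
    proof (intro ext)
      fix i r
      show "snd (unglue (glue q)) i r = snd q i r"
      proof (cases "i \<in> I \<and> r \<in> {1..m i}")
        case True
        then have "Suc r \<in> {1..d i}" "Suc r \<noteq> 1" using m_d[of i] by auto
        then show ?thesis using True by (simp add: unglue_def glue_def del: atLeastAtMost_iff)
      next
        case False
        then have "snd q i r = 0" using q by (auto simp only: carr_sprod carr_WW mem_Times_iff)
        then show ?thesis using False unfolding unglue_def snd_conv by (simp only: if_False)
      qed
    qed
  qed
  show "glue (unglue x) = x" if x: "x \<in> carr TT" for x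
  proof (intro ext)
    fix i r
    show "glue (unglue x) i r = x i r"
    proof (cases "i \<in> I \<and> r \<in> {1..d i}")
      case True
      then have "r - 1 \<in> {1..m i}" "Suc (r - 1) = r" if "r \<noteq> 1" using m_d[of i] that by auto
      then show ?thesis using True by (simp add: unglue_def glue_def del: atLeastAtMost_iff One_nat_def)
    next
      case False
      then have "x i r = 0" using x by (auto simp only: carr_TT)
      then show ?thesis using False unfolding glue_def by (simp only: if_False)
    qed
  qed
qed

text \<open>Invertible by construction. It remains to identify them with the stated matrices, so no
  inverse of an explicit matrix has to be computed.\<close>

definition "ET t = glue (E (0, t))"
definition "ET_inv y = snd (E_inv (unglue y))"
definition "FT x = snd (F (unglue x))"
definition "FT_inv y = glue (F_inv (0, y))"

lemma ET_glue_biso: "biso TT TT ET ET_inv"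
  unfolding ET_def ET_inv_def using biso_comp[OF TT_N HW_N TT_N ET_biso glue_biso] .

lemma FT_glue_biso: "biso TT TT FT FT_inv"
  unfolding FT_def FT_inv_def using biso_comp[OF TT_N HW_N TT_N biso_sym[OF glue_biso] FT_biso] .

section \<open>Identification with the explicit matrices\<close>

lemma E_ents_app:
  assumes j: "j \<in> I" and i: "i \<in> I" and c: "c \<in> {1..d i}" and r: "r \<in> {1..d j}" and v: "v \<in> carr (H i)"
  shows "oapp (E_ents H d l P z j i r c) v =
    (if r = 1 then
       if c \<le> s i then - upper_sum z (d i) (app j i) c v else lower_sum z (l i) (app j i) (c - s i) v
     else if j = i then
       if r \<le> s i then if c \<le> s i \<and> r \<le> c then z ^ (c - r) *\<^sub>C v else 0
       else if c = r then v else 0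
     else 0)"
proof -
  have si: "s i \<ge> 1" using l_lt[OF i] by simp
  have alpha: "oapp (E_alpha_ents H d P z i 1 c) v = - upper_sum z (d i) (app i i) c v"
    using c by (cases c) (auto simp add: E_alpha_ents_def scale_op_def sum_op_def upper_sum_def
        atMost_atLeast0[symmetric] lessThan_Suc_atMost simp del: atMost_atLeast0)
  have off: "oapp (E_alpha_off_ents H d P z j i 1 c) v = - upper_sum z (d i) (app j i) c v" if ji: "j \<noteq> i"
  proof (cases "c = 1")
    case True
    then show ?thesis using P_top[OF j i ji v] d_pos[OF i] by (simp add: E_alpha_off_ents_def zero_op_def upper_sum_1)
  next
    case False
    then obtain c' where c': "c = Suc (Suc c')" using c by (cases c; cases "c - 1") auto
    \<comment> \<open>\<open>upper_sum\<close> has one summand more than the off-diagonal entry; it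
      belongs to index \<open>d i\<close> and vanishes, so one formula serves all blocks.\<close>
    have "app j i (d i - c + 1 + Suc c') v = 0"
      using P_top[OF j i ji v] c c' by (simp add: Suc_diff_Suc)
    then show ?thesis
      unfolding c' by (simp add: E_alpha_off_ents_def scale_op_def sum_op_def upper_sum_def
        atLeast0AtMost lessThan_Suc_atMost c')
  qed
  have beta: "oapp (E_beta_ents H l P z j i 1 c') v = lower_sum z (l i) (app j i) c' v" if "c' \<in> {1..l i}" for c'
  proof -
    have e: "{0..l i - c'} = {..<Suc (l i) - c'}" "l i - c' + 1 = Suc (l i) - c'"
      using that by auto
    show ?thesis
      by (simp only: E_beta_ents_def sum_op_def scale_op_def lower_sum_def e lop.simps if_True simp_thms)
  qed
  have c': "c - s i \<in> {1..l i}" if "\<not> c \<le> s i" using that c l_lt[OF i] by auto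
  show ?thesis
  proof (cases "j = i")
    case True
    show ?thesis
    proof (cases "r = 1")
      case True
      then show ?thesis
        using \<open>j = i\<close> si alpha beta[OF c']
        by (simp add: E_ents_def block22_def vcat_def hcat_def del: One_nat_def)
    next
      case False
      have "r - s i = c - s i \<longleftrightarrow> c = r" if "\<not> r \<le> s i" "\<not> c \<le> s i" using that by auto
      then show ?thesis
        using \<open>j = i\<close> False
        by (auto simp add: E_ents_def block22_def vcat_def hcat_def E_alpha_ents_def E_beta_ents_def
            zero_ents_def id_ents_def zero_op_def scalar_op_def)
    qed
  next
    case False
    then show ?thesis
      using off beta[OF c']
      by (cases "r = 1") (simp_all add: E_ents_def hcat_def E_alpha_off_ents_def E_beta_ents_def zero_op_def
          del: One_nat_def)
  qed
qed

text \<open>The alpha entries use indices above \<open>l i\<close> and the beta entries indices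
  below it, so no possibly unbounded coefficient occurs.\<close>

lemma E_ents_dom:
  assumes j: "j \<in> I" and i: "i \<in> I" and c: "c \<in> {1..d i}"
  shows "odom (E_ents H d l P z j i r c) = carr (H i)"
proof -
  have alpha: "odom (E_alpha_ents H d P z i r c) = carr (H i)" if "c \<le> s i" for r
    using that c P_dom[OF i i] l_lt[OF i]
    by (auto simp add: E_alpha_ents_def sum_op_def scale_op_def scalar_op_def zero_op_def)
  have off: "odom (E_alpha_off_ents H d P z j i r c) = carr (H i)" if "c \<le> s i" for r
    using that c P_dom[OF j i] l_lt[OF i]
    by (auto simp add: E_alpha_off_ents_def sum_op_def scale_op_def scalar_op_def zero_op_def)
  have beta: "odom (E_beta_ents H l P z j i r (c - s i)) = carr (H i)" if "\<not> c \<le> s i" for r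
    using that c P_dom[OF j i] l_lt[OF i]
    by (auto simp add: E_beta_ents_def sum_op_def scale_op_def scalar_op_def zero_op_def)
  show ?thesis
    using alpha off beta
    by (cases "j = i") (simp_all add: E_ents_def block22_def vcat_def hcat_def zero_ents_def id_ents_def
        zero_op_def scalar_op_def)
qed

lemma E_mat_eq: "E_mat n H d l P z =
    matrix_op I I (\<lambda>i. spow (H i) (d i)) (\<lambda>j i. matrix_pow (d j) (d i) (H i) (E_ents H d l P z j i))"
  and F_mat_eq: "F_mat n H d l z =
    dirsum_op I (\<lambda>i. spow (H i) (d i)) (\<lambda>i. matrix_pow (d i) (d i) (H i) (F_ents (H i) (d i) (l i) z))"
  and P_ext_eq: "P_ext n H deg d l P z =
    matrix_op I I (\<lambda>i. spow (H i) (d i))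
       (\<lambda>j i. matrix_pow (d j) (d i) (H i)
          (block22 1 1
             (\<lambda>_ _. P_entry H deg P z j i)  (zero_ents (H i))
             (zero_ents (H i))              (if j = i then W_ents (H i) (d i) (l i) z else zero_ents (H i))))"
  by (simp_all only: E_mat_def F_mat_def P_ext_def I)

lemma E_mat_dom: "odom (E_mat n H d l P z) = carr TT"
  unfolding E_mat_eq set_eq_iff block_matrix_dom using TT_carr E_ents_dom by blast

text \<open>Read off from \<open>EA_inv_EA\<close>, because \<open>EA_inv\<close> is given by
  \<open>row_diff\<close> in these rows.\<close>

lemma row_diff_EA:
  assumes "t \<in> carr TT" "i \<in> I" "c \<in> {2..s i}"
  shows "row_diff (snd (EA (0, t))) i c = t i c"
proof -
  have "(0, t) \<in> carr (sprod HL TT)" using assms by (simp add: carr_sprod HL_carr_0)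
  from EA_inv_EA[OF this] have "snd (EA_inv (EA (0, t))) i c = t i c" by simp
  moreover have "i \<notin> L" "c \<noteq> 1" "c \<in> {1..d i}" using assms not_L by auto
  ultimately show ?thesis
    using assms by (simp add: EA_inv_def)
qed

lemma E_mat_app:
  assumes t: "t \<in> carr TT"
  shows "oapp (E_mat n H d l P z) t = ET t"
proof (intro ext)
  fix j r
  show "oapp (E_mat n H d l P z) t j r = ET t j r"
  proof (cases "j \<in> I \<and> r \<in> {1..d j}")
    case False
    then show ?thesis
      unfolding E_mat_eq block_matrix_outside[where e = d, OF False] ET_def glue_def by (simp only: if_False)
  next
    case True
    then have j: "j \<in> I" and r: "r \<in> {1..d j}" by auto
    have tc: "t i c \<in> carr (H i)" if "i \<in> I" for i c using TT_carr[OF t that] .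
    show ?thesis
    proof (cases "r = 1")
      case True
      \<comment> \<open>Splitting at \<open>s i\<close> separates alpha and beta. The summand
        \<open>c = 1\<close> of the alpha part is the contribution of \<open>EA\<close>; everything
        else is the column \<open>i\<close> of \<open>BV\<close>.\<close>
      have *: "(\<Sum>c=1..d i. oapp (E_ents H d l P z j i 1 c) (t i c)) = (if i = j then - A j (t j 1) else 0)
          + ((\<Sum>c=1..l i. lower_sum z (l i) (app j i) c (snd (EA (0, t)) i (b i + c)))
            - (\<Sum>c=2..s i. upper_sum z (d i) (app j i) c (row_diff (snd (EA (0, t))) i c)))"
        if i: "i \<in> I" for i
      proof -
        have d: "d i = s i + l i" and s: "1 \<le> s i" using l_lt[OF i] by auto
        have "(\<Sum>c=1..d i. oapp (E_ents H d l P z j i 1 c) (t i c)) =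
          (\<Sum>c=1..s i + l i. if c \<le> s i then - upper_sum z (d i) (app j i) c (t i c)
            else lower_sum z (l i) (app j i) (c - s i) (t i c))"
          using r by (intro sum.cong) (auto simp add: True E_ents_app[OF j i _ _ tc[OF i]] d[symmetric])
        also have "\<dots> = (\<Sum>c=1..s i. - upper_sum z (d i) (app j i) c (t i c))
          + (\<Sum>c=s i + 1..s i + l i. lower_sum z (l i) (app j i) (c - s i) (t i c))"
          by (subst sum.ub_add_nat) (auto intro!: arg_cong2[where f = "(+)"] sum.cong)
        also have "(\<Sum>c=s i + 1..s i + l i. lower_sum z (l i) (app j i) (c - s i) (t i c))
          = (\<Sum>c=1..l i. lower_sum z (l i) (app j i) c (t i (s i + c)))"
          by (rule sum.reindex_bij_witness[where i = "\<lambda>c. s i + c" and j = "\<lambda>c. c - s i"]) auto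
        also have "\<dots> = (\<Sum>c=1..l i. lower_sum z (l i) (app j i) c (snd (EA (0, t)) i (b i + c)))"
          by (intro sum.cong refl) (simp only: EA_snd_large[OF i] not_L simp_thms if_False add_0_right snd_conv)
        also have "(\<Sum>c=1..s i. - upper_sum z (d i) (app j i) c (t i c)) =
            - upper_sum z (d i) (app j i) 1 (t i 1) - (\<Sum>c=2..s i. upper_sum z (d i) (app j i) c (t i c))"
          using s by (simp add: sum.atLeast_Suc_atMost sum_negf numeral_2_eq_2)
        also have "(\<Sum>c=2..s i. upper_sum z (d i) (app j i) c (t i c)) =
          (\<Sum>c=2..s i. upper_sum z (d i) (app j i) c (row_diff (snd (EA (0, t))) i c))"
          by (intro sum.cong refl) (simp only: row_diff_EA[OF t i])
        also have "- upper_sum z (d i) (app j i) 1 (t i 1) = (if i = j then - A j (t j 1) else 0)"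
          using P_top[OF j i] tc[OF i] d_pos[OF i] by (auto simp add: upper_sum_1)
        finally show ?thesis
          unfolding diff_add_eq add_diff_eq .
      qed
      have "oapp (E_mat n H d l P z) t j 1 = (\<Sum>i\<in>I. \<Sum>c=1..d i. oapp (E_ents H d l P z j i 1 c) (t i c))"
        unfolding E_mat_eq using j r True by (intro block_matrix_app) auto
      also have "\<dots> = (\<Sum>i\<in>I. (if i = j then - A j (t j 1) else 0)
          + ((\<Sum>c=1..l i. lower_sum z (l i) (app j i) c (snd (EA (0, t)) i (b i + c)))
            - (\<Sum>c=2..s i. upper_sum z (d i) (app j i) c (row_diff (snd (EA (0, t))) i c))))"
        by (intro sum.cong refl *)
      also have "\<dots> = - A j (t j 1) + BV (snd (EA (0, t))) j"
        using j I_fin by (subst sum.distrib) (simp add: BV_def)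
      also have "\<dots> = ET t j 1"
        using j d_pos[OF j] by (simp add: ET_def glue_def E_def) (simp add: EA_def not_L)
      finally show ?thesis using True by simp
    next
      case False
      then have r': "r - 1 \<in> {1..m j}" "Suc (r - 1) = r" using r m_d[OF j] by auto
      have "oapp (E_mat n H d l P z) t j r = (\<Sum>i\<in>I. \<Sum>c=1..d i. oapp (E_ents H d l P z j i r c) (t i c))"
        unfolding E_mat_eq by (rule block_matrix_app[where e = d, OF j r])
      also have "\<dots> = (\<Sum>i\<in>I. if i = j then snd (EA (0, t)) j (r - 1) else 0)"
      proof (intro sum.cong refl)
        fix i assume i: "i \<in> I"
        have row: "(\<Sum>c=1..d i. oapp (E_ents H d l P z j i r c) (t i c)) =
          (\<Sum>c=1..d i. if j = i then
              if r \<le> s i then if c \<le> s i \<and> r \<le> c then z ^ (c - r) *\<^sub>C t i c else 0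
              else if c = r then t i c else 0
            else 0)"
          by (rule sum.cong[OF refl]) (simp only: E_ents_app[OF j i _ r tc[OF i]] False if_False)
        show "(\<Sum>c=1..d i. oapp (E_ents H d l P z j i r c) (t i c)) = (if i = j then snd (EA (0, t)) j (r - 1) else 0)"
        proof (cases "i = j")
          case ij: True
          show ?thesis
          proof (cases "r \<le> s j")
            case True
            then have "r - 1 \<in> {1..b j}" using r'(1) by auto
            \<comment> \<open>\<open>glue\<close> moves row \<open>r - 1\<close> to row
              \<open>r\<close>, so the geometric sum starts at \<open>c = r\<close> and yields the
              upper triangular powers \<open>z ^ (c - r)\<close>.\<close>
            then have "snd (EA (0, t)) j (r - 1) = (\<Sum>c=r..s j. z ^ (c - r) *\<^sub>C t j c)"
              using EA_snd_small[OF j, of "r - 1" "(0, t)"] unfolding r'(2) by simp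
            also have "\<dots> = (\<Sum>c=1..d j. if c \<le> s j \<and> r \<le> c then z ^ (c - r) *\<^sub>C t j c else 0)"
              using r by (intro sum.mono_neutral_cong_left) auto
            also have "\<dots> = (\<Sum>c=1..d i. oapp (E_ents H d l P z j i r c) (t i c))"
              unfolding row unfolding ij using True by simp
            finally show ?thesis using ij by simp
          next
            case rs: False
            have "(\<Sum>c=1..d i. oapp (E_ents H d l P z j i r c) (t i c)) = (\<Sum>c=1..d i. if c = r then t i c else 0)"
              unfolding row unfolding ij using rs by simp
            also have "\<dots> = t j r" using r ij by simp
            also have "\<dots> = snd (EA (0, t)) j (r - 1)"
            proof -
              have "r - s j \<in> {1..l j}" "b j + (r - s j) = r - 1" "s j + (r - s j) = r"
                using rs r l_lt[OF j] by auto
              then show ?thesis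
                using EA_snd_large[OF j, of "r - s j" "(0, t)"] by (simp add: not_L)
            qed
            finally show ?thesis using ij by simp
          qed
        next
          case ij: False
          have "(\<Sum>c=1..d i. oapp (E_ents H d l P z j i r c) (t i c)) = (\<Sum>c=1..d i. 0)"
            unfolding row using ij by simp
          then show ?thesis using ij by simp
        qed
      qed
      also have "\<dots> = snd (EA (0, t)) j (r - 1)" using j I_fin by simp
      also have "\<dots> = ET t j r"
        using False True by (simp add: ET_def glue_def E_def)
      finally show ?thesis .
    qed
  qed
qed

text \<open>Two Kronecker terms that never overlap, prepared for \<open>sum.delta\<close>: the first
  gives the multiples of \<open>x_i\<close>, the second is \<open>shift\<close> after
  \<open>unglue\<close>, with row \<open>s i\<close> empty.\<close>

lemma F_ents_app:
  assumes i: "i \<in> I" and r: "r \<in> {1..d i}" and c: "c \<in> {1..d i}"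
  shows "oapp (F_ents (H i) (d i) (l i) z r c) v =
    (if c = 1 then z ^ (d i - r) *\<^sub>C v else 0)
    + (if c = (if r < s i then Suc r else r) then if r = s i then 0 else v else 0)"
proof -
  have s: "1 \<le> s i" and e: "\<not> r \<le> s i \<Longrightarrow> l i - (r - s i) = d i - r"
    and rc: "\<not> r \<le> s i \<Longrightarrow> \<not> c \<le> s i \<Longrightarrow> r - s i = c - s i \<longleftrightarrow> r = c"
    using l_lt[OF i] by auto
  consider "r < s i" | "r = s i" | "r > s i" by linarith
  then show ?thesis
  proof cases
    case 1
    then show ?thesis
      using s r c by (auto simp add: F_ents_def block22_def vcat_def hcat_def F_alpha_ents_def zero_ents_def
          zero_op_def scalar_op_def)
  next
    case 2
    then show ?thesis
      using s r c by (auto simp add: F_ents_def block22_def vcat_def hcat_def F_alpha_ents_def zero_ents_def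
          zero_op_def scalar_op_def)
  next
    case 3
    then show ?thesis
      using s r c e rc by (auto simp add: F_ents_def block22_def vcat_def hcat_def F_beta_ents_def zero_ents_def
          id_ents_def zero_op_def scalar_op_def)
  qed
qed

lemma F_ents_dom: "odom (F_ents X di li z r c) = carr X"
  by (auto simp add: F_ents_def block22_def vcat_def hcat_def F_beta_ents_def F_alpha_ents_def zero_ents_def
          id_ents_def zero_op_def scalar_op_def)

lemma F_mat_dom: "odom (F_mat n H d l z) = carr TT"
proof -
  have "odom (matrix_pow (d i) (d i) (H i) (F_ents (H i) (d i) (l i) z)) = carr (spow (H i) (d i))" for i
    unfolding spow_def by (rule odom_matrix_op_total) (rule F_ents_dom)
  then show ?thesis
    unfolding F_mat_eq by (auto simp add: dirsum_op_def carr_dirsum)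
qed

lemma F_mat_app:
  assumes x: "x \<in> carr TT"
  shows "oapp (F_mat n H d l z) x = FT x"
proof (intro ext)
  fix i r
  show "oapp (F_mat n H d l z) x i r = FT x i r"
  proof (cases "i \<in> I \<and> r \<in> {1..d i}")
    case False
    then have "oapp (F_mat n H d l z) x i r = 0"
      unfolding F_mat_eq dirsum_op_def matrix_op_def
      by (cases "i \<in> I") (simp_all del: atLeastAtMost_iff)
    moreover have "FT x i r = 0"
      unfolding FT_def F_def FA_def snd_conv using False by (rule if_not_P)
    ultimately show ?thesis by simp
  next
    case True
    then have i: "i \<in> I" and r: "r \<in> {1..d i}" by auto
    let ?c = "if r < s i then Suc r else r"
    have c: "?c \<in> {1..d i}" using r by auto
    have "oapp (F_mat n H d l z) x i r = (\<Sum>c=1..d i. oapp (F_ents (H i) (d i) (l i) z r c) (x i c))"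
      unfolding F_mat_eq dirsum_op_def matrix_op_def using i r by simp
    also have "\<dots> = (\<Sum>c=1..d i. (if c = 1 then z ^ (d i - r) *\<^sub>C x i c else 0)
      + (if c = ?c then if r = s i then 0 else x i c else 0))"
      by (intro sum.cong refl F_ents_app i r)
    also have "\<dots> = z ^ (d i - r) *\<^sub>C x i 1 + (if r = s i then 0 else x i ?c)"
      using c d_pos[OF i] unfolding sum.distrib by (simp only: sum.delta finite_atLeastAtMost if_True) simp
    also have "(if r = s i then 0 else x i ?c) = shift (snd (unglue x)) i r"
    proof -
      consider "r < s i" | "r = s i" | "r > s i" by linarith
      then show ?thesis
      proof cases
        case 1
        then have "r \<in> {1..m i}" using r m_d[OF i] by auto
        then show ?thesis using 1 i by (simp add: shift_def unglue_def del: atLeastAtMost_iff)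
      next
        case 3
        then have "b i + (r - s i) = r - 1" "r - 1 \<in> {1..m i}" "Suc (r - 1) = r"
          using m_d[OF i] l_lt[OF i] r by auto
        then show ?thesis using 3 i by (simp only: shift_def unglue_def snd_conv) simp
      qed (simp add: shift_def)
    qed
    also have "z ^ (d i - r) *\<^sub>C x i 1 + shift (snd (unglue x)) i r = FT x i r"
      using i FA_snd[OF i r, of "unglue x"] by (simp add: FT_def F_def) (simp add: unglue_def)
    finally show ?thesis .
  qed
qed

text \<open>Within each block only the entry in the first row and first column can restrict the
  domain.\<close>

lemma P_ext_dom:
  assumes x: "x \<in> carr TT"
  shows "x \<in> odom (P_ext n H deg d l P z) \<longleftrightarrow> unglue x \<in> odom (P_mat n H deg P z \<oplus>\<^sub>o W_op n H d l z)"
proof -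
  have um: "unglue x \<in> carr (sprod HH WW)"
    using glue_biso x blin_carr unfolding biso_def by blast
  have "(\<forall>c\<in>{1..d i}. \<forall>r\<in>{1..d j}. x i c \<in> odom (block22 1 1
             (\<lambda>_ _. P_entry H deg P z j i)  (zero_ents (H i))
             (zero_ents (H i)) (if j = i then W_ents (H i) (d i) (l i) z else zero_ents (H i)) r c))
      \<longleftrightarrow> x i 1 \<in> odom (P_entry H deg P z j i)" if ij: "i \<in> I" "j \<in> I" for i j
  proof -
    have "odom (block22 1 1
             (\<lambda>_ _. P_entry H deg P z j i)  (zero_ents (H i))
             (zero_ents (H i)) (if j = i then W_ents (H i) (d i) (l i) z else zero_ents (H i)) r c)
        = (if r \<le> 1 \<and> c \<le> 1 then odom (P_entry H deg P z j i) else carr (H i))" for r c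
      by (auto simp add: block22_def vcat_def hcat_def zero_ents_def zero_op_def W_ents_dom)
    then show ?thesis
      using TT_carr[OF x ij(1)] d_pos[OF ij(1)] d_pos[OF ij(2)] by (auto simp add: Suc_le_eq le_Suc_eq)
  qed
  then have "x \<in> odom (P_ext n H deg d l P z) \<longleftrightarrow> (\<forall>i\<in>I. \<forall>j\<in>I. x i 1 \<in> odom (P_entry H deg P z j i))"
    unfolding P_ext_eq block_matrix_dom using x by simp
  also have "\<dots> \<longleftrightarrow> unglue x \<in> odom (P_mat n H deg P z \<oplus>\<^sub>o W_op n H d l z)"
    using um by (simp add: oplus_op_def W_op_dom P_mat_dom carr_sprod mem_Times_iff P_entry_dom)
      (simp add: unglue_def)
  finally show ?thesis .
qed

lemma P_ext_app:
  assumes x: "x \<in> carr TT"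
  shows "oapp (P_ext n H deg d l P z) x = glue (oapp (P_mat n H deg P z \<oplus>\<^sub>o W_op n H d l z) (unglue x))"
proof (intro ext)
  fix j r
  let ?B = "\<lambda>j i. block22 1 1
             (\<lambda>_ _. P_entry H deg P z j i)  (zero_ents (H i))
             (zero_ents (H i)) (if j = i then W_ents (H i) (d i) (l i) z else zero_ents (H i))"
  show "oapp (P_ext n H deg d l P z) x j r = glue (oapp (P_mat n H deg P z \<oplus>\<^sub>o W_op n H d l z) (unglue x)) j r"
  proof (cases "j \<in> I \<and> r \<in> {1..d j}")
    case False
    then show ?thesis
      unfolding P_ext_eq block_matrix_outside[where e = d, OF False] glue_def by (simp only: if_False)
  next
    case True
    then have j: "j \<in> I" and r: "r \<in> {1..d j}" by auto
    have *: "oapp (P_ext n H deg d l P z) x j r = (\<Sum>i\<in>I. \<Sum>c=1..d i. oapp (?B j i r c) (x i c))"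
      unfolding P_ext_eq by (rule block_matrix_app[where e = d, OF j r])
    show ?thesis
    proof (cases "r = 1")
      case True
      have "(\<Sum>c=1..d i. oapp (?B j i r c) (x i c)) = oapp (P_entry H deg P z j i) (fst (unglue x) i)"
        if i: "i \<in> I" for i
        using i True by (subst sum_split_first[OF d_pos[OF i]])
          (simp add: block22_def vcat_def hcat_def zero_ents_def zero_op_def unglue_def)
      then have "oapp (P_ext n H deg d l P z) x j r = oapp (P_mat n H deg P z) (fst (unglue x)) j"
        unfolding * P_mat_eq matrix_op_def using j by simp
      then show ?thesis
        using True j r by (simp add: glue_def oplus_op_def)
    next
      case False
      then have r': "r - 1 \<in> {1..m j}" "Suc (r - 1) = r" "\<not> r \<le> 1" using r m_d[OF j] by auto
      have "(\<Sum>c=1..d i. oapp (?B j i r c) (x i c)) =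
          (if i = j then oapp (W_op n H d l z) (snd (unglue x)) j (r - 1) else 0)"
        if i: "i \<in> I" for i
      proof -
        have "(\<Sum>c=1..d i. oapp (?B j i r c) (x i c)) =
            (\<Sum>c=1..m i. if i = j then oapp (W_ents (H i) (d i) (l i) z (r - 1) c) (x i (Suc c)) else 0)"
          unfolding m_d[OF i] using r'(3)
          by (subst sum_split_first[OF d_pos[OF i]])
            (auto simp add: block22_def vcat_def hcat_def zero_ents_def zero_op_def intro!: sum.cong)
        also have "\<dots> = (\<Sum>c=1..m i. if i = j then oapp (W_ents (H i) (d i) (l i) z (r - 1) c) (snd (unglue x) i c) else 0)"
          using i by (intro sum.cong refl) (simp only: unglue_def snd_conv simp_thms if_True)
        also have "\<dots> = (if i = j then oapp (W_op n H d l z) (snd (unglue x)) j (r - 1) else 0)"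
          using j r'(1) unfolding W_op_eq dirsum_op_def matrix_op_def
          by (cases "i = j") (simp_all del: atLeastAtMost_iff)
        finally show ?thesis .
      qed
      then have "oapp (P_ext n H deg d l P z) x j r = oapp (W_op n H d l z) (snd (unglue x)) j (r - 1)"
        unfolding * using j I_fin by simp
      then show ?thesis
        using False True by (simp add: glue_def oplus_op_def)
    qed
  qed
qed

lemma explicit_equivalence:
  "bounded_op TT TT (E_mat n H d l P z) \<and> op_invertible TT TT (E_mat n H d l P z) \<and>
   bounded_op TT TT (F_mat n H d l z) \<and> op_invertible TT TT (F_mat n H d l z) \<and>
   P_ext n H deg d l P z \<doteq> E_mat n H d l P z \<circ>\<^sub>o Tz \<circ>\<^sub>o F_mat n H d l z \<and>
   odom (P_ext n H deg d l P z) = {x \<in> carr TT. oapp (F_mat n H d l z) x \<in> odom (T_mat n H d P)}"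
proof -
  have um: "unglue x \<in> carr (sprod HH WW)" if "x \<in> carr TT" for x
    using glue_biso that blin_carr unfolding biso_def by blast
  have dom: "odom (P_ext n H deg d l P z) = {x \<in> carr TT. FT x \<in> odom Tz}"
  proof -
    have "x \<in> carr TT" if "x \<in> odom (P_ext n H deg d l P z)" for x
      using that unfolding P_ext_eq block_matrix_dom by blast
    moreover have "x \<in> odom (P_ext n H deg d l P z) \<longleftrightarrow> FT x \<in> odom Tz" if "x \<in> carr TT" for x
      unfolding P_ext_dom[OF that] FT_dom[OF um[OF that]] FT_def ..
    ultimately show ?thesis by blast
  qed
  have Tz_carr: "oapp Tz y \<in> carr TT" if "y \<in> odom Tz" for y
    using linear_op_app[OF linear_op_minus_scalar[OF TT_N T_mat_lin] that] .
  have app: "oapp (P_ext n H deg d l P z) x = ET (oapp Tz (FT x))" if "x \<in> odom (P_ext n H deg d l P z)" for x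
  proof -
    have x: "x \<in> carr TT" using that unfolding dom by blast
    show ?thesis
      using that unfolding P_ext_app[OF x] P_ext_dom[OF x] ET_def FT_def by (simp only: ET_eq)
  qed
  \<comment> \<open>\<open>E_mat\<close> is everywhere defined and \<open>T - z\<close> maps into
    its space, so only the condition on \<open>FT x\<close> remains.\<close>
  have comp_dom: "odom (E_mat n H d l P z \<circ>\<^sub>o Tz \<circ>\<^sub>o F_mat n H d l z) = {x \<in> carr TT. FT x \<in> odom Tz}"
    using Tz_carr by (auto simp add: comp_op_def E_mat_dom F_mat_dom F_mat_app)
  have comp_app: "oapp (E_mat n H d l P z \<circ>\<^sub>o Tz \<circ>\<^sub>o F_mat n H d l z) x = ET (oapp Tz (FT x))"
    if "x \<in> carr TT" "FT x \<in> odom Tz" for x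
    using that Tz_carr by (simp add: comp_op_def F_mat_app E_mat_app)
  have "P_ext n H deg d l P z \<doteq> E_mat n H d l P z \<circ>\<^sub>o Tz \<circ>\<^sub>o F_mat n H d l z"
    unfolding op_eq_def comp_dom using app comp_app by (simp add: dom)
  moreover have "odom Tz = odom (T_mat n H d P)" by (simp add: minus_scalar_def)
  then have "odom (P_ext n H deg d l P z) = {x \<in> carr TT. oapp (F_mat n H d l z) x \<in> odom (T_mat n H d P)}"
    unfolding dom using F_mat_app by auto
  moreover have "bounded_op TT TT (E_mat n H d l P z) \<and> op_invertible TT TT (E_mat n H d l P z)"
    by (rule biso_op_invertible[OF TT_N TT_N ET_glue_biso E_mat_dom E_mat_app])
  moreover have "bounded_op TT TT (F_mat n H d l z) \<and> op_invertible TT TT (F_mat n H d l z)"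
    by (rule biso_op_invertible[OF TT_N TT_N FT_glue_biso F_mat_dom F_mat_app])
  ultimately show ?thesis by blast
qed

end

section \<open>Assembly of the pointwise results over the parameter domain\<close>

theorem theorem4p1:
  fixes n :: nat
    and H :: "nat \<Rightarrow> 'v::complex_vector nspace"
    and deg :: "nat \<Rightarrow> nat \<Rightarrow> nat"
    and d l :: "nat \<Rightarrow> nat"
    and P :: "nat \<Rightarrow> nat \<Rightarrow> nat \<Rightarrow> ('v, 'v) lop"
    and \<Omega> :: "complex set"
    and L :: "nat set"
  assumes H: "\<And>i. i \<in> {1..n} \<Longrightarrow> complex_banach_space (H i)"
    and P: "\<And>j i k. j \<in> {1..n} \<Longrightarrow> i \<in> {1..n} \<Longrightarrow> k \<le> deg j i \<Longrightarrow>
              linear_op (H i) (H j) (P j i k)"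
    and P_zero: "\<And>j i k. j \<in> {1..n} \<Longrightarrow> i \<in> {1..n} \<Longrightarrow> k > deg j i \<Longrightarrow> P j i k \<doteq> zero_op (H i)"
    and d: "\<And>i. i \<in> {1..n} \<Longrightarrow> d i = deg i i"
    and d_pos: "\<And>i. i \<in> {1..n} \<Longrightarrow> d i > 0"
    and d_gt: "\<And>j i. j \<in> {1..n} \<Longrightarrow> i \<in> {1..n} \<Longrightarrow> j \<noteq> i \<Longrightarrow> d i > deg j i"
    and lead: "\<And>i. i \<in> {1..n} \<Longrightarrow> op_invertible (H i) (H i) (P i i (d i))"
    and l: "\<And>i. i \<in> {1..n} \<Longrightarrow> l i \<in> {0..d i}"
    and bdd: "\<And>j i k. j \<in> {1..n} \<Longrightarrow> i \<in> {1..n} \<Longrightarrow> k \<noteq> l i \<Longrightarrow> bounded_op (H i) (H j) (P j i k)"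
    and clos: "\<And>i j k. i \<in> {1..n} \<Longrightarrow> l i = d i \<Longrightarrow> j \<in> {1..n} \<Longrightarrow> k < d j \<Longrightarrow>
              closable (H j) (H i) (P_hat d P i j k) \<and>
              bounded_op (H j) (H i) (op_closure (H j) (H i) (P_hat d P i j k))"
    and \<Omega>: "\<Omega> = (if \<forall>i\<in>{1..n}. l i = 0 then UNIV else UNIV - {0})"
    and L: "L = {i \<in> {1..n}. l i = d i}"
  shows "(L = {} \<longrightarrow>
            equivalent_on \<Omega>
              (sprod (dirsum {1..n} H) (W_space n H d l)) (sprod (dirsum {1..n} H) (W_space n H d l))
              (\<lambda>z. P_mat n H deg P z \<oplus>\<^sub>o W_op n H d l z)
              (dirsum {1..n} (\<lambda>i. spow (H i) (d i))) (dirsum {1..n} (\<lambda>i. spow (H i) (d i)))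
              (\<lambda>z. minus_scalar (T_mat n H d P) z)) \<and>
         (L \<noteq> {} \<longrightarrow>
            equivalent_on \<Omega>
              (sprod (dirsum {1..n} H) (W_space n H d l)) (sprod (dirsum {1..n} H) (W_space n H d l))
              (\<lambda>z. P_mat n H deg P z \<oplus>\<^sub>o W_op n H d l z)
              (sprod (dirsum L H) (dirsum {1..n} (\<lambda>i. spow (H i) (d i))))
              (sprod (dirsum L H) (dirsum {1..n} (\<lambda>i. spow (H i) (d i))))
              (\<lambda>z. dirsum_op L H (\<lambda>i. P i i (d i)) \<oplus>\<^sub>o minus_scalar (T_mat n H d P) z)) \<and>
         (L = {} \<longrightarrow>
            (\<forall>z\<in>\<Omega>.
               let X = dirsum {1..n} (\<lambda>i. spow (H i) (d i)) in
               bounded_op X X (E_mat n H d l P z) \<and> op_invertible X X (E_mat n H d l P z) \<and>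
               bounded_op X X (F_mat n H d l z) \<and> op_invertible X X (F_mat n H d l z) \<and>
               P_ext n H deg d l P z
                 \<doteq> E_mat n H d l P z \<circ>\<^sub>o minus_scalar (T_mat n H d P) z \<circ>\<^sub>o F_mat n H d l z \<and>
               odom (P_ext n H deg d l P z) =
                 {x \<in> carr X. oapp (F_mat n H d l z) x \<in> odom (T_mat n H d P)}))"
proof -
  let ?HH = "dirsum {1..n} H" and ?WW = "W_space n H d l"
    and ?TT = "dirsum {1..n} (\<lambda>i. spow (H i) (d i))"
  \<comment> \<open>The parameter domain omits 0 unless all \<open>l i\<close> vanish, which is the
    condition on \<open>z\<close> under which the divisions are legitimate.\<close>
  have loc: "operator_matrix_polynomial n H deg d l P z {1..n} L" if "z \<in> \<Omega>" for z
  proof (rule operator_matrix_polynomial.intro)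
    show "z \<noteq> 0 \<or> (\<forall>i\<in>{1..n}. l i = 0)"
      using that \<Omega> by (auto split: if_splits)
  qed (fact refl H P P_zero d d_pos d_gt lead l bdd clos L)+
  have reg: "operator_matrix_polynomial_regular n H deg d l P z {1..n} L" if "z \<in> \<Omega>" "L = {}" for z
    by (intro operator_matrix_polynomial_regular.intro loc operator_matrix_polynomial_regular_axioms.intro that)
  note lin = operator_matrix_polynomial.P_mat_lin[OF loc] operator_matrix_polynomial.W_op_lin[OF loc]
    operator_matrix_polynomial.Pd_lin[OF loc]
    linear_op_minus_scalar[OF operator_matrix_polynomial.TT_N[OF loc] operator_matrix_polynomial.T_mat_lin[OF loc]]
  show ?thesis
  proof (intro conjI impI ballI)
    assume L0: "L = {}"
    show "equivalent_on \<Omega> (sprod ?HH ?WW) (sprod ?HH ?WW) (\<lambda>z. P_mat n H deg P z \<oplus>\<^sub>o W_op n H d l z)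
        ?TT ?TT (\<lambda>z. minus_scalar (T_mat n H d P) z)"
      by (rule equivalent_onI)
        (intro linear_op_oplus lin operator_matrix_polynomial_regular.equivalence_regular[OF reg] L0; assumption)+
  next
    show "equivalent_on \<Omega> (sprod ?HH ?WW) (sprod ?HH ?WW) (\<lambda>z. P_mat n H deg P z \<oplus>\<^sub>o W_op n H d l z)
        (sprod (dirsum L H) ?TT) (sprod (dirsum L H) ?TT)
        (\<lambda>z. dirsum_op L H (\<lambda>i. P i i (d i)) \<oplus>\<^sub>o minus_scalar (T_mat n H d P) z)"
      by (rule equivalent_onI)
        (intro linear_op_oplus lin operator_matrix_polynomial.equivalence[OF loc]; assumption)+
  next
    fix z assume "L = {}" "z \<in> \<Omega>"
    then show "let X = ?TT in
        bounded_op X X (E_mat n H d l P z) \<and> op_invertible X X (E_mat n H d l P z) \<and>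
        bounded_op X X (F_mat n H d l z) \<and> op_invertible X X (F_mat n H d l z) \<and>
        P_ext n H deg d l P z
          \<doteq> E_mat n H d l P z \<circ>\<^sub>o minus_scalar (T_mat n H d P) z \<circ>\<^sub>o F_mat n H d l z \<and>
        odom (P_ext n H deg d l P z) =
          {x \<in> carr X. oapp (F_mat n H d l z) x \<in> odom (T_mat n H d P)}"
      unfolding Let_def by (intro operator_matrix_polynomial_regular.explicit_equivalence[OF reg])
  qed
qed

end
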